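(* Let $\rho>0$ and let $\delta_\rho:[\mathcal C_\rho]_{<1}\times[\mathcal C_\rho]_{<1}\to[0,\infty)$ be the hyperbolic metric. If $X,Y\in[\mathcal C_\rho]_{<1}$, then $$\delta_\rho(X,Y)=\ln\max\left\{\left\|C_{\rho,X}C_{\rho,Y}^{-1}\right\|,\left\|C_{\rho,Y}C_{\rho,X}^{-1}\right\|\right\},$$ where $$C_{\rho,X}:=\Delta_{\rho,X}(I-R_X)^{-1},\qquad \Delta_{\rho,X}:=\left[\rho I+(1-\rho)(R_X^*+R_X)+(\rho-2)R_X^*R_X\right]^{1/2},$$ and $R_X:=X_1^*\otimes R_1+\cdots+X_n^*\otimes R_n$ is the reconstruction operator associated with the right creation operators $R_1,\ldots,R_n$ and $X=(X_1,\ldots,X_n)\in[\mathcal C_\rho]_{<1}$.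
   Context: Let $n\ge1$, $\mathcal H$ a complex Hilbert space, $\mathcal K$ an infinite-dimensional Hilbert space. $\mathbb F_n^+$ is the unital free semigroup on generators $g_1,\ldots,g_n$ with identity $g_0$. $T_\alpha:=T_{i_1}\cdots T_{i_k}$ if $\alpha=g_{i_1}\cdots g_{i_k}$, $T_{g_0}:=I$. $T\in B(\mathcal H)^n$ is in the class $\mathcal C_\rho$ if there exist a Hilbert space $\mathcal G\supseteq\mathcal H$ and isometries $V_1,\ldots,V_n\in B(\mathcal G)$ with mutually orthogonal ranges such that $T_\alpha=\rho P_{\mathcal H}V_\alpha|_{\mathcal H}$ for all $\alpha\ne g_0$. $\omega_\rho(T):=\inf\{t>0:\frac1tT\in\mathcal C_\rho\}$ and $[\mathcal C_\rho]_{<1}:=\{X\in B(\mathcal H)^n:\omega_\rho(X)<1\}$. $R_i\varphi:=\varphi\otimes e_i$ are the right creation operators on the full Fock space $F^2(H_n)=\mathbb C1\oplus\bigoplus_{k\ge1}H_n^{\otimes k}$ ($e_1,\ldots,e_n$ an orthonormal basis of the $n$-dimensional Hilbert space $H_n$); $R_X$ acts on $\mathcal H\otimes F^2(H_n)$. Harnack domination: for $A,B\in\mathcal C_\rho$ and $c>0$, $A\overset{H}{\underset c\prec}B$ means $\Re p(A)+(\rho-1)\Re p(0)\le c^2[\Re p(B)+(\rho-1)\Re p(0)]$ for every noncommutative polynomial $p\in\mathbb C[X_1,\ldots,X_n]\otimes M_m$, $m\in\mathbb N$, such that $\Re p(X):=\frac12(p(X)^*+p(X))\ge0$ for all $X\in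 B(\mathcal K)^n$ with $\|\sum_iX_iX_i^*\|<1$; here $p(A)=\sum_\alpha A_\alpha\otimes M_\alpha$ for $p=\sum_\alpha X_\alpha\otimes M_\alpha$. $A\overset{H}{\underset c\sim}B$ means $A\overset{H}{\underset c\prec}B$ and $B\overset{H}{\underset c\prec}A$; $A\overset{H}{\sim}B$ means this holds for some $c\ge1$. The equivalence classes of $\overset{H}{\sim}$ are the Harnack parts of $\mathcal C_\rho$; $[\mathcal C_\rho]_{<1}$ is the Harnack part containing $0$. On a Harnack part, the hyperbolic metric is $\delta_\rho(A,B):=\ln\inf\{c>1:A\overset{H}{\underset c\sim}B\}$. *)

theory Defs
  imports "HOL-Analysis.Analysis"
begin

section \<open>Complex Hilbert spaces\<close>

text \<open>The inner product is linear in its first argument.\<close>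

class chilbert_space = real_inner + complete_space +
  fixes scaleC :: "complex \<Rightarrow> 'a \<Rightarrow> 'a"  (infixr "*\<^sub>C" 75)
    and cinner :: "'a \<Rightarrow> 'a \<Rightarrow> complex"
  assumes scaleC_add_right: "c *\<^sub>C (x + y) = c *\<^sub>C x + c *\<^sub>C y"
    and scaleC_add_left: "(c + d) *\<^sub>C x = c *\<^sub>C x + d *\<^sub>C x"
    and scaleC_scaleC: "c *\<^sub>C (d *\<^sub>C x) = (c * d) *\<^sub>C x"
    and scaleC_of_real: "complex_of_real r *\<^sub>C x = r *\<^sub>R x"
    and cinner_commute: "cinner x y = cnj (cinner y x)"
    and cinner_add_left: "cinner (x + y) z = cinner x z + cinner y z"
    and cinner_scaleC_left: "cinner (c *\<^sub>C x) y = c * cinner x y"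
    and Re_cinner: "Re (cinner x y) = inner x y"

instantiation complex :: chilbert_space
begin

definition scaleC_complex :: "complex \<Rightarrow> complex \<Rightarrow> complex"
  where "scaleC_complex c x = c * x"

definition cinner_complex :: "complex \<Rightarrow> complex \<Rightarrow> complex"
  where "cinner_complex x y = x * cnj y"

instance
  by standard
    (auto simp: scaleC_complex_def cinner_complex_def algebra_simps scaleR_conv_of_real
      inner_complex_def)

end

lemma scaleC_one [simp]: "1 *\<^sub>C x = (x :: 'a::chilbert_space)"
  using scaleC_of_real[of 1 x] by simp

global_interpretation complex_vector: vector_space "scaleC :: complex \<Rightarrow> 'a \<Rightarrow> 'a::chilbert_space"
  by standard (auto simp: scaleC_add_right scaleC_add_left scaleC_scaleC)

lemma cinner_add_right:
  "cinner (x :: 'a::chilbert_space) (y + z) = cinner x y + cinner x z"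
  by (metis cinner_add_left cinner_commute complex_cnj_add)

lemma cinner_scaleC_right:
  "cinner (x :: 'a::chilbert_space) (c *\<^sub>C y) = cnj c * cinner x y"
  by (metis cinner_commute cinner_scaleC_left complex_cnj_mult)

lemma cinner_zero_left [simp]: "cinner 0 (x :: 'a::chilbert_space) = 0"
  using cinner_add_left[of 0 0 x] by simp

lemma cinner_zero_right [simp]: "cinner (x :: 'a::chilbert_space) 0 = 0"
  using cinner_add_right[of x 0 0] by simp

lemma cinner_minus_left: "cinner (- x :: 'a::chilbert_space) y = - cinner x y"
  using cinner_add_left[of x "- x" y] by (simp add: eq_neg_iff_add_eq_0 add.commute)

lemma cinner_minus_right: "cinner (x :: 'a::chilbert_space) (- y) = - cinner x y"
  using cinner_add_right[of x y "- y"] by (simp add: eq_neg_iff_add_eq_0 add.commute)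

lemma cinner_diff_left: "cinner (x - y :: 'a::chilbert_space) z = cinner x z - cinner y z"
  using cinner_add_left[of x "- y" z] by (simp add: cinner_minus_left)

lemma cinner_diff_right: "cinner (x :: 'a::chilbert_space) (y - z) = cinner x y - cinner x z"
  using cinner_add_right[of x y "- z"] by (simp add: cinner_minus_right)

lemma cinner_sum_left: "cinner (sum f A) (y :: 'a::chilbert_space) = (\<Sum>i\<in>A. cinner (f i) y)"
  by (induction A rule: infinite_finite_induct) (auto simp: cinner_add_left)

lemma cinner_sum_right: "cinner (y :: 'a::chilbert_space) (sum f A) = (\<Sum>i\<in>A. cinner y (f i))"
  by (induction A rule: infinite_finite_induct) (auto simp: cinner_add_right)

lemma Im_cinner: "Im (cinner (x :: 'a::chilbert_space) y) = inner x (\<i> *\<^sub>C y)"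
  using Re_cinner[of x "\<i> *\<^sub>C y"] by (simp add: cinner_scaleC_right)

lemma cinner_self: "cinner (x :: 'a::chilbert_space) x = complex_of_real ((norm x)\<^sup>2)"
proof (rule complex_eqI)
  show "Re (cinner x x) = Re (complex_of_real ((norm x)\<^sup>2))"
    by (simp add: Re_cinner power2_norm_eq_inner)
  have "Im (cinner x x) = - Im (cinner x x)"
    using cinner_commute[of x x] by (metis cnj.simps(2))
  then show "Im (cinner x x) = Im (complex_of_real ((norm x)\<^sup>2))"
    by simp
qed

lemma norm_scaleC [simp]: "norm (c *\<^sub>C (x :: 'a::chilbert_space)) = cmod c * norm x"
proof -
  have "cinner (c *\<^sub>C x) (c *\<^sub>C x) = (c * cnj c) * cinner x x"
    by (simp add: cinner_scaleC_left cinner_scaleC_right)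
  then have "complex_of_real ((norm (c *\<^sub>C x))\<^sup>2) = complex_of_real ((cmod c * norm x)\<^sup>2)"
    by (simp only: cinner_self complex_norm_square[symmetric] power_mult_distrib of_real_mult)
  then have "(norm (c *\<^sub>C x))\<^sup>2 = (cmod c * norm x)\<^sup>2"
    using of_real_eq_iff by blast
  then show ?thesis
    by (simp add: power2_eq_iff_nonneg)
qed

lemma cmod_cinner_le: "cmod (cinner (x :: 'a::chilbert_space) y) \<le> norm x * norm y"
proof (cases "cinner x y = 0")
  case False
  define u where "u = cnj (cinner x y) / complex_of_real (cmod (cinner x y))"
  have u: "cmod u = 1"
    using False by (simp add: u_def norm_divide)
  have "u * cinner x y = complex_of_real (cmod (cinner x y))"
    using False by (simp add: u_def complex_norm_square[symmetric] mult.commute power2_eq_square field_simps)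
  then have "cmod (cinner x y) = Re (cinner (u *\<^sub>C x) y)"
    by (simp add: cinner_scaleC_left)
  also have "\<dots> \<le> norm (u *\<^sub>C x) * norm y"
    by (simp only: Re_cinner norm_cauchy_schwarz)
  finally show ?thesis
    by (simp add: u)
qed simp

definition bounded_clinear :: "('a::chilbert_space \<Rightarrow> 'b::chilbert_space) \<Rightarrow> bool"
  where "bounded_clinear f \<longleftrightarrow> bounded_linear f \<and> (\<forall>c x. f (c *\<^sub>C x) = c *\<^sub>C f x)"

definition cadj :: "('a::chilbert_space \<Rightarrow> 'b::chilbert_space) \<Rightarrow> 'b \<Rightarrow> 'a"
  where "cadj f = (THE g. \<forall>x y. cinner (f x) y = cinner x (g y))"

definition positive_op :: "('a::chilbert_space \<Rightarrow> 'a) \<Rightarrow> bool"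
  where "positive_op A \<longleftrightarrow>
    bounded_clinear A \<and> (\<forall>x. Im (cinner (A x) x) = 0 \<and> 0 \<le> Re (cinner (A x) x))"

definition op_sqrt :: "('a::chilbert_space \<Rightarrow> 'a) \<Rightarrow> 'a \<Rightarrow> 'a"
  where "op_sqrt A = (THE S. positive_op S \<and> S \<circ> S = A)"

definition infinite_dimensional :: "'a::chilbert_space itself \<Rightarrow> bool"
  where "infinite_dimensional _ \<longleftrightarrow>
    \<not> (\<exists>B :: 'a set. finite B \<and> complex_vector.span B = UNIV)"

definition isometry_between ::
    "'a::chilbert_space set \<Rightarrow> 'b::chilbert_space set \<Rightarrow> ('a \<Rightarrow> 'b) \<Rightarrow> bool"
  where "isometry_between A B f \<longleftrightarrow>
    f ` A \<subseteq> B \<and> (\<forall>x\<in>A. \<forall>y\<in>A. f (x + y) = f x + f y) \<and>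
    (\<forall>c. \<forall>x\<in>A. f (c *\<^sub>C x) = c *\<^sub>C f x) \<and> (\<forall>x\<in>A. norm (f x) = norm x)"


section \<open>Square-summable families\<close>

typedef (overloaded) ('i, 'a::chilbert_space) ell2 =
  "{f :: 'i \<Rightarrow> 'a. (\<lambda>i. (norm (f i))\<^sup>2) summable_on UNIV}"
  by (rule exI[of _ "\<lambda>_. 0"]) simp

setup_lifting type_definition_ell2

lemma ell2_bound: "(norm (x + y :: 'a::real_normed_vector))\<^sup>2 \<le> 2 * (norm x)\<^sup>2 + 2 * (norm y)\<^sup>2"
proof -
  have "(norm (x + y))\<^sup>2 \<le> (norm x + norm y)\<^sup>2"
    by (intro power_mono norm_triangle_ineq) auto
  also have "\<dots> \<le> 2 * (norm x)\<^sup>2 + 2 * (norm y)\<^sup>2"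
    using sum_squares_bound[of "norm x" "norm y"] by (simp add: power2_sum)
  finally show ?thesis .
qed

lemma ell2_add_closed:
  fixes f g :: "'i \<Rightarrow> 'a::real_normed_vector"
  assumes "(\<lambda>i. (norm (f i))\<^sup>2) summable_on UNIV" "(\<lambda>i. (norm (g i))\<^sup>2) summable_on UNIV"
  shows "(\<lambda>i. (norm (f i + g i))\<^sup>2) summable_on UNIV"
proof (rule summable_on_comparison_test)
  show "(\<lambda>i. 2 * (norm (f i))\<^sup>2 + 2 * (norm (g i))\<^sup>2) summable_on UNIV"
    by (intro summable_on_add summable_on_cmult_right assms)
qed (auto simp: ell2_bound)

lemma ell2_cinner_summable:
  fixes f g :: "'i \<Rightarrow> 'a::chilbert_space"
  assumes "(\<lambda>i. (norm (f i))\<^sup>2) summable_on UNIV" "(\<lambda>i. (norm (g i))\<^sup>2) summable_on UNIV"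
  shows "(\<lambda>i. cinner (f i) (g i)) summable_on UNIV"
proof (rule abs_summable_summable, rule summable_on_comparison_test)
  show "(\<lambda>i. (norm (f i))\<^sup>2 + (norm (g i))\<^sup>2) summable_on UNIV"
    by (intro summable_on_add assms)
  fix i
  have "cmod (cinner (f i) (g i)) \<le> norm (f i) * norm (g i)"
    by (rule cmod_cinner_le)
  also have "\<dots> \<le> (norm (f i))\<^sup>2 + (norm (g i))\<^sup>2"
    using sum_squares_bound[of "norm (f i)" "norm (g i)"]
      mult_nonneg_nonneg[OF norm_ge_zero norm_ge_zero, of "f i" "g i"] by linarith
  finally show "cmod (cinner (f i) (g i)) \<le> (norm (f i))\<^sup>2 + (norm (g i))\<^sup>2" .
qed auto

lemma ell2_inner_summable:
  fixes f g :: "'i \<Rightarrow> 'a::chilbert_space"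
  assumes "(\<lambda>i. (norm (f i))\<^sup>2) summable_on UNIV" "(\<lambda>i. (norm (g i))\<^sup>2) summable_on UNIV"
  shows "(\<lambda>i. inner (f i) (g i)) summable_on UNIV"
  using summable_on_Re[OF ell2_cinner_summable[OF assms]] by (simp add: Re_cinner)

instantiation ell2 :: (type, chilbert_space) real_vector
begin

lift_definition zero_ell2 :: "('a, 'b) ell2" is "\<lambda>_. 0" by simp

lift_definition plus_ell2 :: "('a, 'b) ell2 \<Rightarrow> ('a, 'b) ell2 \<Rightarrow> ('a, 'b) ell2"
  is "\<lambda>f g i. f i + g i" by (rule ell2_add_closed)

lift_definition uminus_ell2 :: "('a, 'b) ell2 \<Rightarrow> ('a, 'b) ell2"
  is "\<lambda>f i. - f i" by simp

definition minus_ell2 :: "('a, 'b) ell2 \<Rightarrow> ('a, 'b) ell2 \<Rightarrow> ('a, 'b) ell2"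
  where "minus_ell2 x y = x + - y"

lift_definition scaleR_ell2 :: "real \<Rightarrow> ('a, 'b) ell2 \<Rightarrow> ('a, 'b) ell2"
  is "\<lambda>r f i. r *\<^sub>R f i" by (simp add: power_mult_distrib summable_on_cmult_right)

instance
proof
  fix x y z :: "('a, 'b) ell2" and r s :: real
  show "x + y + z = x + (y + z)" by transfer (simp add: algebra_simps)
  show "x + y = y + x" by transfer (simp add: algebra_simps)
  show "0 + x = x" by transfer simp
  show "- x + x = 0" by transfer simp
  show "x - y = x + - y" by (rule minus_ell2_def)
  show "r *\<^sub>R (x + y) = r *\<^sub>R x + r *\<^sub>R y" by transfer (simp add: algebra_simps)
  show "(r + s) *\<^sub>R x = r *\<^sub>R x + s *\<^sub>R x" by transfer (simp add: algebra_simps)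
  show "r *\<^sub>R s *\<^sub>R x = (r * s) *\<^sub>R x" by transfer simp
  show "1 *\<^sub>R x = x" by transfer simp
qed

end

instantiation ell2 :: (type, chilbert_space) real_inner
begin

lift_definition inner_ell2 :: "('a, 'b) ell2 \<Rightarrow> ('a, 'b) ell2 \<Rightarrow> real"
  is "\<lambda>f g. \<Sum>\<^sub>\<infinity>i. inner (f i) (g i)" .

definition norm_ell2 :: "('a, 'b) ell2 \<Rightarrow> real"
  where "norm_ell2 x = sqrt (inner x x)"

definition sgn_ell2 :: "('a, 'b) ell2 \<Rightarrow> ('a, 'b) ell2"
  where "sgn_ell2 x = x /\<^sub>R norm x"

definition dist_ell2 :: "('a, 'b) ell2 \<Rightarrow> ('a, 'b) ell2 \<Rightarrow> real"
  where "dist_ell2 x y = norm (x - y)"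

definition uniformity_ell2 :: "(('a, 'b) ell2 \<times> ('a, 'b) ell2) filter"
  where "uniformity_ell2 = (INF e\<in>{0 <..}. principal {(x, y). dist x y < e})"

definition open_ell2 :: "('a, 'b) ell2 set \<Rightarrow> bool"
  where "open_ell2 S = (\<forall>x\<in>S. \<forall>\<^sub>F (x', y) in uniformity. x' = x \<longrightarrow> y \<in> S)"

instance
proof
  fix x y z :: "('a, 'b) ell2" and r :: real
  show "inner x y = inner y x" by transfer (simp add: inner_commute)
  show "inner (x + y) z = inner x z + inner y z"
    by transfer (simp add: inner_add_left infsum_add ell2_inner_summable)
  show "inner (r *\<^sub>R x) y = r * inner x y"
    by transfer (simp add: infsum_cmult_right')
  show "0 \<le> inner x x" by transfer (simp add: infsum_nonneg)
  show "inner x x = 0 \<longleftrightarrow> x = 0"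
  proof (transfer, intro iffI ext)
    fix f :: "'a \<Rightarrow> 'b" and i
    assume f: "(\<lambda>i. (norm (f i))\<^sup>2) summable_on UNIV" and "(\<Sum>\<^sub>\<infinity>i. inner (f i) (f i)) = 0"
    then have "(norm (f i))\<^sup>2 = 0"
      by (intro nonneg_infsum_le_0D[of "\<lambda>i. (norm (f i))\<^sup>2" UNIV])
        (auto simp: power2_norm_eq_inner)
    then show "f i = 0" by simp
  qed simp
  show "sgn x = x /\<^sub>R norm x" by (rule sgn_ell2_def)
  show "dist x y = norm (x - y)" by (rule dist_ell2_def)
  show "uniformity = (INF e\<in>{0 <..}. principal {(x, y :: ('a, 'b) ell2). dist x y < e})"
    by (rule uniformity_ell2_def)
  show "open U = (\<forall>x\<in>U. \<forall>\<^sub>F (x', y) in uniformity. x' = x \<longrightarrow> y \<in> U)"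
    for U :: "('a, 'b) ell2 set" by (rule open_ell2_def)
  show "norm x = sqrt (inner x x)" by (rule norm_ell2_def)
qed

end

lemma ell2_summable: "(\<lambda>i. (norm (Rep_ell2 x i))\<^sup>2) summable_on UNIV"
  using Rep_ell2[of x] by simp

lemma ell2_norm_sq: "(norm x)\<^sup>2 = (\<Sum>\<^sub>\<infinity>i. (norm (Rep_ell2 x i))\<^sup>2)"
  by (simp only: power2_norm_eq_inner inner_ell2.rep_eq)

lemma minus_ell2_rep: "Rep_ell2 (x - y) = (\<lambda>i. Rep_ell2 x i - Rep_ell2 y i)"
  unfolding minus_ell2_def plus_ell2.rep_eq uminus_ell2.rep_eq by simp

lemma ell2_sum_le: "finite F \<Longrightarrow> (\<Sum>i\<in>F. (norm (Rep_ell2 x i))\<^sup>2) \<le> (norm x)\<^sup>2"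
  unfolding ell2_norm_sq by (rule finite_sum_le_infsum[OF ell2_summable]) auto

lemma ell2_norm_component: "norm (Rep_ell2 x i) \<le> norm x"
  by (rule power2_le_imp_le) (use ell2_sum_le[of "{i}" x] in auto)

lemma ell2_complete:
  fixes X :: "nat \<Rightarrow> ('i, 'a::chilbert_space) ell2"
  assumes "Cauchy X"
  shows "convergent X"
proof -
  have "Cauchy (\<lambda>n. Rep_ell2 (X n) i)" for i
  proof (rule metric_CauchyI)
    fix e :: real assume "0 < e"
    then obtain M where M: "\<And>m n. m \<ge> M \<Longrightarrow> n \<ge> M \<Longrightarrow> dist (X m) (X n) < e"
      using metric_CauchyD[OF assms] by blast
    have "dist (Rep_ell2 (X m) i) (Rep_ell2 (X n) i) < e" if "m \<ge> M" "n \<ge> M" for m n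
      using ell2_norm_component[of "X m - X n" i] M[OF that]
      by (simp add: dist_norm minus_ell2_rep)
    then show "\<exists>M. \<forall>m\<ge>M. \<forall>n\<ge>M. dist (Rep_ell2 (X m) i) (Rep_ell2 (X n) i) < e" by blast
  qed
  then have "\<forall>i. \<exists>l. (\<lambda>n. Rep_ell2 (X n) i) \<longlonglongrightarrow> l"
    by (simp add: Cauchy_convergent_iff convergent_def)
  then obtain L where L: "\<And>i. (\<lambda>n. Rep_ell2 (X n) i) \<longlonglongrightarrow> L i" by metis
  have bound: "\<exists>M. \<forall>m\<ge>M. \<forall>F. finite F \<longrightarrow> (\<Sum>i\<in>F. (norm (Rep_ell2 (X m) i - L i))\<^sup>2) \<le> e\<^sup>2"
    if "0 < e" for e :: real
  proof -
    obtain M where M: "\<And>m n. m \<ge> M \<Longrightarrow> n \<ge> M \<Longrightarrow> dist (X m) (X n) < e"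
      using metric_CauchyD[OF assms \<open>0 < e\<close>] by blast
    have "(\<Sum>i\<in>F. (norm (Rep_ell2 (X m) i - L i))\<^sup>2) \<le> e\<^sup>2" if "m \<ge> M" "finite F" for m F
    proof (rule LIMSEQ_le_const2)
      show "(\<lambda>n. \<Sum>i\<in>F. (norm (Rep_ell2 (X m) i - Rep_ell2 (X n) i))\<^sup>2)
          \<longlonglongrightarrow> (\<Sum>i\<in>F. (norm (Rep_ell2 (X m) i - L i))\<^sup>2)"
        by (intro tendsto_intros L)
      have "(\<Sum>i\<in>F. (norm (Rep_ell2 (X m) i - Rep_ell2 (X n) i))\<^sup>2) \<le> e\<^sup>2" if "n \<ge> M" for n
      proof -
        have "(\<Sum>i\<in>F. (norm (Rep_ell2 (X m) i - Rep_ell2 (X n) i))\<^sup>2) \<le> (norm (X m - X n))\<^sup>2"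
          using ell2_sum_le[OF \<open>finite F\<close>, of "X m - X n"] by (simp add: minus_ell2_rep)
        also have "\<dots> \<le> e\<^sup>2"
          using M[OF \<open>m \<ge> M\<close> that] by (intro power_mono) (auto simp: dist_norm)
        finally show ?thesis .
      qed
      then show "\<exists>N. \<forall>n\<ge>N. (\<Sum>i\<in>F. (norm (Rep_ell2 (X m) i - Rep_ell2 (X n) i))\<^sup>2) \<le> e\<^sup>2"
        by blast
    qed
    then show ?thesis by blast
  qed
  have summ: "(\<lambda>i. (norm (Rep_ell2 (X m) i - L i))\<^sup>2) summable_on UNIV"
    if "\<And>F. finite F \<Longrightarrow> (\<Sum>i\<in>F. (norm (Rep_ell2 (X m) i - L i))\<^sup>2) \<le> e\<^sup>2" for m and e :: real
    by (rule nonneg_bdd_above_summable_on) (auto intro!: bdd_aboveI2[of _ _ "e\<^sup>2"] that)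
  obtain m where "\<And>F. finite F \<Longrightarrow> (\<Sum>i\<in>F. (norm (Rep_ell2 (X m) i - L i))\<^sup>2) \<le> 1\<^sup>2"
    using bound[of 1] by auto
  from summ[OF this] have "(\<lambda>i. (norm (L i - Rep_ell2 (X m) i))\<^sup>2) summable_on UNIV"
    by (simp add: norm_minus_commute)
  from ell2_add_closed[OF this ell2_summable[of "X m"]]
  have "(\<lambda>i. (norm (L i))\<^sup>2) summable_on UNIV" by simp
  then have RepL: "Rep_ell2 (Abs_ell2 L) = L" by (simp add: Abs_ell2_inverse)
  have "X \<longlonglongrightarrow> Abs_ell2 L"
  proof (rule metric_LIMSEQ_I)
    fix e :: real assume "0 < e"
    then obtain M where
      M: "\<And>m F. m \<ge> M \<Longrightarrow> finite F \<Longrightarrow> (\<Sum>i\<in>F. (norm (Rep_ell2 (X m) i - L i))\<^sup>2) \<le> (e/2)\<^sup>2"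
      using bound[of "e/2"] by auto
    have "dist (X m) (Abs_ell2 L) < e" if "m \<ge> M" for m
    proof -
      have "(norm (X m - Abs_ell2 L))\<^sup>2 \<le> (e/2)\<^sup>2"
        unfolding ell2_norm_sq minus_ell2_rep RepL
        by (rule infsum_le_finite_sums[OF summ[OF M[OF that]]]) (auto intro: M[OF that])
      then have "norm (X m - Abs_ell2 L) \<le> e/2"
        using \<open>0 < e\<close> by (simp add: power2_le_iff_abs_le)
      then show ?thesis using \<open>0 < e\<close> by (simp add: dist_norm)
    qed
    then show "\<exists>M. \<forall>m\<ge>M. dist (X m) (Abs_ell2 L) < e" by blast
  qed
  then show ?thesis by (auto simp: convergent_def)
qed

instantiation ell2 :: (type, chilbert_space) chilbert_space
begin

lift_definition scaleC_ell2 :: "complex \<Rightarrow> ('a, 'b) ell2 \<Rightarrow> ('a, 'b) ell2"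
  is "\<lambda>c f i. c *\<^sub>C f i" by (simp add: power_mult_distrib summable_on_cmult_right)

lift_definition cinner_ell2 :: "('a, 'b) ell2 \<Rightarrow> ('a, 'b) ell2 \<Rightarrow> complex"
  is "\<lambda>f g. \<Sum>\<^sub>\<infinity>i. cinner (f i) (g i)" .

instance
proof
  show "convergent X" if "Cauchy X" for X :: "nat \<Rightarrow> ('a, 'b) ell2"
    using that by (rule ell2_complete)
  fix x y z :: "('a, 'b) ell2" and c d :: complex and r :: real
  show "c *\<^sub>C (x + y) = c *\<^sub>C x + c *\<^sub>C y" by transfer (simp add: scaleC_add_right)
  show "(c + d) *\<^sub>C x = c *\<^sub>C x + d *\<^sub>C x" by transfer (simp add: scaleC_add_left)
  show "c *\<^sub>C d *\<^sub>C x = (c * d) *\<^sub>C x" by transfer (simp add: scaleC_scaleC)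
  show "complex_of_real r *\<^sub>C x = r *\<^sub>R x" by transfer (simp add: scaleC_of_real)
  show "cinner x y = cnj (cinner y x)"
    by (simp only: cinner_ell2.rep_eq infsum_cnj[symmetric] cinner_commute[symmetric])
  show "cinner (x + y) z = cinner x z + cinner y z"
    by transfer (simp add: cinner_add_left infsum_add ell2_cinner_summable)
  show "cinner (c *\<^sub>C x) y = c * cinner x y"
    by transfer (simp add: cinner_scaleC_left infsum_cmult_right')
  show "Re (cinner x y) = inner x y"
    by transfer (simp only: infsum_Re[OF ell2_cinner_summable, symmetric] Re_cinner)
qed

end

lift_definition unit_vec :: "'i \<Rightarrow> 'a::chilbert_space \<Rightarrow> ('i, 'a) ell2"
  is "\<lambda>i x j. if j = i then x else 0"
proof -
  fix i :: 'i and x :: 'a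
  have "(\<lambda>j. (norm (if j = i then x else 0))\<^sup>2) summable_on {i}" by simp
  then show "(\<lambda>j. (norm (if j = i then x else 0))\<^sup>2) summable_on UNIV"
    by (rule summable_on_cong_neutral[THEN iffD1, rotated -1]) auto
qed

lemma ell2_sums_unit_vecs:
  fixes x :: "('i, 'a::chilbert_space) ell2"
  shows "((\<lambda>i. unit_vec i (Rep_ell2 x i)) has_sum x) UNIV"
  unfolding has_sum_def
proof (rule tendstoI)
  fix e :: real assume e: "0 < e"
  let ?f = "\<lambda>i. (norm (Rep_ell2 x i))\<^sup>2"
  have "(?f has_sum (norm x)\<^sup>2) UNIV"
    unfolding ell2_norm_sq using ell2_summable by (rule has_sum_infsum)
  then have "\<forall>\<^sub>F F in finite_subsets_at_top UNIV. dist (sum ?f F) ((norm x)\<^sup>2) < e\<^sup>2"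
    unfolding has_sum_def by (rule tendstoD) (use e in simp)
  moreover have "\<forall>\<^sub>F F in finite_subsets_at_top (UNIV :: 'i set). finite F"
    by (rule eventually_finite_subsets_at_top_weakI)
  ultimately show "\<forall>\<^sub>F F in finite_subsets_at_top UNIV.
      dist (\<Sum>i\<in>F. unit_vec i (Rep_ell2 x i)) x < e"
  proof eventually_elim
    case (elim F)
    let ?s = "\<Sum>i\<in>F. unit_vec i (Rep_ell2 x i)"
    have rep_sum: "Rep_ell2 (sum g A) j = (\<Sum>i\<in>A. Rep_ell2 (g i) j)"
      for g :: "'i \<Rightarrow> ('i, 'a) ell2" and A j
      by (induction A rule: infinite_finite_induct) (auto simp: zero_ell2.rep_eq plus_ell2.rep_eq)
    have "Rep_ell2 ?s j = (if j \<in> F then Rep_ell2 x j else 0)" for j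
      using elim(2) by (simp add: rep_sum unit_vec.rep_eq)
    then have "(norm (x - ?s))\<^sup>2 = infsum ?f (- F)"
      unfolding ell2_norm_sq minus_ell2_rep by (intro infsum_cong_neutral) auto
    also have "\<dots> = (norm x)\<^sup>2 - sum ?f F"
      using infsum_Un_disjoint[of ?f F "- F"] elim(2) ell2_summable[of x]
      by (simp add: ell2_norm_sq summable_on_subset_banach)
    also have "\<dots> < e\<^sup>2"
      using elim(1) by (simp add: dist_real_def)
    finally have "norm (x - ?s) < e"
      using e by (simp add: power2_less_imp_less)
    then show ?case by (simp add: dist_norm norm_minus_commute)
  qed
qed

section \<open>Closed subspaces\<close>

lemma clinear_simps:
  assumes "bounded_clinear f"
  shows "bounded_linear f" "f (x + y) = f x + f y" "f (x - y) = f x - f y" "f 0 = 0"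
    "f (c *\<^sub>C x) = c *\<^sub>C f x" "f (sum g A) = (\<Sum>i\<in>A. f (g i))"
  using assms unfolding bounded_clinear_def
  by (auto simp: linear_simps linear_sum bounded_linear.linear)

lemma bounded_linear_cinner_left: "bounded_linear (\<lambda>x. cinner (x :: 'a::chilbert_space) y)"
  by (rule bounded_linear_intro[where K = "norm y"])
    (auto simp: cinner_add_left cmod_cinner_le scaleR_conv_of_real
      cinner_scaleC_left simp flip: scaleC_of_real)

lemma bounded_linear_scaleC: "bounded_linear (\<lambda>x. c *\<^sub>C (x :: 'a::chilbert_space))"
  by (rule bounded_linear_intro[where K = "cmod c"])
    (auto simp: scaleC_add_right scaleC_scaleC mult.commute simp flip: scaleC_of_real)

lemma csubspace_closure:
  assumes "complex_vector.subspace (S :: 'a::chilbert_space set)"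
  shows "complex_vector.subspace (closure S)"
proof (rule complex_vector.subspaceI)
  show "0 \<in> closure S"
    using complex_vector.subspace_0[OF assms] closure_subset by blast
  fix x y c assume x: "x \<in> closure S" and y: "y \<in> closure S"
  obtain f g where f: "\<And>n. f n \<in> S" "f \<longlonglongrightarrow> x" and g: "\<And>n. g n \<in> S" "g \<longlonglongrightarrow> y"
    using x y unfolding closure_sequential by metis
  show "x + y \<in> closure S"
    unfolding closure_sequential
    by (rule exI[of _ "\<lambda>n. f n + g n"])
      (auto intro!: tendsto_intros f g complex_vector.subspace_add[OF assms])
  show "c *\<^sub>C x \<in> closure S"
    unfolding closure_sequential
    by (rule exI[of _ "\<lambda>n. c *\<^sub>C f n"])
      (auto intro!: bounded_linear.tendsto[OF bounded_linear_scaleC] f g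
        complex_vector.subspace_scale[OF assms])
qed

lemma orthogonal_projection_exists:
  fixes S :: "'a::chilbert_space set"
  assumes "closed S" "complex_vector.subspace S"
  shows "\<exists>p\<in>S. \<forall>s\<in>S. cinner (x - p) s = 0"
proof -
  note sub = complex_vector.subspace_0[OF assms(2)] complex_vector.subspace_add[OF assms(2)]
    complex_vector.subspace_scale[OF assms(2)]
  define D where "D = (INF s\<in>S. (norm (x - s))\<^sup>2)"
  have bdd: "bdd_below ((\<lambda>s. (norm (x - s))\<^sup>2) ` S)"
    by (rule bdd_belowI2[of _ 0]) simp
  have D: "D \<le> (norm (x - s))\<^sup>2" if "s \<in> S" for s
    unfolding D_def using bdd that by (rule cINF_lower)
  have "\<exists>s\<in>S. (norm (x - s))\<^sup>2 < D + 1 / real (Suc n)" for n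
  proof -
    have "(INF s\<in>S. (norm (x - s))\<^sup>2) < D + 1 / real (Suc n)" by (simp add: D_def)
    then show ?thesis using sub(1) bdd by (subst (asm) cINF_less_iff) auto
  qed
  then obtain f where f: "\<And>n. f n \<in> S" "\<And>n. (norm (x - f n))\<^sup>2 < D + 1 / real (Suc n)"
    by metis
  have half: "(1 / 2) *\<^sub>R (a + b) \<in> S" if "a \<in> S" "b \<in> S" for a b
    using sub(2,3) that by (metis scaleC_of_real)
  have par: "(norm (a - b))\<^sup>2 \<le> 2 * (norm (x - a))\<^sup>2 + 2 * (norm (x - b))\<^sup>2 - 4 * D"
    if "a \<in> S" "b \<in> S" for a b
  proof -
    have "(norm (a - b))\<^sup>2 + 4 * (norm (x - (1 / 2) *\<^sub>R (a + b)))\<^sup>2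
        = 2 * (norm (x - a))\<^sup>2 + 2 * (norm (x - b))\<^sup>2"
      by (simp add: power2_norm_eq_inner inner_simps inner_commute field_simps)
    then show ?thesis using D[OF half[OF that]] by linarith
  qed
  have "Cauchy f"
  proof (rule metric_CauchyI)
    fix e :: real assume e: "0 < e"
    obtain N where N: "4 / e\<^sup>2 < real N"
      using reals_Archimedean2 by blast
    have "dist (f m) (f n) < e" if "m \<ge> N" "n \<ge> N" for m n
    proof -
      have N0: "0 < real N" using N e by (meson divide_pos_pos less_trans zero_less_numeral zero_less_power)
      have *: "1 / real (Suc k) \<le> 1 / real N" if "k \<ge> N" for k
        using that N0 by (intro divide_left_mono) auto
      have "(norm (f m - f n))\<^sup>2 < 2 * (D + 1 / real (Suc m)) + 2 * (D + 1 / real (Suc n)) - 4 * D"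
        using par[OF f(1)[of m] f(1)[of n]] f(2)[of m] f(2)[of n] by argo
      also have "\<dots> \<le> 4 * (1 / real N)"
        using *[OF that(1)] *[OF that(2)] by argo
      also have "\<dots> < e\<^sup>2"
        using N N0 e by (simp add: field_simps)
      finally show ?thesis
        using e by (simp add: dist_norm power2_less_imp_less)
    qed
    then show "\<exists>M. \<forall>m\<ge>M. \<forall>n\<ge>M. dist (f m) (f n) < e" by blast
  qed
  then obtain p where p: "f \<longlonglongrightarrow> p"
    using Cauchy_convergent convergent_def by blast
  have pS: "p \<in> S"
    using assms(1) f(1) p closed_sequentially by blast
  have "(norm (x - p))\<^sup>2 \<le> D + 0"
  proof (rule LIMSEQ_le)
    show "(\<lambda>n. (norm (x - f n))\<^sup>2) \<longlonglongrightarrow> (norm (x - p))\<^sup>2"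
      by (intro tendsto_intros p)
    show "(\<lambda>n. D + 1 / real (Suc n)) \<longlonglongrightarrow> D + 0"
      by (intro tendsto_intros LIMSEQ_Suc[OF lim_1_over_n])
    show "\<exists>N. \<forall>n\<ge>N. (norm (x - f n))\<^sup>2 \<le> D + 1 / real (Suc n)"
      using f(2) less_imp_le by blast
  qed
  then have min: "(norm (x - p))\<^sup>2 \<le> (norm (x - s))\<^sup>2" if "s \<in> S" for s
    using D[OF that] by linarith
  have real_orth: "inner (x - p) s = 0" if s: "s \<in> S" for s
  proof (cases "s = 0")
    case False
    define t where "t = inner (x - p) s / (norm s)\<^sup>2"
    have "p + t *\<^sub>R s \<in> S" using pS s sub(2,3) by (metis scaleC_of_real)
    from min[OF this]
    have "(norm (x - p))\<^sup>2 \<le> (norm ((x - p) - t *\<^sub>R s))\<^sup>2" by (simp add: algebra_simps)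
    also have "\<dots> = (norm (x - p))\<^sup>2 - 2 * t * inner (x - p) s + t\<^sup>2 * (norm s)\<^sup>2"
      using dot_norm_neg[of "x - p" "t *\<^sub>R s"] by (simp add: power_mult_distrib)
    also have "t\<^sup>2 * (norm s)\<^sup>2 = t * inner (x - p) s"
      using False by (simp add: t_def power2_eq_square)
    finally have "t * inner (x - p) s \<le> 0" by simp
    moreover have "t * inner (x - p) s = (inner (x - p) s)\<^sup>2 / (norm s)\<^sup>2"
      by (simp add: t_def power2_eq_square)
    ultimately have "(inner (x - p) s)\<^sup>2 / (norm s)\<^sup>2 \<le> 0" by simp
    then show ?thesis using False by (simp add: divide_le_0_iff)
  qed simp
  have "cinner (x - p) s = 0" if "s \<in> S" for s
    using real_orth[OF that] real_orth[OF sub(3)[OF that]]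
    by (intro complex_eqI) (auto simp: Re_cinner Im_cinner)
  then show ?thesis using pS by blast
qed

lemma cinner_ext:
  assumes "\<And>x. cinner x y = cinner x (z :: 'a::chilbert_space)"
  shows "y = z"
proof -
  have "cinner (y - z) (y - z) = 0" by (simp add: cinner_diff_right assms)
  then show ?thesis by (simp add: cinner_self)
qed

lemma riesz_representation:
  fixes f :: "'a::chilbert_space \<Rightarrow> complex"
  assumes "bounded_clinear f"
  shows "\<exists>z. \<forall>x. f x = cinner x z"
proof (cases "\<forall>x. f x = 0")
  case True
  then show ?thesis by (intro exI[of _ 0]) simp
next
  case False
  then obtain x where x: "f x \<noteq> 0" by blast
  note f = clinear_simps[OF assms]
  define S where "S = {x. f x = 0}"
  have sc: "c *\<^sub>C d = c * d" for c d :: complex by (simp add: scaleC_complex_def)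
  have "complex_vector.subspace S"
    unfolding S_def by (rule complex_vector.subspaceI) (auto simp: f sc)
  moreover have "closed S"
    unfolding S_def by (intro closed_Collect_eq continuous_intros
      linear_continuous_on[OF f(1)])
  ultimately obtain p where p: "p \<in> S" "\<And>s. s \<in> S \<Longrightarrow> cinner (x - p) s = 0"
    using orthogonal_projection_exists[of S x] by blast
  define u where "u = x - p"
  have fu: "f u = f x" using p(1) by (simp add: u_def f S_def)
  then have u0: "u \<noteq> 0" using x f(4) by auto
  define z where "z = (cnj (f u) / cinner u u) *\<^sub>C u"
  have "f y = cinner y z" for y
  proof -
    have "y - (f y / f u) *\<^sub>C u \<in> S" using fu x by (simp add: S_def f sc)
    from p(2)[OF this] have "cinner (y - (f y / f u) *\<^sub>C u) u = 0"
      by (metis cinner_commute complex_cnj_zero u_def)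
    then have "cinner y u = f y / f u * cinner u u"
      by (simp add: cinner_diff_left cinner_scaleC_left)
    moreover have "cinner y z = f u / cinner u u * cinner y u"
      unfolding z_def cinner_scaleC_right by (simp flip: cinner_commute)
    ultimately show ?thesis
      using u0 fu x by (simp add: cinner_self)
  qed
  then show ?thesis by blast
qed

lemma cadj_unique:
  assumes "\<And>x y. cinner (f x) y = cinner x (g y)"
  shows "cadj f = g"
  unfolding cadj_def
proof (rule the_equality)
  show "h = g" if "\<forall>x y. cinner (f x) y = cinner x (h y)" for h
  proof (rule ext, rule cinner_ext)
    fix x y
    have "cinner (f x) y = cinner x (h y)" by (rule that[rule_format])
    then show "cinner x (h y) = cinner x (g y)" by (simp only: assms)
  qed
qed (intro allI assms)

lemma cadj_eq:
  assumes "bounded_clinear f"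
  shows "cinner (f x) y = cinner x (cadj f y)"
proof -
  have "\<exists>z. \<forall>x. cinner (f x) y = cinner x z" for y
  proof (rule riesz_representation)
    show "bounded_clinear (\<lambda>x. cinner (f x) y)"
      using clinear_simps(5)[OF assms]
      by (auto simp: bounded_clinear_def scaleC_complex_def cinner_scaleC_left
        intro!: bounded_linear_compose[OF bounded_linear_cinner_left] clinear_simps(1)[OF assms])
  qed
  then obtain g where g: "\<And>x y. cinner (f x) y = cinner x (g y)" by metis
  then show ?thesis by (simp only: cadj_unique[of f g, OF g])
qed

section \<open>Tensor products with a sequence space\<close>

text \<open>
  The Hilbert space tensor product of \<open>'h\<close> and \<open>('i, complex) ell2\<close> is realised as
  \<open>('i, 'h) ell2\<close>: the elementary tensor of \<open>h\<close> and \<open>\<phi>\<close> is the family with entries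
  \<open>\<phi> i *\<^sub>C h\<close>.
\<close>

lift_definition tensor_vec :: "'h::chilbert_space \<Rightarrow> ('i, complex) ell2 \<Rightarrow> ('i, 'h) ell2"
  is "\<lambda>h \<phi> i. \<phi> i *\<^sub>C h"
  by (simp add: power_mult_distrib summable_on_cmult_left)

definition tensor_op :: "('h::chilbert_space \<Rightarrow> 'h) \<Rightarrow>
    (('i, complex) ell2 \<Rightarrow> ('i, complex) ell2) \<Rightarrow> ('i, 'h) ell2 \<Rightarrow> ('i, 'h) ell2"
  where "tensor_op A B = (THE S. bounded_clinear S \<and>
    (\<forall>h \<phi>. S (tensor_vec h \<phi>) = tensor_vec (A h) (B \<phi>)))"

text \<open>
  The full Fock space over an \<open>n\<close>-dimensional Hilbert space, with \<open>n = CARD('n)\<close>, has the words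
  over \<open>'n\<close> as an orthonormal basis: the word \<open>[i\<^sub>1, \<dots>, i\<^sub>k]\<close> stands for the tensor product of
  the basis vectors with these indices, and the empty word for the vacuum. Tensoring with a basis
  vector on the right appends a letter.
\<close>

type_synonym 'n fock = "('n list, complex) ell2"

lemma append_letter_summable:
  fixes f :: "'n list \<Rightarrow> 'a::real_normed_vector"
  assumes "(\<lambda>w. (norm (f w))\<^sup>2) summable_on UNIV"
  shows "(\<lambda>w. (norm (if w \<noteq> [] \<and> last w = i then f (butlast w) else 0))\<^sup>2) summable_on UNIV"
proof -
  let ?g = "\<lambda>w. (norm (if w \<noteq> [] \<and> last w = i then f (butlast w) else 0))\<^sup>2"
  have "inj (\<lambda>w. w @ [i])" by (rule injI) simp
  moreover have "?g \<circ> (\<lambda>w. w @ [i]) = (\<lambda>w. (norm (f w))\<^sup>2)" by auto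
  ultimately have "?g summable_on range (\<lambda>w. w @ [i])"
    using assms by (simp add: summable_on_reindex)
  then show ?thesis
  proof (rule summable_on_cong_neutral[THEN iffD1, rotated -1])
    fix w assume "w \<in> UNIV - range (\<lambda>w. w @ [i])"
    then have "\<not> (w \<noteq> [] \<and> last w = i)"
      by (metis DiffD2 append_butlast_last_id rangeI)
    then show "?g w = 0" by auto
  qed auto
qed

lift_definition right_creation :: "'n \<Rightarrow> 'n fock \<Rightarrow> 'n fock"
  is "\<lambda>i \<phi> w. if w \<noteq> [] \<and> last w = i then \<phi> (butlast w) else 0"
  by (rule append_letter_summable)

lemma right_creation_unit_vec: "right_creation i (unit_vec w c) = unit_vec (w @ [i]) c"
  by transfer (auto simp: fun_eq_iff append_eq_conv_conj snoc_eq_iff_butlast)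

lemma bounded_clinear_eqI_tensor_vec:
  fixes S S' :: "('i, 'h::chilbert_space) ell2 \<Rightarrow> 'b::chilbert_space"
  assumes "bounded_clinear S" "bounded_clinear S'"
    and "\<And>h \<phi>. S (tensor_vec h \<phi>) = S' (tensor_vec h \<phi>)"
  shows "S = S'"
proof
  fix x
  have "unit_vec i h = tensor_vec h (unit_vec i 1)" for i :: 'i and h :: 'h
    by transfer (auto simp: fun_eq_iff)
  then have *: "S (unit_vec i h) = S' (unit_vec i h)" for i h
    using assms(3) by metis
  have "((\<lambda>i. T (unit_vec i (Rep_ell2 x i))) has_sum T x) UNIV" if "bounded_clinear T" for T :: "('i, 'h) ell2 \<Rightarrow> 'b"
    using has_sum_bounded_linear[OF clinear_simps(1)[OF that] ell2_sums_unit_vecs[of x]] .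
  from this[OF assms(1)] this[OF assms(2)] show "S x = S' x"
    by (simp add: * has_sum_unique)
qed

lemma tensor_op_right_creation:
  fixes A :: "'h::chilbert_space \<Rightarrow> 'h"
  assumes A: "bounded_clinear A"
  shows "Rep_ell2 (tensor_op A (right_creation i) x) w =
      (if w \<noteq> [] \<and> last w = i then A (Rep_ell2 x (butlast w)) else 0)" (is ?rep)
    and "bounded_clinear (tensor_op A (right_creation i))"
    and "tensor_op A (right_creation i) (tensor_vec h \<phi>) = tensor_vec (A h) (right_creation i \<phi>)"
proof -
  note lin = clinear_simps[OF A]
  obtain K where K: "\<And>x. norm (A x) \<le> norm x * K" "0 \<le> K"
    using bounded_linear.nonneg_bounded[OF lin(1)] by metis
  define g where "g = (\<lambda>(x :: ('a list, 'h) ell2) w.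
    if w \<noteq> [] \<and> last w = i then A (Rep_ell2 x (butlast w)) else 0)"
  have A2: "(norm (A y))\<^sup>2 \<le> K\<^sup>2 * (norm y)\<^sup>2" for y
    using power_mono[OF K(1)[of y] norm_ge_zero, of 2] by (simp add: power_mult_distrib mult.commute)
  have AS: "(\<lambda>w. (norm (A (Rep_ell2 x w)))\<^sup>2) summable_on UNIV" for x :: "('a list, 'h) ell2"
    by (rule summable_on_comparison_test[where f = "\<lambda>w. K\<^sup>2 * (norm (Rep_ell2 x w))\<^sup>2"])
      (auto intro!: summable_on_cmult_right ell2_summable A2)
  define S where "S x = Abs_ell2 (g x)" for x
  have S: "Rep_ell2 (S x) = g x" for x
    using append_letter_summable[OF AS[of x], of i] by (simp add: S_def g_def Abs_ell2_inverse)
  have normS: "norm (S x) \<le> norm x * K" for x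
  proof (rule power2_le_imp_le)
    have "inj (\<lambda>w. w @ [i])" by (rule injI) simp
    have "(norm (S x))\<^sup>2 = (\<Sum>\<^sub>\<infinity>w\<in>range (\<lambda>w. w @ [i]). (norm (g x w))\<^sup>2)"
      unfolding ell2_norm_sq S
    proof (rule infsum_cong_neutral)
      fix w assume "w \<in> UNIV - range (\<lambda>w. w @ [i])"
      then have "\<not> (w \<noteq> [] \<and> last w = i)"
        by (metis DiffD2 append_butlast_last_id rangeI)
      then show "(norm (g x w))\<^sup>2 = 0" by (auto simp: g_def)
    qed auto
    also have "\<dots> = (\<Sum>\<^sub>\<infinity>w. (norm (A (Rep_ell2 x w)))\<^sup>2)"
      by (subst infsum_reindex[OF \<open>inj _\<close>]) (simp add: g_def o_def)
    also have "\<dots> \<le> (\<Sum>\<^sub>\<infinity>w. K\<^sup>2 * (norm (Rep_ell2 x w))\<^sup>2)"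
      by (intro infsum_mono AS summable_on_cmult_right ell2_summable A2)
    also have "\<dots> = (norm x * K)\<^sup>2"
      by (simp add: infsum_cmult_right' ell2_norm_sq[symmetric] power_mult_distrib mult.commute)
    finally show "(norm (S x))\<^sup>2 \<le> (norm x * K)\<^sup>2" .
  qed (simp add: K)
  have ext: "x = y" if "\<And>w. Rep_ell2 x w = Rep_ell2 y w" for x y :: "('a list, 'h) ell2"
    using that by (metis Rep_ell2_inject ext)
  have bS: "bounded_clinear S"
    unfolding bounded_clinear_def
  proof (intro conjI allI)
    show "bounded_linear S"
      by (rule bounded_linear_intro[where K = K]; (rule ext)?)
        (auto simp: S g_def plus_ell2.rep_eq scaleR_ell2.rep_eq lin normS
          linear_simps[OF lin(1)])
    show "S (c *\<^sub>C x) = c *\<^sub>C S x" for c x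
      by (rule ext) (auto simp: S g_def scaleC_ell2.rep_eq lin)
  qed
  have tS: "S (tensor_vec h \<phi>) = tensor_vec (A h) (right_creation i \<phi>)" for h \<phi>
    by (rule ext) (auto simp: S g_def tensor_vec.rep_eq right_creation.rep_eq lin)
  have "tensor_op A (right_creation i) = S"
    unfolding tensor_op_def
    by (rule the_equality) (auto simp: bS tS intro!: bounded_clinear_eqI_tensor_vec)
  then show ?rep "bounded_clinear (tensor_op A (right_creation i))"
    "tensor_op A (right_creation i) (tensor_vec h \<phi>) = tensor_vec (A h) (right_creation i \<phi>)"
    using S bS tS by (auto simp: g_def)
qed

section \<open>Operators of class rho\<close>

primrec word_op :: "('n \<Rightarrow> 'a \<Rightarrow> 'a) \<Rightarrow> 'n list \<Rightarrow> 'a \<Rightarrow> 'a"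
  where
    "word_op T [] = id"
  | "word_op T (i # \<alpha>) = T i \<circ> word_op T \<alpha>"

text \<open>
  \<open>J\<close> is the inclusion of \<open>'h\<close> into the larger Hilbert space \<open>G\<close>, so that \<^term>\<open>cadj J\<close>
  restricted to \<open>G\<close> is the orthogonal projection onto \<open>'h\<close>. As one cannot quantify over types, \<open>G\<close>
  ranges over the closed subspaces of one fixed Hilbert space. This is no restriction: only the
  part of \<open>G\<close> spanned by the vectors \<^term>\<open>word_op V \<alpha> (J h)\<close> matters, and it embeds into the
  space of square-summable families indexed by the pairs \<open>(\<alpha>, h)\<close>; see \<open>rho_class_dilation\<close>.
\<close>

definition rho_class :: "real \<Rightarrow> ('n::finite \<Rightarrow> 'h::chilbert_space \<Rightarrow> 'h) set"
  where "rho_class \<rho> = {T. (\<forall>i. bounded_clinear (T i)) \<and>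
    (\<exists>(G :: ('n list \<times> 'h, complex) ell2 set) J V.
      closed G \<and> complex_vector.subspace G \<and> isometry_between UNIV G J \<and>
      (\<forall>i. isometry_between G G (V i)) \<and>
      (\<forall>i j. i \<noteq> j \<longrightarrow> (\<forall>x\<in>G. \<forall>y\<in>G. cinner (V i x) (V j y) = 0)) \<and>
      (\<forall>\<alpha>. \<alpha> \<noteq> [] \<longrightarrow> (\<forall>h. word_op T \<alpha> h = \<rho> *\<^sub>R cadj J (word_op V \<alpha> (J h)))))}"

lemma span_family_embeds:
  fixes x :: "'i \<Rightarrow> 'g::chilbert_space"
  shows "\<exists>U :: 'g \<Rightarrow> ('i, complex) ell2. bounded_clinear U \<and>
    (\<forall>y \<in> closure (complex_vector.span (range x)). \<forall>z. cinner (U y) (U z) = cinner y z)"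
proof -
  obtain r :: "'i rel" where r: "Well_order r" "Field r = UNIV"
    using well_ordering[where 'a = 'i] by (elim exE conjE)
  define less where "less i j \<longleftrightarrow> (i, j) \<in> r - Id" for i j
  have wf: "wf (r - Id)" using r(1) by (simp add: well_order_on_def)
  have tot: "i = j \<or> less i j \<or> less j i" for i j
    using r by (auto simp: less_def well_order_on_def linear_order_on_def total_on_def)
  have trans: "less i k" if "less i j" "less j k" for i j k
    using that r by (auto simp: less_def well_order_on_def linear_order_on_def
        partial_order_on_def preorder_on_def antisym_def dest: transD)
  define L where "L i = closure (complex_vector.span (x ` {j. less j i}))" for i
  have sub: "complex_vector.subspace (closure (complex_vector.span A))" for A :: "'g set"
    by (rule csubspace_closure) simp
  have L: "closed (L i)" "complex_vector.subspace (L i)" for i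
    by (simp_all add: L_def sub)
  have clspan: "closure (complex_vector.span A) \<subseteq> M"
    if "closed M" "complex_vector.subspace M" "A \<subseteq> M" for A M :: "'g set"
    using that by (intro closure_minimal complex_vector.span_minimal)
  have gen: "a \<in> closure (complex_vector.span A)" if "a \<in> A" for a and A :: "'g set"
    using that closure_subset complex_vector.span_base by blast
  have "\<exists>p\<in>L i. \<forall>s\<in>L i. cinner (x i - p) s = 0" for i
    by (rule orthogonal_projection_exists[OF L])
  then obtain P where P: "\<And>i. P i \<in> L i" "\<And>i s. s \<in> L i \<Longrightarrow> cinner (x i - P i) s = 0"
    by metis
  define e where "e i = sgn (x i - P i)" for i
  have e_scale: "e i = complex_of_real (inverse (norm (x i - P i))) *\<^sub>C (x i - P i)" for i
    by (simp only: e_def sgn_div_norm scaleC_of_real)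
  have e_orth_L: "cinner (e i) s = 0" if "s \<in> L i" for i s
    by (simp add: e_scale cinner_scaleC_left P(2)[OF that])
  have mono: "L j \<subseteq> L i" if "less j i" for i j
    unfolding L_def using that trans by (intro closure_mono complex_vector.span_mono) auto
  have e_in_L: "e j \<in> L i" if "less j i" for i j
  proof -
    have "x j \<in> L i" unfolding L_def using that by (intro gen) auto
    moreover have "P j \<in> L i" using P(1) mono[OF that] by blast
    ultimately show ?thesis
      unfolding e_scale using L(2)
      by (intro complex_vector.subspace_scale complex_vector.subspace_diff)
  qed
  have orth: "cinner (e i) (e j) = 0" if "i \<noteq> j" for i j
    using tot[of i j] that e_orth_L[OF e_in_L] by (metis cinner_commute complex_cnj_zero)
  have e_self: "cinner (e i) (e i) = 1 \<or> e i = 0" for i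
    by (auto simp: cinner_self e_def norm_sgn sgn_zero_iff)
  define E where "E = closure (complex_vector.span (range e))"
  have E: "closed E" "complex_vector.subspace E" by (simp_all add: E_def sub)
  have xE: "x i \<in> E" for i
    using wf
  proof (induction i rule: wf_induct_rule)
    case (less i)
    have "L i \<subseteq> E"
      unfolding L_def using E less by (intro clspan) (auto simp: less_def)
    then have "P i \<in> E" using P(1) by blast
    moreover have "x i - P i = complex_of_real (norm (x i - P i)) *\<^sub>C e i"
      by (cases "x i - P i = 0") (auto simp: e_def sgn_div_norm scaleC_of_real)
    then have "x i - P i \<in> E"
      using E(2) gen[of "e i" "range e"]
      by (metis E_def complex_vector.subspace_scale rangeI)
    ultimately have "P i + (x i - P i) \<in> E"
      using E(2) by (intro complex_vector.subspace_add)
    then show ?case by simp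
  qed
  have bessel: "(\<Sum>i\<in>F. (cmod (cinner y (e i)))\<^sup>2) \<le> (norm y)\<^sup>2" if "finite F" for F y
  proof -
    define q where "q = (\<Sum>i\<in>F. cinner y (e i) *\<^sub>C e i)"
    have qe: "cinner q (e j) = cinner y (e j)" if "j \<in> F" for j
    proof -
      have "cinner q (e j) = (\<Sum>i\<in>F. cinner y (e i) * cinner (e i) (e j))"
        by (simp add: q_def cinner_sum_left cinner_scaleC_left)
      also have "\<dots> = cinner y (e j) * cinner (e j) (e j)"
        using orth that \<open>finite F\<close> by (subst sum.remove[of F j]) (auto intro!: sum.neutral)
      also have "\<dots> = cinner y (e j)" using e_self[of j] by auto
      finally show ?thesis .
    qed
    have "cinner (y - q) q = 0"
    proof -
      have "cinner (y - q) q = (\<Sum>j\<in>F. cnj (cinner y (e j)) * cinner (y - q) (e j))"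
        by (subst (2) q_def) (simp add: cinner_sum_right cinner_scaleC_right)
      also have "\<dots> = 0" by (rule sum.neutral) (simp add: cinner_diff_left qe)
      finally show ?thesis .
    qed
    then have yq: "cinner y q = cinner q q" by (simp add: cinner_diff_left)
    have "cinner y q = (\<Sum>i\<in>F. complex_of_real ((cmod (cinner y (e i)))\<^sup>2))"
      unfolding q_def cinner_sum_right cinner_scaleC_right
      by (rule sum.cong) (simp_all only: complex_norm_square mult.commute)
    then have sq: "(\<Sum>i\<in>F. (cmod (cinner y (e i)))\<^sup>2) = (norm q)\<^sup>2"
      unfolding yq cinner_self of_real_sum[symmetric] of_real_eq_iff by simp
    have "(norm q)\<^sup>2 = inner y q"
      using yq by (simp add: Re_cinner[symmetric] cinner_self)
    also have "\<dots> \<le> norm y * norm q" by (rule norm_cauchy_schwarz)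
    finally have "norm q \<le> norm y"
      by (cases "norm q = 0") (auto simp: power2_eq_square)
    then show ?thesis unfolding sq by (intro power_mono) auto
  qed
  define U where "U y = Abs_ell2 (\<lambda>i. cinner y (e i))" for y
  have "(\<lambda>i. (norm (cinner y (e i)))\<^sup>2) summable_on UNIV" for y
    by (rule nonneg_bdd_above_summable_on)
      (auto intro!: bdd_aboveI2[of _ _ "(norm y)\<^sup>2"] bessel)
  then have U: "Rep_ell2 (U y) = (\<lambda>i. cinner y (e i))" for y
    by (simp add: U_def Abs_ell2_inverse)
  have ext: "a = b" if "\<And>i. Rep_ell2 a i = Rep_ell2 b i" for a b :: "('i, complex) ell2"
    using that by (metis Rep_ell2_inject ext)
  have U_add: "U (y + z) = U y + U z" for y z
    by (rule ext) (simp add: U plus_ell2.rep_eq cinner_add_left)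
  have U_scale: "U (c *\<^sub>C y) = c *\<^sub>C U y" for c y
    by (rule ext) (simp add: U scaleC_ell2.rep_eq cinner_scaleC_left scaleC_complex_def)
  have "norm (U y) \<le> norm y * 1" for y
  proof (rule power2_le_imp_le)
    show "(norm (U y))\<^sup>2 \<le> (norm y * 1)\<^sup>2"
      unfolding ell2_norm_sq
      by (rule infsum_le_finite_sums[OF ell2_summable]) (use bessel in \<open>simp add: U\<close>)
  qed simp
  then have bU: "bounded_clinear U"
    unfolding bounded_clinear_def
    by (auto intro!: bounded_linear_intro[where K = 1] U_add U_scale simp flip: scaleC_of_real)
  define M where "M = {y. \<forall>z. cinner (U y) (U z) = cinner y z}"
  have "complex_vector.subspace M"
    unfolding M_def by (rule complex_vector.subspaceI)
      (auto simp: clinear_simps[OF bU] cinner_add_left cinner_scaleC_left)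
  moreover have "closed M"
    unfolding M_def
    by (intro closed_Collect_all closed_Collect_eq
        linear_continuous_on bounded_linear_cinner_left
        bounded_linear_compose[OF bounded_linear_cinner_left clinear_simps(1)[OF bU]])
  moreover have "e j \<in> M" for j
  proof -
    have "cinner (U (e j)) (U z) = cinner (e j) z" for z
    proof -
      have "cinner (U (e j)) (U z) = (\<Sum>\<^sub>\<infinity>i\<in>{j}. cinner (cinner (e j) (e i)) (cinner z (e i)))"
        unfolding cinner_ell2.rep_eq U
        by (rule infsum_cong_neutral) (auto simp: orth)
      also have "\<dots> = cinner (e j) (e j) * cnj (cinner z (e j))"
        by (simp add: cinner_complex_def)
      also have "\<dots> = cinner (e j) z"
        using e_self[of j] by (auto simp flip: cinner_commute)
      finally show ?thesis .
    qed
    then show ?thesis by (simp add: M_def)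
  qed
  ultimately have "E \<subseteq> M"
    unfolding E_def by (intro clspan) auto
  moreover have "closure (complex_vector.span (range x)) \<subseteq> E"
    using E xE by (intro clspan) auto
  ultimately show ?thesis
    using bU by (intro exI[of _ U]) (auto simp: M_def)
qed

lemma isometry_between_bounded_clinear:
  assumes "isometry_between UNIV B f"
  shows "bounded_clinear f"
  using assms unfolding isometry_between_def bounded_clinear_def
  by (auto intro!: bounded_linear_intro[where K = 1] simp flip: scaleC_of_real)

lemma rho_class_dilation:
  fixes T :: "'n::finite \<Rightarrow> 'h::chilbert_space \<Rightarrow> 'h"
    and J :: "'h \<Rightarrow> 'g::chilbert_space" and V :: "'n \<Rightarrow> 'g \<Rightarrow> 'g"
  assumes T: "\<And>i. bounded_clinear (T i)"
    and J: "isometry_between UNIV UNIV J"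
    and V: "\<And>i. isometry_between UNIV UNIV (V i)"
    and orth: "\<And>i j x y. i \<noteq> j \<Longrightarrow> cinner (V i x) (V j y) = 0"
    and dil: "\<And>\<alpha> h. \<alpha> \<noteq> [] \<Longrightarrow> word_op T \<alpha> h = \<rho> *\<^sub>R cadj J (word_op V \<alpha> (J h))"
  shows "T \<in> rho_class \<rho>"
proof -
  note linJ = isometry_between_bounded_clinear[OF J]
  note linV = isometry_between_bounded_clinear[OF V]
  define x where "x = (\<lambda>(\<alpha>, h). word_op V \<alpha> (J h))"
  define M where "M = closure (complex_vector.span (range x))"
  have M: "closed M" "complex_vector.subspace M"
    by (simp_all add: M_def csubspace_closure)
  note Msub = complex_vector.subspace_0[OF M(2)] complex_vector.subspace_add[OF M(2)]
    complex_vector.subspace_scale[OF M(2)] complex_vector.subspace_diff[OF M(2)]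
  have xM: "word_op V \<alpha> (J h) \<in> M" for \<alpha> h
  proof -
    have "word_op V \<alpha> (J h) \<in> range x"
      by (rule range_eqI[of _ _ "(\<alpha>, h)"]) (simp add: x_def)
    then show ?thesis
      unfolding M_def by (intro closure_subset[THEN subsetD] complex_vector.span_base)
  qed
  have VM: "V i y \<in> M" if "y \<in> M" for i y
  proof -
    have "complex_vector.subspace (V i -` M)"
      by (rule complex_vector.subspaceI) (auto simp: clinear_simps[OF linV] Msub)
    moreover have "closed (V i -` M)"
      by (intro closed_vimage M linear_continuous_on clinear_simps(1)[OF linV])
    moreover have "range x \<subseteq> V i -` M"
      using xM[of "i # _"] by (auto simp: x_def)
    ultimately have "closure (complex_vector.span (range x)) \<subseteq> V i -` M"
      by (intro closure_minimal complex_vector.span_minimal)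
    then show ?thesis using that by (auto simp flip: M_def)
  qed
  obtain U :: "'g \<Rightarrow> ('n list \<times> 'h, complex) ell2" where U: "bounded_clinear U"
    and iso: "\<And>y z. y \<in> M \<Longrightarrow> cinner (U y) (U z) = cinner y z"
    using span_family_embeds[of x] unfolding M_def by blast
  note linU = clinear_simps[OF U]
  have normU: "norm (U y) = norm y" if "y \<in> M" for y
    using iso[OF that, of y] by (simp add: cinner_self flip: of_real_power)
  have inj: "inj_on U M"
  proof (rule inj_onI)
    fix y z assume "y \<in> M" "z \<in> M" "U y = U z"
    then show "y = z" using normU[OF Msub(4), of y z] by (simp add: linU)
  qed
  define G where "G = U ` M"
  define W where "W = inv_into M U"
  have W: "W (U y) = y" if "y \<in> M" for y
    using inj that by (simp add: W_def)
  have "closed G"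
  proof -
    have "subspace M"
      unfolding subspace_def using Msub(1-3) by (metis scaleC_of_real)
    moreover have "complete M"
      using M(1) by (simp add: complete_eq_closed)
    ultimately have "complete G"
      unfolding G_def using linU(1) normU by (intro complete_isometric_image[of 1]) auto
    then show ?thesis by (rule complete_imp_closed)
  qed
  moreover have "complex_vector.subspace G"
    unfolding G_def
  proof (rule complex_vector.subspaceI)
    show "0 \<in> U ` M" using Msub(1) linU(4) by (metis imageI)
    show "a + b \<in> U ` M" if "a \<in> U ` M" "b \<in> U ` M" for a b
      using that Msub(2) by (auto simp flip: linU(2))
    show "c *\<^sub>C a \<in> U ` M" if "a \<in> U ` M" for c a
      using that Msub(3) by (auto simp flip: linU(5))
  qed
  moreover have "isometry_between UNIV G (U \<circ> J)"
    using xM[of "[]"] normU J by (auto simp: isometry_between_def G_def linU)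
  moreover have "isometry_between G G (\<lambda>w. U (V i (W w)))" for i
  proof -
    have "norm (V i y) = norm y" for y using V by (auto simp: isometry_between_def)
    then show ?thesis
      unfolding isometry_between_def G_def
      by (auto simp: W VM normU linU Msub clinear_simps[OF linV] simp flip: linU(2,5))
  qed
  moreover have "cinner (U (V i (W a))) (U (V j (W b))) = 0" if "i \<noteq> j" "a \<in> G" "b \<in> G" for i j a b
    using that by (auto simp: G_def W VM iso orth)
  moreover have "word_op T \<alpha> h = \<rho> *\<^sub>R cadj (U \<circ> J) (word_op (\<lambda>i w. U (V i (W w))) \<alpha> ((U \<circ> J) h))"
    if "\<alpha> \<noteq> []" for \<alpha> h
  proof -
    have w: "word_op (\<lambda>i w. U (V i (W w))) \<alpha> (U (J h)) = U (word_op V \<alpha> (J h))"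
      by (induction \<alpha>) (auto simp: W xM)
    have "cadj (U \<circ> J) (U y) = cadj J y" if "y \<in> M" for y
    proof (rule cinner_ext)
      fix k
      have "bounded_clinear (U \<circ> J)"
        unfolding bounded_clinear_def o_def
        using bounded_linear_compose[OF linU(1) clinear_simps(1)[OF linJ]]
        by (simp add: linU(5) clinear_simps(5)[OF linJ])
      from cadj_eq[OF this, of k "U y"]
      have "cinner k (cadj (U \<circ> J) (U y)) = cinner (U (J k)) (U y)" by simp
      also have "\<dots> = cinner (J k) y" using iso xM[of "[]" k] by simp
      finally show "cinner k (cadj (U \<circ> J) (U y)) = cinner k (cadj J y)"
        by (simp add: cadj_eq[OF linJ])
    qed
    then show ?thesis using dil[OF that, of h] by (simp add: w xM)
  qed
  ultimately show ?thesis
    using T unfolding rho_class_def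
    by (intro CollectI conjI exI[of _ G] exI[of _ "U \<circ> J"] exI[of _ "\<lambda>i w. U (V i (W w))"]) auto
qed

text \<open>
  The infimum is taken in the extended reals, so that it would be infinite over the empty set.
\<close>

definition rho_radius :: "real \<Rightarrow> ('n::finite \<Rightarrow> 'h::chilbert_space \<Rightarrow> 'h) \<Rightarrow> ereal"
  where "rho_radius \<rho> T =
    Inf {ereal t |t. 0 < t \<and> (\<lambda>i h. (1 / t) *\<^sub>R T i h) \<in> rho_class \<rho>}"

definition rho_ball :: "real \<Rightarrow> ('n::finite \<Rightarrow> 'h::chilbert_space \<Rightarrow> 'h) set"
  where "rho_ball \<rho> = {X. (\<forall>i. bounded_clinear (X i)) \<and> rho_radius \<rho> X < 1}"


section \<open>Harnack domination\<close>

text \<open>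
  A noncommutative polynomial with coefficients in the \<open>m \<times> m\<close> matrices is the family of its
  coefficient matrices; only the entries with indices below \<open>m\<close> count. An operator on the
  tensor product of a Hilbert space with \<open>\<complex>\<^sup>m\<close> is the \<open>m \<times> m\<close> matrix of its operator entries.
\<close>

type_synonym 'n ncpoly = "'n list \<Rightarrow> nat \<Rightarrow> nat \<Rightarrow> complex"

definition is_ncpoly :: "nat \<Rightarrow> 'n ncpoly \<Rightarrow> bool"
  where "is_ncpoly m p \<longleftrightarrow> finite {\<alpha>. \<exists>i<m. \<exists>j<m. p \<alpha> i j \<noteq> 0}"

type_synonym 'a block_op = "nat \<Rightarrow> nat \<Rightarrow> 'a \<Rightarrow> 'a"

definition poly_eval :: "'n ncpoly \<Rightarrow> ('n \<Rightarrow> 'a::chilbert_space \<Rightarrow> 'a) \<Rightarrow> 'a block_op"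
  where "poly_eval p A = (\<lambda>i j x. \<Sum>\<alpha> | p \<alpha> i j \<noteq> 0. p \<alpha> i j *\<^sub>C word_op A \<alpha> x)"

definition block_adj :: "'a::chilbert_space block_op \<Rightarrow> 'a block_op"
  where "block_adj P = (\<lambda>i j. cadj (P j i))"

definition Re_poly :: "'n ncpoly \<Rightarrow> ('n \<Rightarrow> 'a::chilbert_space \<Rightarrow> 'a) \<Rightarrow> 'a block_op"
  where "Re_poly p A =
    (\<lambda>i j x. (1 / 2) *\<^sub>R (block_adj (poly_eval p A) i j x + poly_eval p A i j x))"

definition block_nonneg :: "nat \<Rightarrow> 'a::chilbert_space block_op \<Rightarrow> bool"
  where "block_nonneg m P \<longleftrightarrow> (\<forall>x :: nat \<Rightarrow> 'a.
    let s = \<Sum>i<m. \<Sum>j<m. cinner (P i j (x j)) (x i) in Im s = 0 \<and> 0 \<le> Re s)"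

definition block_le :: "nat \<Rightarrow> 'a::chilbert_space block_op \<Rightarrow> 'a block_op \<Rightarrow> bool"
  where "block_le m P Q \<longleftrightarrow> block_nonneg m (\<lambda>i j x. Q i j x - P i j x)"

definition strict_row_contractions :: "('n::finite \<Rightarrow> 'k::chilbert_space \<Rightarrow> 'k) set"
  where "strict_row_contractions = {X. (\<forall>i. bounded_clinear (X i)) \<and>
    onorm (\<lambda>x. \<Sum>i\<in>UNIV. X i (cadj (X i) x)) < 1}"

definition Re_poly_rho ::
    "real \<Rightarrow> 'n ncpoly \<Rightarrow> ('n \<Rightarrow> 'a::chilbert_space \<Rightarrow> 'a) \<Rightarrow> 'a block_op"
  where "Re_poly_rho \<rho> p A =
    (\<lambda>i j x. Re_poly p A i j x + (\<rho> - 1) *\<^sub>R Re_poly p (\<lambda>_ _. 0) i j x)"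

text \<open>
  Domination is a relation on \<^term>\<open>rho_class \<rho>\<close>; the defining inequality is written for arbitrary
  tuples. The type argument is the infinite-dimensional space on which positivity of the real
  part of a polynomial is tested.
\<close>

definition harnack_dom :: "'k::chilbert_space itself \<Rightarrow> real \<Rightarrow> real \<Rightarrow>
    ('n::finite \<Rightarrow> 'h::chilbert_space \<Rightarrow> 'h) \<Rightarrow> ('n \<Rightarrow> 'h \<Rightarrow> 'h) \<Rightarrow> bool"
  where "harnack_dom _ \<rho> c A B \<longleftrightarrow> (\<forall>m p. is_ncpoly m p \<and>
    (\<forall>X \<in> (strict_row_contractions :: ('n \<Rightarrow> 'k \<Rightarrow> 'k) set). block_nonneg m (Re_poly p X)) \<longrightarrow>
    block_le m (Re_poly_rho \<rho> p A) (\<lambda>i j x. c\<^sup>2 *\<^sub>R Re_poly_rho \<rho> p B i j x))"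

definition harnack_equiv :: "'k::chilbert_space itself \<Rightarrow> real \<Rightarrow> real \<Rightarrow>
    ('n::finite \<Rightarrow> 'h::chilbert_space \<Rightarrow> 'h) \<Rightarrow> ('n \<Rightarrow> 'h \<Rightarrow> 'h) \<Rightarrow> bool"
  where "harnack_equiv K \<rho> c A B \<longleftrightarrow> harnack_dom K \<rho> c A B \<and> harnack_dom K \<rho> c B A"

definition hyperbolic_dist :: "'k::chilbert_space itself \<Rightarrow> real \<Rightarrow>
    ('n::finite \<Rightarrow> 'h::chilbert_space \<Rightarrow> 'h) \<Rightarrow> ('n \<Rightarrow> 'h \<Rightarrow> 'h) \<Rightarrow> real"
  where "hyperbolic_dist K \<rho> A B = ln (Inf {c. 1 < c \<and> harnack_equiv K \<rho> c A B})"


section \<open>The operators of the distance formula\<close>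

definition reconstruction ::
    "('n::finite \<Rightarrow> 'h::chilbert_space \<Rightarrow> 'h) \<Rightarrow> ('n list, 'h) ell2 \<Rightarrow> ('n list, 'h) ell2"
  where "reconstruction X = (\<lambda>f. \<Sum>i\<in>UNIV. tensor_op (cadj (X i)) (right_creation i) f)"

definition Delta_op ::
    "real \<Rightarrow> ('n::finite \<Rightarrow> 'h::chilbert_space \<Rightarrow> 'h) \<Rightarrow> ('n list, 'h) ell2 \<Rightarrow> ('n list, 'h) ell2"
  where "Delta_op \<rho> X = (let R = reconstruction X in
    op_sqrt (\<lambda>f. \<rho> *\<^sub>R f + (1 - \<rho>) *\<^sub>R (cadj R f + R f) + (\<rho> - 2) *\<^sub>R cadj R (R f)))"

text \<open>For \<open>X\<close> in \<^term>\<open>rho_ball \<rho>\<close>, the function under \<^term>\<open>inv\<close> is a bijection.\<close>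

definition C_op ::
    "real \<Rightarrow> ('n::finite \<Rightarrow> 'h::chilbert_space \<Rightarrow> 'h) \<Rightarrow> ('n list, 'h) ell2 \<Rightarrow> ('n list, 'h) ell2"
  where "C_op \<rho> X = Delta_op \<rho> X \<circ> inv (\<lambda>f. f - reconstruction X f)"

end

theory Submission
  imports Defs
begin

text \<open>
  Put \<open>R = R\<^sub>X\<close> and let \<open>K\<^sub>X = C\<^sub>X\<^sup>* C\<^sub>X = (\<rho> - 2) I + (I - R)\<^sup>-\<^sup>1 + (I - R\<^sup>*)\<^sup>-\<^sup>1\<close> be the Poisson
  kernel of \<open>X\<close>. The norm of \<open>C\<^sub>X C\<^sub>Y\<^sup>-\<^sup>1\<close> is at most \<open>c\<close> exactly when \<open>K\<^sub>X \<le> c\<^sup>2 K\<^sub>Y\<close>, so it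
  suffices to see that this is the Harnack domination of \<open>X\<close> by \<open>Y\<close> with constant \<open>c\<close>.

  The compression of \<open>K\<^sub>X\<close> to finitely many words is \<open>Re p(X) + (\<rho> - 1) Re p(0)\<close> for a matrix
  polynomial \<open>p\<close> whose real part on a strict row contraction is a compression of its own (positive)
  Poisson kernel. This gives one direction. Conversely, if \<open>D = s\<^sup>2 K\<^sub>Y - K\<^sub>X\<close> is positive and
  invertible, then the operators \<open>D\<^sup>1\<^sup>/\<^sup>2 L\<^sub>i D\<^sup>-\<^sup>1\<^sup>/\<^sup>2\<close>, with \<open>L\<^sub>i\<close> the left creation operators, are
  isometries with orthogonal ranges, because \<open>D\<close> is multi-Toeplitz; evaluating a polynomial with
  nonnegative real part at them yields the inequality for the constant \<open>s\<close>, and \<open>s\<close> tends to \<open>c\<close>.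

  All invertibility comes from \<open>K\<^sub>X \<ge> \<epsilon> > 0\<close> on the ball, which the dilation of \<open>X / t\<close>, \<open>t < 1\<close>,
  reduces to the classical computation for a strict contraction.
\<close>

section \<open>Bounded operators and square roots\<close>

text \<open>Makes absolutely convergent series converge and spaces of bounded operators complete;
  the Neumann series and the fixed point for square roots rest on this.\<close>

instance chilbert_space \<subseteq> banach ..

section \<open>Closure properties of bounded complex-linear maps, and adjoints\<close>

lemma bounded_clinearI:
  assumes "\<And>x y. f (x + y) = f x + f y" and "\<And>c x. f (c *\<^sub>C x) = c *\<^sub>C f x"
    and "\<And>x. norm (f x) \<le> norm x * K"
  shows "bounded_clinear f"
  unfolding bounded_clinear_def using assms
  by (auto intro!: bounded_linear_intro[where K = K] simp flip: scaleC_of_real)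

lemma scaleC_scaleR_commute: "c *\<^sub>C (r *\<^sub>R x) = r *\<^sub>R (c *\<^sub>C (x :: 'a::chilbert_space))"
  by (simp add: scaleC_scaleC mult.commute flip: scaleC_of_real)

lemma cinner_scaleR_left: "cinner (r *\<^sub>R x) y = complex_of_real r * cinner (x :: 'a::chilbert_space) y"
  by (simp add: cinner_scaleC_left flip: scaleC_of_real)

lemma cinner_scaleR_right: "cinner x (r *\<^sub>R y) = complex_of_real r * cinner (x :: 'a::chilbert_space) y"
  by (simp add: cinner_scaleC_right flip: scaleC_of_real)

lemma scaleC_diff_right: "c *\<^sub>C (x - y) = c *\<^sub>C x - c *\<^sub>C (y :: 'a::chilbert_space)"
  by (rule complex_vector.scale_right_diff_distrib)

lemma bounded_clinear_ident: "bounded_clinear (\<lambda>x. x)"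
  unfolding bounded_clinear_def by (simp add: bounded_linear_ident)

lemma bounded_clinear_zero: "bounded_clinear (\<lambda>x. 0)"
  unfolding bounded_clinear_def by (simp add: bounded_linear_zero complex_vector.scale_zero_right)

lemma bounded_clinear_add:
  assumes "bounded_clinear f" "bounded_clinear g"
  shows "bounded_clinear (\<lambda>x. f x + g x)"
  using assms unfolding bounded_clinear_def by (simp add: bounded_linear_add scaleC_add_right)

lemma bounded_clinear_diff:
  assumes "bounded_clinear f" "bounded_clinear g"
  shows "bounded_clinear (\<lambda>x. f x - g x)"
  using assms unfolding bounded_clinear_def by (simp add: bounded_linear_sub scaleC_diff_right)

lemma bounded_clinear_scaleR:
  assumes "bounded_clinear f"
  shows "bounded_clinear (\<lambda>x. r *\<^sub>R f x)"
  using assms unfolding bounded_clinear_def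
  by (simp add: bounded_linear_const_scaleR scaleC_scaleR_commute)

lemma bounded_clinear_compose:
  assumes "bounded_clinear f" "bounded_clinear g"
  shows "bounded_clinear (\<lambda>x. f (g x))"
  using assms unfolding bounded_clinear_def
  by (simp add: bounded_linear_compose)

lemma bounded_clinear_sum:
  assumes "\<And>i. i \<in> I \<Longrightarrow> bounded_clinear (f i)"
  shows "bounded_clinear (\<lambda>x. \<Sum>i\<in>I. f i x)"
  using assms
  by (induction I rule: infinite_finite_induct)
    (simp_all add: bounded_clinear_zero bounded_clinear_add)

lemma bounded_clinear_funpow:
  fixes f :: "'a::chilbert_space \<Rightarrow> 'a"
  assumes "bounded_clinear f"
  shows "bounded_clinear (f ^^ k)"
proof (induction k)
  case 0
  then show ?case using bounded_clinear_ident by (simp add: id_def)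
next
  case (Suc k)
  then show ?case using bounded_clinear_compose[OF assms Suc] by (simp add: o_def)
qed

lemma cadj_eq':
  assumes "bounded_clinear f"
  shows "cinner (cadj f y) x = cinner y (f x)"
  using cadj_eq[OF assms, of x y] by (metis cinner_commute)

text \<open>A bound \<open>K\<close> for \<open>f\<close> also bounds the adjoint: in
  \<open>(norm (cadj f y))\<^sup>2 = inner (f (cadj f y)) y\<close> one factor
  \<open>norm (cadj f y)\<close> cancels.\<close>

lemma bounded_clinear_cadj:
  assumes f: "bounded_clinear f"
  shows "bounded_clinear (cadj f)"
proof -
  obtain K where K: "\<And>x. norm (f x) \<le> norm x * K" "0 \<le> K"
    using bounded_linear.nonneg_bounded[OF clinear_simps(1)[OF f]] by blast
  show ?thesis
  proof (rule bounded_clinearI[where K = K])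
    show "cadj f (x + y) = cadj f x + cadj f y" for x y
      by (rule cinner_ext) (simp add: cinner_add_right flip: cadj_eq[OF f])
    show "cadj f (c *\<^sub>C x) = c *\<^sub>C cadj f x" for c x
      by (rule cinner_ext) (simp add: cinner_scaleC_right flip: cadj_eq[OF f])
    fix y
    have "(norm (cadj f y))\<^sup>2 = inner (f (cadj f y)) y"
      by (simp add: power2_norm_eq_inner cadj_eq[OF f] flip: Re_cinner)
    also have "\<dots> \<le> norm (f (cadj f y)) * norm y" by (rule norm_cauchy_schwarz)
    also have "\<dots> \<le> (norm (cadj f y) * K) * norm y" by (intro mult_right_mono K) simp
    finally have "norm (cadj f y) * norm (cadj f y) \<le> norm (cadj f y) * (norm y * K)"
      by (simp add: power2_eq_square mult_ac)
    moreover have "0 \<le> norm y * K"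
      using K(2) by simp
    ultimately show "norm (cadj f y) \<le> norm y * K"
      by (cases "cadj f y = 0") (auto simp: mult_le_cancel_left)
  qed
qed

section \<open>Operators with a positive lower bound: inversion and square roots\<close>

text \<open>Expanding the square bounds \<open>norm (x - s *\<^sub>R A x)\<close> by the root of
  \<open>1 - 2 * s * e + s\<^sup>2 * M\<^sup>2\<close> times \<open>norm x\<close>, where
  \<open>M\<close> bounds \<open>A\<close>. The choice \<open>s = e / M\<^sup>2\<close> minimises
  this factor.\<close>

lemma lower_bound_contraction:
  fixes A :: "'a::real_inner \<Rightarrow> 'a"
  assumes A: "bounded_linear A" and "0 < e" and lower: "\<And>x. e * (norm x)\<^sup>2 \<le> inner (A x) x"
  obtains s q where "0 < s" "0 \<le> q" "q < 1" "\<And>x. norm (x - s *\<^sub>R A x) \<le> q * norm x"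
proof -
  obtain K where K: "\<And>x. norm (A x) \<le> norm x * K" "0 < K"
    using bounded_linear.pos_bounded[OF A] by blast
  \<comment> \<open>The maximum with \<open>e\<close> keeps
    \<open>b = 1 - e\<^sup>2 / M\<^sup>2\<close> nonnegative, so that its root can be taken.\<close>
  define M where "M = max K e"
  have M: "norm (A x) \<le> norm x * M" "e \<le> M" "0 < M" for x
    using order_trans[OF K(1) mult_left_mono[of K M "norm x"]] K(2) by (auto simp: M_def)
  define s where "s = e / M\<^sup>2"
  define b where "b = 1 - e\<^sup>2 / M\<^sup>2"
  have s: "0 < s" using \<open>0 < e\<close> M by (simp add: s_def)
  have b: "0 \<le> b" "b < 1"
    using \<open>0 < e\<close> M by (auto simp: b_def power_mono)
  have "(norm (x - s *\<^sub>R A x))\<^sup>2 \<le> (sqrt b * norm x)\<^sup>2" for x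
  proof -
    have "(norm (x - s *\<^sub>R A x))\<^sup>2 = (norm x)\<^sup>2 - 2 * s * inner (A x) x + s\<^sup>2 * (norm (A x))\<^sup>2"
      by (simp only: power2_norm_eq_inner)
        (simp add: inner_diff inner_commute algebra_simps power2_eq_square)
    also have "\<dots> \<le> (norm x)\<^sup>2 - 2 * s * (e * (norm x)\<^sup>2) + s\<^sup>2 * (norm x * M)\<^sup>2"
      using s by (intro add_mono diff_mono mult_left_mono lower power_mono M) auto
    also have "\<dots> = b * (norm x)\<^sup>2"
      using M(3) by (simp add: s_def b_def field_simps power2_eq_square)
    finally show ?thesis using b by (simp add: power_mult_distrib)
  qed
  then have "norm (x - s *\<^sub>R A x) \<le> sqrt b * norm x" for x
    using b by (meson mult_nonneg_nonneg norm_ge_zero power2_le_imp_le real_sqrt_ge_zero)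
  moreover have "sqrt b < 1" using b by simp
  ultimately show ?thesis using that[of s "sqrt b"] s b by auto
qed

text \<open>The Lax-Milgram argument: a solution of \<open>A x = y\<close> is a fixed point of the
  contraction sending \<open>x\<close> to \<open>x - s *\<^sub>R (A x - y)\<close>.\<close>

lemma bij_lower_bound:
  fixes A :: "'a::{real_inner, complete_space} \<Rightarrow> 'a"
  assumes A: "bounded_linear A" and "0 < e" and lower: "\<And>x. e * (norm x)\<^sup>2 \<le> inner (A x) x"
  shows "bij A"
proof (rule bijI)
  interpret bounded_linear A by (rule A)
  obtain s q where s: "0 < s" "0 \<le> q" "q < 1" "\<And>x. norm (x - s *\<^sub>R A x) \<le> q * norm x"
    using lower_bound_contraction[OF assms] by metis
  show "inj A"
  proof (rule injI)
    fix x y assume "A x = A y"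
    then have "e * (norm (x - y))\<^sup>2 \<le> 0" using lower[of "x - y"] by (simp add: diff)
    then show "x = y" using \<open>0 < e\<close> by (simp add: mult_le_0_iff)
  qed
  have "\<exists>x. A x = y" for y
  proof -
    have "\<exists>!x\<in>UNIV. x - s *\<^sub>R (A x - y) = x"
    proof (rule Banach_fix)
      show "dist (x - s *\<^sub>R (A x - y)) (z - s *\<^sub>R (A z - y)) \<le> q * dist x z" for x z
        using s(4)[of "x - z"] by (simp add: dist_norm diff algebra_simps)
    qed (use s in auto)
    then show ?thesis using s(1) by auto
  qed
  then show "surj A" by (metis surj_def)
qed

lemma inv_lower_bound:
  fixes A :: "'a::chilbert_space \<Rightarrow> 'b::chilbert_space"
  assumes A: "bounded_clinear A" and "bij A" and "0 < e"
    and lower: "\<And>x. e * norm x \<le> norm (A x)"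
  shows "bounded_clinear (inv A)" "norm (inv A y) \<le> norm y / e"
proof -
  note lin = clinear_simps[OF A]
  have AI: "A (inv A y) = y" for y
    using \<open>bij A\<close> by (simp add: bij_is_surj surj_f_inv_f)
  have IA: "inv A (A y) = y" for y
    using \<open>bij A\<close> by (simp add: bij_is_inj)
  have n: "norm (inv A y) \<le> norm y / e" for y
    using lower[of "inv A y"] \<open>0 < e\<close> by (simp add: AI field_simps)
  then show "norm (inv A y) \<le> norm y / e" .
  show "bounded_clinear (inv A)"
  proof (rule bounded_clinearI[where K = "1 / e"])
    show "inv A (x + y) = inv A x + inv A y" for x y
      by (metis AI IA lin(2))
    show "inv A (c *\<^sub>C x) = c *\<^sub>C inv A x" for c x
      by (metis AI IA lin(5))
  qed (use n in simp)
qed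

text \<open>With \<open>B = I - s A\<close> of norm below 1, the equation
  \<open>z = (B + z z) / 2\<close> says \<open>(I - z) (I - z) = s A\<close>, so
  \<open>S = (I - z) / sqrt s\<close> is a root. Banach's theorem supplies \<open>z\<close>. The
  last conclusion, commutation with the commutant of \<open>A\<close>, serves the uniqueness of the
  positive root.\<close>

lemma square_root_exists:
  fixes A :: "'a::chilbert_space \<Rightarrow> 'a"
  assumes A: "bounded_clinear A" and self: "\<And>x y. cinner (A x) y = cinner x (A y)"
    and "0 < e" and lower: "\<And>x. e * (norm x)\<^sup>2 \<le> inner (A x) x"
  obtains S d where "bounded_clinear S" "\<And>x y. cinner (S x) y = cinner x (S y)"
    "0 < d" "\<And>x. d * (norm x)\<^sup>2 \<le> inner (S x) x" "\<And>x. S (S x) = A x"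
    "\<And>T x. bounded_linear T \<Longrightarrow> (\<And>y. T (A y) = A (T y)) \<Longrightarrow> T (S x) = S (T x)"
proof -
  note lin = clinear_simps[OF A]
  obtain s q where s: "0 < s" "0 \<le> q" "q < 1" "\<And>x. norm (x - s *\<^sub>R A x) \<le> q * norm x"
    using lower_bound_contraction[OF lin(1) \<open>0 < e\<close> lower] by metis
  define B where "B = Blinfun (\<lambda>x. x - s *\<^sub>R A x)"
  have B: "blinfun_apply B x = x - s *\<^sub>R A x" for x
    unfolding B_def
    by (subst bounded_linear_Blinfun_apply)
      (auto intro!: bounded_linear_sub bounded_linear_ident bounded_linear_const_scaleR lin)
  have normB: "norm B \<le> q"
    by (rule norm_blinfun_bound) (use s in \<open>auto simp: B\<close>)
  define comm where "comm T \<longleftrightarrow> bounded_linear T \<and> (\<forall>x. T (A x) = A (T x))" for T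
  \<comment> \<open>Everything wanted of the root is put into a closed set that \<open>F\<close>
    maps to itself, so the fixed point inherits it.\<close>
  define Z where "Z = {z :: 'a \<Rightarrow>\<^sub>L 'a. norm z \<le> q \<and>
    (\<forall>c x. blinfun_apply z (c *\<^sub>C x) = c *\<^sub>C blinfun_apply z x) \<and>
    (\<forall>x y. cinner (blinfun_apply z x) y = cinner x (blinfun_apply z y)) \<and>
    (\<forall>T\<in>Collect comm. \<forall>x. T (blinfun_apply z x) = blinfun_apply z (T x))}"
  define F where "F z = (1 / 2) *\<^sub>R (B + (z o\<^sub>L z))" for z :: "'a \<Rightarrow>\<^sub>L 'a"
  have F: "blinfun_apply (F z) x = (1 / 2) *\<^sub>R (x - s *\<^sub>R A x + blinfun_apply z (blinfun_apply z x))" for z x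
    by (simp add: F_def B blinfun.bilinear_simps)
  have app: "continuous_on UNIV (\<lambda>z. blinfun_apply z x)" for x :: 'a
    by (intro continuous_intros)
  have "closed Z"
  proof -
    have "closed {z :: 'a \<Rightarrow>\<^sub>L 'a. blinfun_apply z (c *\<^sub>C x) = c *\<^sub>C blinfun_apply z x}" for c x
      by (intro closed_Collect_eq app bounded_linear.continuous_on[OF bounded_linear_scaleC])
    moreover have "closed {z :: 'a \<Rightarrow>\<^sub>L 'a. cinner (blinfun_apply z x) y = cinner x (blinfun_apply z y)}" for x y
    proof -
      have "continuous_on UNIV (\<lambda>z :: 'a \<Rightarrow>\<^sub>L 'a. cinner x (blinfun_apply z y))"
        unfolding cinner_commute[of x]
        by (intro continuous_on_cnj bounded_linear.continuous_on[OF bounded_linear_cinner_left] app)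
      then show ?thesis
        by (intro closed_Collect_eq bounded_linear.continuous_on[OF bounded_linear_cinner_left] app)
    qed
    moreover have "closed {z :: 'a \<Rightarrow>\<^sub>L 'a. T (blinfun_apply z x) = blinfun_apply z (T x)}" if "comm T" for T x
      using that unfolding comm_def
      by (intro closed_Collect_eq app bounded_linear.continuous_on[of T]) auto
    moreover have "closed {z :: 'a \<Rightarrow>\<^sub>L 'a. norm z \<le> q}"
      by (intro closed_Collect_le continuous_intros)
    ultimately have "closed ({z :: 'a \<Rightarrow>\<^sub>L 'a. norm z \<le> q} \<inter>
        {z. \<forall>c x. blinfun_apply z (c *\<^sub>C x) = c *\<^sub>C blinfun_apply z x} \<inter>
        {z. \<forall>x y. cinner (blinfun_apply z x) y = cinner x (blinfun_apply z y)} \<inter>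
        (\<Inter>T\<in>Collect comm. {z. \<forall>x. T (blinfun_apply z x) = blinfun_apply z (T x)}))"
      by (intro closed_Int closed_INT ballI closed_Collect_all) auto
    moreover have "Z = {z :: 'a \<Rightarrow>\<^sub>L 'a. norm z \<le> q} \<inter>
        {z. \<forall>c x. blinfun_apply z (c *\<^sub>C x) = c *\<^sub>C blinfun_apply z x} \<inter>
        {z. \<forall>x y. cinner (blinfun_apply z x) y = cinner x (blinfun_apply z y)} \<inter>
        (\<Inter>T\<in>Collect comm. {z. \<forall>x. T (blinfun_apply z x) = blinfun_apply z (T x)})"
      unfolding Z_def by blast
    ultimately show ?thesis by simp
  qed
  have "\<exists>!z\<in>Z. F z = z"
  proof (rule Banach_fix)
    show "complete Z" using \<open>closed Z\<close> by (simp add: complete_eq_closed)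
    have "(0 :: 'a \<Rightarrow>\<^sub>L 'a) \<in> Z"
      using s(2) by (auto simp: Z_def comm_def linear_simps complex_vector.scale_zero_right)
    then show "Z \<noteq> {}" by blast
    show "F ` Z \<subseteq> Z"
    proof safe
      fix z assume z: "z \<in> Z"
      have "norm (B + (z o\<^sub>L z)) \<le> q + q"
      proof (rule norm_triangle_mono[OF normB])
        have "norm (z o\<^sub>L z) \<le> norm z * norm z" by (rule norm_blinfun_compose)
        also have "\<dots> \<le> q * 1" using z s(2,3) by (intro mult_mono) (auto simp: Z_def)
        finally show "norm (z o\<^sub>L z) \<le> q" by simp
      qed
      moreover have "T (blinfun_apply (F z) x) = blinfun_apply (F z) (T x)" if "comm T" for T x
      proof -
        have "T (blinfun_apply z y) = blinfun_apply z (T y)" for y using z that by (auto simp: Z_def)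
        then show ?thesis using that by (simp add: F comm_def linear_simps)
      qed
      ultimately show "F z \<in> Z"
        using z unfolding Z_def
        by (auto simp: F_def[of z, THEN arg_cong[of _ _ norm]] F lin self cinner_scaleR_left cinner_scaleR_right
            cinner_add_left cinner_add_right cinner_diff_left cinner_diff_right
            scaleC_scaleR_commute scaleC_add_right scaleC_diff_right)
    qed
    show "dist (F z) (F w) \<le> q * dist z w" if "z \<in> Z" "w \<in> Z" for z w
    proof -
      \<comment> \<open>This splitting of \<open>z z - w w\<close> holds without commutation, and
        each factor \<open>z\<close>, \<open>w\<close> has norm at most \<open>q\<close>.\<close>
      have "F z - F w = (1 / 2) *\<^sub>R ((z o\<^sub>L (z - w)) + ((z - w) o\<^sub>L w))"
        by (rule blinfun_eqI) (simp add: F blinfun.bilinear_simps algebra_simps)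
      then have "dist (F z) (F w) = (1 / 2) * norm ((z o\<^sub>L (z - w)) + ((z - w) o\<^sub>L w))"
        by (simp add: dist_norm)
      also have "\<dots> \<le> (1 / 2) * (q * norm (z - w) + norm (z - w) * q)"
        using that s(2)
        by (intro mult_left_mono norm_triangle_mono
            order_trans[OF norm_blinfun_compose mult_right_mono]
            order_trans[OF norm_blinfun_compose mult_left_mono]) (auto simp: Z_def)
      finally show ?thesis by (simp add: dist_norm)
    qed
  qed (use s in auto)
  then obtain z where z: "z \<in> Z" "F z = z" by blast
  let ?z = "blinfun_apply z"
  have zz: "?z (?z x) = 2 *\<^sub>R ?z x - x + s *\<^sub>R A x" for x
  proof -
    have "2 *\<^sub>R ?z x = 2 *\<^sub>R blinfun_apply (F z) x" by (simp only: z(2))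
    then show ?thesis by (simp add: F)
  qed
  define S where "S x = (1 / sqrt s) *\<^sub>R (x - ?z x)" for x
  have zlin: "bounded_clinear (blinfun_apply z)"
    using z(1) by (auto simp: Z_def bounded_clinear_def blinfun.bounded_linear_right)
  show ?thesis
  proof (rule that)
    show "bounded_clinear S"
      unfolding S_def
      by (intro bounded_clinear_scaleR bounded_clinear_diff bounded_clinear_ident zlin)
    show "cinner (S x) y = cinner x (S y)" for x y
      using z(1) by (simp add: Z_def S_def cinner_scaleR_left cinner_scaleR_right cinner_diff_left cinner_diff_right)
    show "0 < (1 - q) / sqrt s" using s by simp
    show "(1 - q) / sqrt s * (norm x)\<^sup>2 \<le> inner (S x) x" for x
    proof -
      have "inner (?z x) x \<le> norm (?z x) * norm x" by (rule norm_cauchy_schwarz)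
      also have "\<dots> \<le> (q * norm x) * norm x"
        using z(1) by (intro mult_right_mono order_trans[OF norm_blinfun] mult_right_mono) (auto simp: Z_def)
      finally have "(1 - q) * (norm x)\<^sup>2 \<le> inner (x - ?z x) x"
        by (simp add: inner_diff_left dot_square_norm algebra_simps power2_eq_square)
      then show ?thesis using s(1) by (simp add: S_def divide_right_mono)
    qed
    show "S (S x) = A x" for x
    proof -
      have "S (S x) = (1 / s) *\<^sub>R (x - ?z x - ?z (x - ?z x))"
        using s(1) by (simp add: S_def blinfun.scaleR_right flip: scaleR_diff_right)
      also have "x - ?z x - ?z (x - ?z x) = s *\<^sub>R A x"
        by (simp add: blinfun.diff_right zz scaleR_2)
      finally show ?thesis using s(1) by simp
    qed
    show "T (S x) = S (T x)" if "bounded_linear T" "\<And>y. T (A y) = A (T y)" for T x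
      using z(1) that by (simp add: Z_def S_def comm_def linear_simps)
  qed
qed

text \<open>\<open>op_sqrt\<close> is a definite description, so uniqueness is needed as well. A
  positive root \<open>T\<close> commutes with \<open>A = T T\<close>, hence with the root
  \<open>S\<close> constructed above; strict positivity of \<open>S\<close> then forces
  \<open>T = S\<close>.\<close>

lemma op_sqrt_lower_bound:
  fixes A :: "'a::chilbert_space \<Rightarrow> 'a"
  assumes A: "bounded_clinear A" and self: "\<And>x y. cinner (A x) y = cinner x (A y)"
    and "0 < e" and lower: "\<And>x. e * (norm x)\<^sup>2 \<le> inner (A x) x"
  obtains d where "bounded_clinear (op_sqrt A)"
    "\<And>x y. cinner (op_sqrt A x) y = cinner x (op_sqrt A y)" "\<And>x. op_sqrt A (op_sqrt A x) = A x"
    "0 < d" "\<And>x. d * (norm x)\<^sup>2 \<le> inner (op_sqrt A x) x"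
proof -
  obtain S d where S: "bounded_clinear S" "\<And>x y. cinner (S x) y = cinner x (S y)"
    "0 < d" "\<And>x. d * (norm x)\<^sup>2 \<le> inner (S x) x" "\<And>x. S (S x) = A x"
    "\<And>T x. bounded_linear T \<Longrightarrow> (\<And>y. T (A y) = A (T y)) \<Longrightarrow> T (S x) = S (T x)"
    using square_root_exists[OF assms] by blast
  have "op_sqrt A = S"
    unfolding op_sqrt_def
  proof (rule the_equality)
    have "Im (cinner (S x) x) = 0" for x
      using S(2)[of x x] cinner_commute[of "S x" x] by (metis add.inverse_neutral cnj.simps(2) equal_neg_zero)
    moreover have "0 \<le> Re (cinner (S x) x)" for x
      using order_trans[OF mult_nonneg_nonneg[of d "(norm x)\<^sup>2"] S(4)] S(3) by (simp add: Re_cinner)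
    ultimately show "positive_op S \<and> S \<circ> S = A"
      using S(1,5) by (auto simp: positive_op_def)
    fix T assume T: "positive_op T \<and> T \<circ> T = A"
    then have TT: "T (T x) = A x" and T1: "bounded_clinear T" and T2: "0 \<le> inner (T x) x" for x
      by (auto simp: positive_op_def Re_cinner[symmetric])
    note Tl = clinear_simps[OF T1] and Sl = clinear_simps[OF S(1)]
    have TS: "T (S x) = S (T x)" for x
      by (rule S(6)) (simp_all add: Tl flip: TT)
    show "T = S"
    proof
      fix x
      let ?y = "S x - T x"
      \<comment> \<open>Since \<open>S\<close> and \<open>T\<close> commute,
        \<open>(S + T) (S - T) = S S - T T = 0\<close>.\<close>
      have "S ?y + T ?y = 0" by (simp add: Sl Tl TS S(5) TT)
      then have "inner (S ?y) ?y + inner (T ?y) ?y = 0" by (metis inner_add_left inner_zero_left)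
      then have "d * (norm ?y)\<^sup>2 \<le> 0" using S(4)[of ?y] T2[of ?y] by linarith
      then show "T x = S x" using S(3) by (simp add: mult_le_0_iff)
    qed
  qed
  then show ?thesis using that[of d] S by metis
qed

section \<open>Reconstruction operators and the Poisson kernel\<close>

lemma ell2_eqI: "(\<And>i. Rep_ell2 x i = Rep_ell2 y i) \<Longrightarrow> x = y"
  by (metis Rep_ell2_inject ext)

lemma Rep_ell2_sum: "Rep_ell2 (sum g A) i = (\<Sum>a\<in>A. Rep_ell2 (g a) i)"
  by (induction A rule: infinite_finite_induct) (auto simp: zero_ell2.rep_eq plus_ell2.rep_eq)

lemma norm_ell2_le:
  assumes "\<And>F. finite F \<Longrightarrow> (\<Sum>i\<in>F. (norm (Rep_ell2 x i))\<^sup>2) \<le> c\<^sup>2" and "0 \<le> c"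
  shows "norm x \<le> c"
proof (rule power2_le_imp_le)
  show "(norm x)\<^sup>2 \<le> c\<^sup>2"
    unfolding ell2_norm_sq by (rule infsum_le_finite_sums[OF ell2_summable]) (use assms in simp)
qed (use assms in simp)

lemma word_op_append: "word_op T (\<alpha> @ \<beta>) x = word_op T \<alpha> (word_op T \<beta> x)"
  by (induction \<alpha>) auto

lemma bounded_clinear_word_op:
  assumes "\<And>i. bounded_clinear (T i)"
  shows "bounded_clinear (word_op T \<alpha>)"
proof (induction \<alpha>)
  case Nil
  then show ?case using bounded_clinear_ident by (simp add: id_def)
next
  case (Cons i \<alpha>)
  then show ?case using bounded_clinear_compose[OF assms Cons] by (simp add: o_def)
qed

lemma word_op_scaleR:
  assumes "\<And>i. bounded_clinear (T i)"
  shows "word_op (\<lambda>i x. r *\<^sub>R T i x) \<alpha> x = r ^ length \<alpha> *\<^sub>R word_op T \<alpha> x"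
  by (induction \<alpha>) (auto simp: linear_simps[OF clinear_simps(1)[OF assms]])

section \<open>The reconstruction operator: coordinates, powers and norm\<close>

text \<open>The \<open>i\<close>-th summand appends the letter \<open>i\<close>, so at the word
  \<open>w\<close> only \<open>i = last w\<close> contributes.\<close>

lemma reconstruction_rep:
  assumes "\<And>i. bounded_clinear (X i)"
  shows "Rep_ell2 (reconstruction X f) w =
    (if w = [] then 0 else cadj (X (last w)) (Rep_ell2 f (butlast w)))"
  unfolding reconstruction_def Rep_ell2_sum
  by (simp add: tensor_op_right_creation(1)[OF bounded_clinear_cadj[OF assms]])

lemma bounded_clinear_reconstruction:
  assumes "\<And>i. bounded_clinear (X i)"
  shows "bounded_clinear (reconstruction X)"
  unfolding reconstruction_def
  by (intro bounded_clinear_sum tensor_op_right_creation(2) bounded_clinear_cadj assms)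

text \<open>The \<open>k\<close>-th power strips the last \<open>k\<close> letters and applies the
  adjoints belonging to them. Pairing with \<open>h\<close> moves these adjoints to the other side,
  where they form the word operator of the stripped suffix.\<close>

lemma cinner_reconstruction_funpow:
  assumes X: "\<And>i. bounded_clinear (X i)"
  shows "cinner (Rep_ell2 ((reconstruction X ^^ k) f) w) h =
    (if k \<le> length w
     then cinner (Rep_ell2 f (take (length w - k) w)) (word_op X (drop (length w - k) w) h)
     else 0)"
proof (induction k arbitrary: w h)
  case 0
  then show ?case by simp
next
  case (Suc k)
  show ?case
  proof (cases w rule: rev_cases)
    case Nil
    then show ?thesis by (simp add: reconstruction_rep[OF X])
  next
    case (snoc v i)
    then show ?thesis
      by (simp add: reconstruction_rep[OF X] cadj_eq'[OF X] Suc word_op_append)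
  qed
qed

text \<open>A bound for the row operator passes to its adjoint, the column: test the row at the
  vectors \<open>cadj (X i) y\<close>.\<close>

lemma column_bound:
  fixes X :: "'n::finite \<Rightarrow> 'a::chilbert_space \<Rightarrow> 'a"
  assumes X: "\<And>i. bounded_clinear (X i)"
    and row: "\<And>z. (norm (\<Sum>i\<in>UNIV. X i (z i)))\<^sup>2 \<le> c\<^sup>2 * (\<Sum>i\<in>UNIV. (norm (z i))\<^sup>2)"
  shows "(\<Sum>i\<in>UNIV. (norm (cadj (X i) y))\<^sup>2) \<le> c\<^sup>2 * (norm y)\<^sup>2"
proof -
  define s where "s = (\<Sum>i\<in>UNIV. (norm (cadj (X i) y))\<^sup>2)"
  define u where "u = (\<Sum>i\<in>UNIV. X i (cadj (X i) y))"
  have s: "0 \<le> s" by (simp add: s_def sum_nonneg)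
  have "s = inner u y"
    unfolding s_def u_def inner_sum_left
    by (rule sum.cong) (simp_all add: power2_norm_eq_inner cadj_eq[OF X] flip: Re_cinner)
  also have "\<dots> \<le> norm u * norm y" by (rule norm_cauchy_schwarz)
  finally have "s\<^sup>2 \<le> (norm u * norm y)\<^sup>2" using s by (rule power_mono)
  also have "\<dots> \<le> (c\<^sup>2 * s) * (norm y)\<^sup>2"
    unfolding power_mult_distrib s_def u_def by (intro mult_right_mono row) simp
  finally have "s * s \<le> s * (c\<^sup>2 * (norm y)\<^sup>2)" by (simp add: power2_eq_square mult_ac)
  then have "s \<le> c\<^sup>2 * (norm y)\<^sup>2"
    using s by (cases "s = 0") (auto simp: mult_le_cancel_left)
  then show ?thesis by (simp add: s_def)
qed

text \<open>The entry at \<open>v @ [i]\<close> is \<open>cadj (X i)\<close> applied to the entry of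
  \<open>f\<close> at \<open>v\<close>, so the words with common prefix \<open>v\<close> together
  contribute one column.\<close>

lemma norm_reconstruction_le:
  fixes X :: "'n::finite \<Rightarrow> 'a::chilbert_space \<Rightarrow> 'a"
  assumes X: "\<And>i. bounded_clinear (X i)" and "0 \<le> c"
    and col: "\<And>y. (\<Sum>i\<in>UNIV. (norm (cadj (X i) y))\<^sup>2) \<le> c\<^sup>2 * (norm y)\<^sup>2"
  shows "norm (reconstruction X f) \<le> c * norm f"
proof (rule norm_ell2_le)
  fix F :: "'n list set" assume "finite F"
  define G where "G = F - {[]}"
  have fin: "finite G" using \<open>finite F\<close> by (simp add: G_def)
  let ?g = "\<lambda>(v, i). (norm (cadj (X i) (Rep_ell2 f v)))\<^sup>2"
  \<comment> \<open>Splitting off the last letter is injective only on nonempty words; at the empty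
    word the entry is 0.\<close>
  have inj: "inj_on (\<lambda>w. (butlast w, last w)) G"
    by (rule inj_onI) (metis DiffD2 G_def append_butlast_last_id prod.inject singletonI)
  have "(\<Sum>w\<in>F. (norm (Rep_ell2 (reconstruction X f) w))\<^sup>2)
      = (\<Sum>w\<in>G. (norm (Rep_ell2 (reconstruction X f) w))\<^sup>2)"
    using \<open>finite F\<close> by (intro sum.mono_neutral_right) (auto simp: G_def reconstruction_rep[OF X])
  also have "\<dots> = (\<Sum>w\<in>G. ?g (butlast w, last w))"
    by (rule sum.cong) (auto simp: G_def reconstruction_rep[OF X])
  also have "\<dots> = sum ?g ((\<lambda>w. (butlast w, last w)) ` G)"
    by (simp add: sum.reindex[OF inj])
  also have "\<dots> \<le> sum ?g (butlast ` G \<times> UNIV)"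
    using fin by (intro sum_mono2) auto
  also have "\<dots> = (\<Sum>v\<in>butlast ` G. \<Sum>i\<in>UNIV. (norm (cadj (X i) (Rep_ell2 f v)))\<^sup>2)"
    by (simp add: sum.cartesian_product)
  also have "\<dots> \<le> (\<Sum>v\<in>butlast ` G. c\<^sup>2 * (norm (Rep_ell2 f v))\<^sup>2)"
    by (intro sum_mono col)
  also have "\<dots> \<le> c\<^sup>2 * (norm f)\<^sup>2"
    unfolding sum_distrib_left[symmetric] using fin by (intro mult_left_mono ell2_sum_le) auto
  finally show "(\<Sum>w\<in>F. (norm (Rep_ell2 (reconstruction X f) w))\<^sup>2) \<le> (c * norm f)\<^sup>2"
    by (simp add: power_mult_distrib)
qed (use assms in simp)

section \<open>Neumann series of operators with geometrically decaying powers\<close>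

text \<open>For \<open>\<rho> > 1\<close> a tuple in the ball may have a reconstruction operator of
  norm above 1; what survives is the geometric decay of its powers.\<close>

definition power_stable :: "('a::chilbert_space \<Rightarrow> 'a) \<Rightarrow> bool"
  where "power_stable R \<longleftrightarrow> bounded_clinear R \<and>
    (\<exists>C t. 0 \<le> t \<and> t < 1 \<and> (\<forall>k f. norm ((R ^^ k) f) \<le> C * t ^ k * norm f))"

definition neumann :: "('a::chilbert_space \<Rightarrow> 'a) \<Rightarrow> 'a \<Rightarrow> 'a"
  where "neumann R f = (\<Sum>k. (R ^^ k) f)"

lemma power_stable_contraction:
  assumes "bounded_clinear R" "0 \<le> t" "t < 1" "\<And>f. norm (R f) \<le> t * norm f"
  shows "power_stable R"
proof -
  have "norm ((R ^^ k) f) \<le> 1 * t ^ k * norm f" for k f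
  proof (induction k)
    case (Suc k)
    have "norm (R ((R ^^ k) f)) \<le> t * norm ((R ^^ k) f)" by (rule assms)
    also have "\<dots> \<le> t * (1 * t ^ k * norm f)" by (intro mult_left_mono Suc assms)
    finally show ?case by simp
  qed simp
  then show ?thesis using assms unfolding power_stable_def by blast
qed

text \<open>The decay makes the series converge absolutely, and both inverse identities follow by
  telescoping.\<close>

lemma
  assumes "power_stable R"
  shows neumann_sums: "(\<lambda>k. (R ^^ k) f) sums neumann R f"
    and bounded_clinear_neumann: "bounded_clinear (neumann R)"
    and neumann_right: "neumann R f - R (neumann R f) = f"
    and neumann_left: "neumann R (f - R f) = f"
proof -
  have R: "bounded_clinear R" using assms by (simp add: power_stable_def)
  note lin = clinear_simps[OF R]
  note plin = clinear_simps[OF bounded_clinear_funpow[OF R]]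
  obtain C t where t: "0 \<le> t" "t < 1" and b: "\<And>k f. norm ((R ^^ k) f) \<le> C * t ^ k * norm f"
    using assms unfolding power_stable_def by blast
  have g: "summable (\<lambda>k. C * t ^ k * norm f)" for f :: 'a
    using t by (intro summable_mult2 summable_mult summable_geometric) simp
  have summ: "summable (\<lambda>k. norm ((R ^^ k) f))" for f
    by (rule summable_comparison_test'[OF g[of f], of 0]) (use b in simp)
  have s: "(\<lambda>k. (R ^^ k) f) sums neumann R f" for f
    unfolding neumann_def using summable_norm_cancel[OF summ] by (rule summable_sums)
  then show "(\<lambda>k. (R ^^ k) f) sums neumann R f" .
  show "bounded_clinear (neumann R)"
  proof (rule bounded_clinearI[where K = "\<Sum>k. C * t ^ k"])
    show "neumann R (x + y) = neumann R x + neumann R y" for x y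
      using sums_unique2[OF s[of "x + y"]] sums_add[OF s[of x] s[of y]] by (simp add: plin)
    show "neumann R (c *\<^sub>C x) = c *\<^sub>C neumann R x" for c x
      using sums_unique2[OF s[of "c *\<^sub>C x"]] bounded_linear.sums[OF bounded_linear_scaleC s[of x]]
      by (simp add: plin)
    show "norm (neumann R x) \<le> norm x * (\<Sum>k. C * t ^ k)" for x
    proof -
      have "norm (neumann R x) \<le> (\<Sum>k. norm ((R ^^ k) x))"
        unfolding neumann_def by (rule summable_norm[OF summ])
      also have "\<dots> \<le> (\<Sum>k. C * t ^ k * norm x)" by (intro suminf_le b summ g)
      also have "\<dots> = norm x * (\<Sum>k. C * t ^ k)"
        using t by (subst suminf_mult2[symmetric]) (auto intro: summable_mult summable_geometric)
      finally show ?thesis .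
    qed
  qed
  have "(\<lambda>k. (R ^^ Suc k) f) sums (neumann R f - f)" for f
    using s[of f] by (subst sums_Suc_iff) simp
  then have shift: "(\<lambda>k. R ((R ^^ k) f)) sums (neumann R f - f)" for f by simp
  have "R (neumann R f) = neumann R f - f"
    using sums_unique2[OF bounded_linear.sums[OF lin(1) s] shift] .
  then show "neumann R f - R (neumann R f) = f" by simp
  have "(\<lambda>k. (R ^^ k) f - R ((R ^^ k) f)) sums (neumann R f - (neumann R f - f))"
    by (intro sums_diff s shift)
  moreover have "(R ^^ k) f - R ((R ^^ k) f) = (R ^^ k) (f - R f)" for k
    by (simp add: plin funpow_swap1)
  ultimately have "(\<lambda>k. (R ^^ k) (f - R f)) sums f" by simp
  then show "neumann R (f - R f) = f" using sums_unique2[OF s] by blast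
qed

lemma inner_neumann_sums:
  assumes "power_stable R"
  shows "(\<lambda>k. inner ((R ^^ k) f) g) sums inner (neumann R f) g"
  by (rule bounded_linear.sums[OF bounded_linear_inner_left neumann_sums[OF assms]])

lemma cinner_neumann_sums:
  assumes "power_stable R"
  shows "(\<lambda>k. cinner ((R ^^ k) f) g) sums cinner (neumann R f) g"
  by (rule bounded_linear.sums[OF bounded_linear_cinner_left neumann_sums[OF assms]])

text \<open>The second claim turns the \<open>inv\<close> in the definition of \<open>C_op\<close>
  into a Neumann series.\<close>

lemma bij_neumann:
  assumes "power_stable R"
  shows "bij (neumann R)" and "inv (\<lambda>f. f - R f) = neumann R"
proof -
  show "bij (neumann R)"
    by (rule o_bij[of "\<lambda>f. f - R f"]) (auto simp: neumann_left[OF assms] neumann_right[OF assms])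
  show "inv (\<lambda>f. f - R f) = neumann R"
    by (rule inv_equality) (simp_all add: neumann_left[OF assms] neumann_right[OF assms])
qed

text \<open>
  Since \<open>\<rho> + (1 - \<rho>) (R\<^sup>* + R) + (\<rho> - 2) R\<^sup>*R\<close> equals
  \<open>(\<rho> - 2) (I - R)\<^sup>* (I - R) + (I - R)\<^sup>* + (I - R)\<close>, conjugating with the inverse of \<open>I - R\<close>
  turns \<open>\<Delta>\<^sup>2\<close> into the following operator.
\<close>

definition poisson :: "real \<Rightarrow> ('a::chilbert_space \<Rightarrow> 'a) \<Rightarrow> 'a \<Rightarrow> 'a"
  where "poisson \<rho> R f = (\<rho> - 2) *\<^sub>R f + (neumann R f + cadj (neumann R) f)"

text \<open>The quadratic form of \<open>poisson\<close>. The factor 2 arises because an operator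
  and its adjoint have forms with the same real part.\<close>

definition poisson_form :: "real \<Rightarrow> ('a::chilbert_space \<Rightarrow> 'a) \<Rightarrow> 'a \<Rightarrow> real"
  where "poisson_form \<rho> R f = (\<rho> - 2) * (norm f)\<^sup>2 + 2 * inner (neumann R f) f"

section \<open>The Poisson kernel as a self-adjoint operator, and its form\<close>

lemma bounded_clinear_poisson:
  assumes "power_stable R"
  shows "bounded_clinear (poisson \<rho> R)"
  unfolding poisson_def
  by (intro bounded_clinear_add bounded_clinear_scaleR bounded_clinear_ident
      bounded_clinear_cadj bounded_clinear_neumann assms)

lemma poisson_self_adjoint:
  assumes "power_stable R"
  shows "cinner (poisson \<rho> R f) g = cinner f (poisson \<rho> R g)"
  unfolding poisson_def using bounded_clinear_neumann[OF assms]
  by (simp add: cinner_add_left cinner_add_right cinner_scaleR_left cinner_scaleR_right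
      cadj_eq cadj_eq')

lemma inner_poisson:
  assumes "power_stable R"
  shows "inner (poisson \<rho> R f) f = poisson_form \<rho> R f"
proof -
  have "inner (cadj (neumann R) f) f = inner (neumann R f) f"
    by (metis Re_cinner bounded_clinear_neumann[OF assms] cadj_eq inner_commute)
  then show ?thesis
    by (simp add: poisson_def poisson_form_def inner_add_left dot_square_norm)
qed

text \<open>Substituting \<open>g - R g\<close> removes the resolvent; the right-hand side is the
  form of the operator under the square root in \<open>Delta_op\<close>.\<close>

lemma poisson_form_resolvent:
  assumes "power_stable R"
  shows "poisson_form \<rho> R (g - R g) =
    \<rho> * (norm g)\<^sup>2 + 2 * (1 - \<rho>) * inner (R g) g + (\<rho> - 2) * (norm (R g))\<^sup>2"
  unfolding poisson_form_def neumann_left[OF assms] power2_norm_eq_inner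
  by (simp add: inner_diff_left inner_diff_right inner_commute algebra_simps)

text \<open>For \<open>f = g - R g\<close> the form is
  \<open>(norm g)\<^sup>2 - (norm (R g))\<^sup>2\<close>, at least
  \<open>(1 - t\<^sup>2) * (norm g)\<^sup>2\<close>, while \<open>norm f\<close> is at most
  \<open>(1 + t) * norm g\<close>. Dividing gives the constant
  \<open>(1 - t) / (1 + t)\<close>.\<close>

lemma poisson_form_contraction:
  assumes R: "bounded_clinear R" and t: "0 \<le> t" "t < 1" and le: "\<And>f. norm (R f) \<le> t * norm f"
  shows "(1 - t) / (1 + t) * (norm f)\<^sup>2 \<le> poisson_form 1 R f"
proof -
  have ps: "power_stable R" by (rule power_stable_contraction[OF assms])
  define g where "g = neumann R f"
  have f: "f = g - R g" by (simp add: g_def neumann_right[OF ps])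
  have "norm f \<le> norm g + norm (R g)" unfolding f by (rule norm_triangle_ineq4)
  also have "\<dots> \<le> (1 + t) * norm g" using le[of g] by (simp add: algebra_simps)
  finally have "(norm f)\<^sup>2 \<le> ((1 + t) * norm g)\<^sup>2" by (intro power_mono) auto
  then have "(1 - t) / (1 + t) * (norm f)\<^sup>2 \<le> (1 - t) / (1 + t) * ((1 + t) * norm g)\<^sup>2"
    using t by (intro mult_left_mono) auto
  also have "\<dots> = (norm g)\<^sup>2 - (t * norm g)\<^sup>2"
    using t by (simp add: field_simps power2_eq_square)
  also have "\<dots> \<le> (norm g)\<^sup>2 - (norm (R g))\<^sup>2"
    using le by (intro diff_left_mono power_mono) auto
  also have "\<dots> = poisson_form 1 R f"
    unfolding f poisson_form_resolvent[OF ps] by simp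
  finally show ?thesis .
qed

section \<open>Dilations and the operators of the distance formula\<close>

text \<open>The point of \<open>S\<close> with residual orthogonal to \<open>S\<close> is unique,
  and this makes its choice linear in \<open>x\<close>.\<close>

lemma projection_exists:
  fixes S :: "'a::chilbert_space set"
  assumes "closed S" "complex_vector.subspace S"
  obtains P where "bounded_clinear P" "\<And>x. P x \<in> S" "\<And>x. x \<in> S \<Longrightarrow> P x = x"
    "\<And>x. norm (P x) \<le> norm x"
proof -
  obtain P where P: "\<And>x. P x \<in> S" "\<And>x s. s \<in> S \<Longrightarrow> cinner (x - P x) s = 0"
    using orthogonal_projection_exists[OF assms] by metis
  note sub = complex_vector.subspace_add[OF assms(2)] complex_vector.subspace_scale[OF assms(2)]
    complex_vector.subspace_diff[OF assms(2)]
  have unique: "P x = p" if "p \<in> S" "\<And>s. s \<in> S \<Longrightarrow> cinner (x - p) s = 0" for x p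
  proof -
    let ?d = "P x - p"
    have "?d \<in> S" using P(1) that(1) by (rule sub)
    then have "cinner (x - p) ?d - cinner (x - P x) ?d = 0" using P(2) that(2) by simp
    then have "cinner ?d ?d = 0" by (simp add: cinner_diff_left)
    then show ?thesis by (simp add: cinner_self)
  qed
  have norm: "norm (P x) \<le> norm x" for x
  proof -
    have "cinner x (P x) = cinner (P x) (P x)"
      using P(2)[OF P(1), of x x] by (simp add: cinner_diff_left)
    then have "(norm (P x))\<^sup>2 = inner x (P x)"
      by (metis Re_cinner power2_norm_eq_inner)
    also have "\<dots> \<le> norm x * norm (P x)" by (rule norm_cauchy_schwarz)
    finally show ?thesis by (cases "P x = 0") (auto simp: power2_eq_square)
  qed
  have "bounded_clinear P"
  proof (rule bounded_clinearI[where K = 1])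
    show "P (x + y) = P x + P y" for x y
    proof (rule unique)
      show "cinner (x + y - (P x + P y)) s = 0" if "s \<in> S" for s
        using P(2)[OF that, of x] P(2)[OF that, of y] by (simp add: cinner_diff_left cinner_add_left)
    qed (intro sub P)
    show "P (c *\<^sub>C x) = c *\<^sub>C P x" for c x
    proof (rule unique)
      show "cinner (c *\<^sub>C x - c *\<^sub>C P x) s = 0" if "s \<in> S" for s
        using P(2)[OF that, of x] by (simp add: cinner_scaleC_left flip: scaleC_diff_right)
    qed (intro sub P)
  qed (use norm in simp)
  moreover have "P x = x" if "x \<in> S" for x using that by (intro unique) auto
  ultimately show ?thesis using that P(1) norm by blast
qed

lemma norm_sum_orthogonal:
  fixes v :: "'n::finite \<Rightarrow> 'a::chilbert_space"
  assumes "\<And>i j. i \<noteq> j \<Longrightarrow> cinner (v i) (v j) = 0"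
  shows "(norm (\<Sum>i\<in>UNIV. v i))\<^sup>2 = (\<Sum>i\<in>UNIV. (norm (v i))\<^sup>2)"
  by (rule norm_sum_Pythagorean)
    (auto simp: pairwise_def orthogonal_def assms simp flip: Re_cinner)

text \<open>A radius below 1 gives \<open>t < 1\<close> with \<open>X / t\<close> in the class. Its
  isometries are extended from \<open>G\<close> to the whole space, and the scalar \<open>t\<close>
  is absorbed into them, so that \<open>X\<close> itself is dilated by a row of norm at most
  \<open>t\<close>.\<close>

lemma rho_ball_dilation:
  fixes X :: "'n::finite \<Rightarrow> 'h::chilbert_space \<Rightarrow> 'h"
  assumes "X \<in> rho_ball \<rho>"
  obtains t and J :: "'h \<Rightarrow> ('n list \<times> 'h, complex) ell2" and V where "0 < t" "t < 1"
    "bounded_clinear J" "\<And>x. norm (J x) = norm x" "\<And>i. bounded_clinear (V i)"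
    "\<And>z. (norm (\<Sum>i\<in>UNIV. V i (z i)))\<^sup>2 \<le> t\<^sup>2 * (\<Sum>i\<in>UNIV. (norm (z i))\<^sup>2)"
    "\<And>\<alpha> g h. \<alpha> \<noteq> [] \<Longrightarrow>
      cinner g (word_op X \<alpha> h) = complex_of_real \<rho> * cinner (J g) (word_op V \<alpha> (J h))"
proof -
  have X: "\<And>i. bounded_clinear (X i)" using assms by (simp add: rho_ball_def)
  have "rho_radius \<rho> X < 1" using assms by (simp add: rho_ball_def)
  then obtain t where t: "0 < t" "t < 1" and "(\<lambda>i h. (1 / t) *\<^sub>R X i h) \<in> rho_class \<rho>"
    unfolding rho_radius_def Inf_less_iff by auto
  then obtain G :: "('n list \<times> 'h, complex) ell2 set" and J V where
    G: "closed G" "complex_vector.subspace G" and J: "isometry_between UNIV G J"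
    and V: "\<forall>i. isometry_between G G (V i)"
    and orth': "\<forall>i j. i \<noteq> j \<longrightarrow> (\<forall>x\<in>G. \<forall>y\<in>G. cinner (V i x) (V j y) = 0)"
    and dil': "\<forall>\<alpha>. \<alpha> \<noteq> [] \<longrightarrow> (\<forall>h.
      word_op (\<lambda>i h. (1 / t) *\<^sub>R X i h) \<alpha> h = \<rho> *\<^sub>R cadj J (word_op V \<alpha> (J h)))"
    unfolding rho_class_def mem_Collect_eq by (elim conjE exE) (rule that)
  have orth: "cinner (V i x) (V j y) = 0" if "i \<noteq> j" "x \<in> G" "y \<in> G" for i j x y
    using orth' that by simp
  have dil: "word_op (\<lambda>i h. (1 / t) *\<^sub>R X i h) \<alpha> h = \<rho> *\<^sub>R cadj J (word_op V \<alpha> (J h))"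
    if "\<alpha> \<noteq> []" for \<alpha> h
    using dil' that by simp
  obtain P where P: "bounded_clinear P" "\<And>x. P x \<in> G" "\<And>x. x \<in> G \<Longrightarrow> P x = x"
    "\<And>x. norm (P x) \<le> norm x"
    using projection_exists[OF G] by blast
  have JG: "J x \<in> G" for x using J by (auto simp: isometry_between_def)
  have linJ: "bounded_clinear J" by (rule isometry_between_bounded_clinear[OF J])
  note Pl = clinear_simps[OF P(1)]
  have VG: "V i x \<in> G" "norm (V i x) = norm x" "V i (c *\<^sub>C x) = c *\<^sub>C V i x"
    and V_add: "y \<in> G \<Longrightarrow> V i (x + y) = V i x + V i y" if "x \<in> G" for i c x y
    using V[rule_format, of i] that by (auto simp: isometry_between_def)
  \<comment> \<open>\<open>V i\<close> is only controlled on \<open>G\<close>; composing with the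
    projection makes it linear and contractive everywhere.\<close>
  define V' where "V' i x = V i (P x)" for i x
  define W where "W i x = t *\<^sub>R V' i x" for i x
  have V': "bounded_clinear (V' i)" for i
    by (rule bounded_clinearI[where K = 1]) (simp_all add: V'_def Pl VG V_add P(2,4))
  have W: "bounded_clinear (W i)" for i
    unfolding W_def by (intro bounded_clinear_scaleR V')
  show ?thesis
  proof (rule that[of t J W])
    show "norm (J x) = norm x" for x using J by (auto simp: isometry_between_def)
    show "(norm (\<Sum>i\<in>UNIV. W i (z i)))\<^sup>2 \<le> t\<^sup>2 * (\<Sum>i\<in>UNIV. (norm (z i))\<^sup>2)" for z
    proof -
      have "(norm (\<Sum>i\<in>UNIV. V' i (z i)))\<^sup>2 = (\<Sum>i\<in>UNIV. (norm (V' i (z i)))\<^sup>2)"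
        by (rule norm_sum_orthogonal) (simp add: V'_def orth P(2))
      also have "\<dots> \<le> (\<Sum>i\<in>UNIV. (norm (z i))\<^sup>2)"
        by (intro sum_mono power_mono) (simp_all add: V'_def VG P(2,4))
      finally show ?thesis
        unfolding W_def scaleR_sum_right[symmetric] by (simp add: power_mult_distrib mult_left_mono)
    qed
    fix \<alpha> :: "'n list" and g h assume "\<alpha> \<noteq> []"
    \<comment> \<open>Words applied to \<open>J h\<close> stay in \<open>G\<close>, where the
      projection is the identity.\<close>
    have *: "word_op V \<alpha> (J h) = word_op V' \<alpha> (J h) \<and> word_op V \<alpha> (J h) \<in> G" for \<alpha>
      by (induction \<alpha>) (auto simp: JG V'_def P(3) VG)
    have "word_op X \<alpha> h = t ^ length \<alpha> *\<^sub>R word_op (\<lambda>i h. (1 / t) *\<^sub>R X i h) \<alpha> h"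
      using t by (simp add: word_op_scaleR[OF X] power_divide)
    also have "\<dots> = \<rho> *\<^sub>R cadj J (word_op W \<alpha> (J h))"
      unfolding dil[OF \<open>\<alpha> \<noteq> []\<close>] W_def word_op_scaleR[OF V'] conjunct1[OF *]
      using bounded_clinear_cadj[OF linJ]
      by (simp add: linear_simps[OF clinear_simps(1)] mult.commute)
    finally show "cinner g (word_op X \<alpha> h) = complex_of_real \<rho> * cinner (J g) (word_op W \<alpha> (J h))"
      by (simp add: cinner_scaleR_right cadj_eq[OF linJ])
  qed (use t linJ W in auto)
qed

text \<open>For \<open>k > 0\<close> the dilation makes the \<open>k\<close>-th power of
  \<open>R\<close> equal to \<open>\<rho>\<close> times a compression of the \<open>k\<close>-th
  power of \<open>W\<close>, a strict contraction. Hence the powers decay, and the form of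
  \<open>R\<close> with parameter \<open>\<rho>\<close> is \<open>\<rho>\<close> times that of
  \<open>W\<close> with parameter 1.\<close>

lemma rho_ball_bounds:
  fixes X :: "'n::finite \<Rightarrow> 'h::chilbert_space \<Rightarrow> 'h"
  assumes "0 < \<rho>" and "X \<in> rho_ball \<rho>"
  shows "power_stable (reconstruction X)"
    and "\<exists>e>0. \<forall>f. e * (norm f)\<^sup>2 \<le> poisson_form \<rho> (reconstruction X) f"
proof -
  have X: "\<And>i. bounded_clinear (X i)" using assms by (simp add: rho_ball_def)
  obtain t and J :: "'h \<Rightarrow> ('n list \<times> 'h, complex) ell2" and V where t: "0 < t" "t < 1"
    and J: "bounded_clinear J" "\<And>x. norm (J x) = norm x" and V: "\<And>i. bounded_clinear (V i)"
    and row: "\<And>z. (norm (\<Sum>i\<in>UNIV. V i (z i)))\<^sup>2 \<le> t\<^sup>2 * (\<Sum>i\<in>UNIV. (norm (z i))\<^sup>2)"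
    and dil: "\<And>\<alpha> g h. \<alpha> \<noteq> [] \<Longrightarrow>
      cinner g (word_op X \<alpha> h) = complex_of_real \<rho> * cinner (J g) (word_op V \<alpha> (J h))"
    using rho_ball_dilation[OF assms(2)] by blast
  define R where "R = reconstruction X"
  define W where "W = reconstruction V"
  \<comment> \<open>\<open>A\<close> is the tensor product of \<open>J\<close> with the identity of
    the Fock space: \<open>J\<close> is applied in each coordinate.\<close>
  define A where "A f = Abs_ell2 (\<lambda>w. J (Rep_ell2 f w))" for f :: "('n list, 'h) ell2"
  have A: "Rep_ell2 (A f) w = J (Rep_ell2 f w)" for f w
    using ell2_summable[of f] by (simp add: A_def Abs_ell2_inverse J)
  have normA: "norm (A f) = norm f" for f
    by (rule power2_eq_imp_eq) (simp_all add: ell2_norm_sq A J)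
  have R: "bounded_clinear R" unfolding R_def by (rule bounded_clinear_reconstruction[OF X])
  have W: "bounded_clinear W" unfolding W_def by (rule bounded_clinear_reconstruction[OF V])
  have Wt: "norm (W f) \<le> t * norm f" for f
    unfolding W_def using t by (intro norm_reconstruction_le V column_bound row) auto
  have Wk: "norm ((W ^^ k) f) \<le> t ^ k * norm f" for k f
  proof (induction k)
    case (Suc k)
    show ?case using order_trans[OF Wt mult_left_mono[OF Suc]] t by (simp add: mult.assoc)
  qed simp
  \<comment> \<open>The exponent is a successor because the dilation identity is available for
    nonempty words only.\<close>
  have RW: "inner ((R ^^ Suc k) f) g = \<rho> * inner ((W ^^ Suc k) (A f)) (A g)" for k f g
  proof -
    have "cinner (Rep_ell2 ((R ^^ Suc k) f) w) (Rep_ell2 g w) =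
        \<rho> * cinner (Rep_ell2 ((W ^^ Suc k) (A f)) w) (Rep_ell2 (A g) w)" for w
      unfolding R_def W_def cinner_reconstruction_funpow[OF X] cinner_reconstruction_funpow[OF V] A
      by (auto intro!: dil)
    then have "cinner ((R ^^ Suc k) f) g = \<rho> * cinner ((W ^^ Suc k) (A f)) (A g)"
      unfolding cinner_ell2.rep_eq by (simp only: infsum_cmult_right')
    from arg_cong[OF this, of Re] show ?thesis by (simp add: Re_cinner)
  qed
  \<comment> \<open>The maximum with 1 covers \<open>k = 0\<close>, where no factor
    \<open>\<rho>\<close> occurs.\<close>
  have Rk: "norm ((R ^^ k) f) \<le> max 1 \<rho> * t ^ k * norm f" for k f
  proof (cases k)
    case 0
    then show ?thesis using mult_right_mono[of 1 "max 1 \<rho>" "norm f"] by simp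
  next
    case (Suc l)
    let ?g = "(R ^^ k) f"
    have "norm ?g * norm ?g = \<rho> * inner ((W ^^ k) (A f)) (A ?g)"
      using RW[of l f ?g] by (simp add: Suc flip: power2_norm_eq_inner power2_eq_square)
    also have "\<dots> \<le> \<rho> * (norm ((W ^^ k) (A f)) * norm (A ?g))"
      using assms(1) by (intro mult_left_mono norm_cauchy_schwarz) simp
    also have "\<dots> \<le> \<rho> * ((t ^ k * norm (A f)) * norm (A ?g))"
      using assms(1) by (intro mult_left_mono mult_right_mono Wk) auto
    finally have "norm ?g * norm ?g \<le> norm ?g * (\<rho> * t ^ k * norm f)"
      by (simp add: normA mult_ac)
    then have "norm ?g \<le> \<rho> * t ^ k * norm f"
      using assms(1) t by (cases "?g = 0") (auto simp: mult_le_cancel_left)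
    also have "\<dots> \<le> max 1 \<rho> * t ^ k * norm f" using t by (intro mult_right_mono) auto
    finally show ?thesis .
  qed
  show ps: "power_stable (reconstruction X)"
    using R Rk t unfolding R_def power_stable_def by (metis less_imp_le)
  have psW: "power_stable W" using W Wt t by (intro power_stable_contraction) auto
  have form: "poisson_form \<rho> R f = \<rho> * poisson_form 1 W (A f)" for f
  proof -
    \<comment> \<open>The term \<open>k = 0\<close> is split off, since only the remaining terms
      scale by \<open>\<rho>\<close>.\<close>
    have "(\<lambda>k. inner ((R ^^ Suc k) f) f) sums (inner (neumann R f) f - (norm f)\<^sup>2)"
      using inner_neumann_sums[OF ps[folded R_def], of f f]
      by (subst sums_Suc_iff) (simp add: power2_norm_eq_inner)
    moreover have "(\<lambda>k. inner ((W ^^ Suc k) (A f)) (A f)) sums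
        (inner (neumann W (A f)) (A f) - (norm f)\<^sup>2)"
      using inner_neumann_sums[OF psW, of "A f" "A f"]
      by (subst sums_Suc_iff) (simp add: normA flip: power2_norm_eq_inner)
    then have "(\<lambda>k. inner ((R ^^ Suc k) f) f) sums
        (\<rho> * (inner (neumann W (A f)) (A f) - (norm f)\<^sup>2))"
      unfolding RW by (rule sums_mult)
    ultimately have "inner (neumann R f) f - (norm f)\<^sup>2
        = \<rho> * (inner (neumann W (A f)) (A f) - (norm f)\<^sup>2)"
      by (rule sums_unique2)
    then show ?thesis by (simp add: poisson_form_def normA algebra_simps)
  qed
  have "\<rho> * ((1 - t) / (1 + t)) * (norm f)\<^sup>2 \<le> poisson_form \<rho> R f" for f
    using mult_left_mono[OF poisson_form_contraction[OF W _ _ Wt, of "A f"], of \<rho>] t assms(1)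
    by (simp add: form normA mult.assoc)
  moreover have "0 < \<rho> * ((1 - t) / (1 + t))" using t assms(1) by simp
  ultimately show "\<exists>e>0. \<forall>f. e * (norm f)\<^sup>2 \<le> poisson_form \<rho> (reconstruction X) f"
    unfolding R_def by blast
qed

section \<open>The operators \<open>C_op\<close> and their quotients\<close>

text \<open>The form of the operator \<open>D\<close> under the root at \<open>g\<close> is the
  Poisson form at \<open>g - R g\<close>. So \<open>D\<close> is bounded below, its root is
  invertible, and at \<open>g = neumann R f\<close> the resolvents cancel.\<close>

lemma C_op_properties:
  fixes X :: "'n::finite \<Rightarrow> 'h::chilbert_space \<Rightarrow> 'h"
  assumes ps: "power_stable (reconstruction X)"
    and "0 < e" and lower: "\<And>f. e * (norm f)\<^sup>2 \<le> poisson_form \<rho> (reconstruction X) f"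
  shows "bounded_clinear (C_op \<rho> X)" and "bij (C_op \<rho> X)"
    and "(norm (C_op \<rho> X f))\<^sup>2 = poisson_form \<rho> (reconstruction X) f"
proof -
  define R where "R = reconstruction X"
  have psR: "power_stable R" using ps by (simp add: R_def)
  have R: "bounded_clinear R" using psR by (simp add: power_stable_def)
  define D where "D f = \<rho> *\<^sub>R f + (1 - \<rho>) *\<^sub>R (cadj R f + R f) + (\<rho> - 2) *\<^sub>R cadj R (R f)" for f
  have D: "bounded_clinear D"
    unfolding D_def
    by (intro bounded_clinear_add bounded_clinear_scaleR bounded_clinear_ident bounded_clinear_cadj
        bounded_clinear_compose[OF bounded_clinear_cadj] R)
  have self: "cinner (D f) g = cinner f (D g)" for f g
    by (simp add: D_def cinner_add_left cinner_add_right cinner_scaleR_left cinner_scaleR_right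
        cadj_eq'[OF R] flip: cadj_eq[OF R])
  have form: "inner (D g) g = poisson_form \<rho> R (g - R g)" for g
  proof -
    have "inner (cadj R h) g = inner h (R g)" for h g
      by (metis Re_cinner cadj_eq'[OF R])
    then show ?thesis
      unfolding poisson_form_resolvent[OF psR]
      by (simp add: D_def inner_add_left inner_commute[of g "R g"] dot_square_norm algebra_simps)
  qed
  note N = bounded_clinear_neumann[OF psR]
  obtain K where K: "0 < K" "\<And>x. norm (neumann R x) \<le> norm x * K"
    using bounded_linear.pos_bounded[OF clinear_simps(1)[OF N]] by blast
  \<comment> \<open>\<open>K\<close> bounds the inverse of \<open>I - R\<close>, so
    \<open>norm g\<close> is at most \<open>K * norm (g - R g)\<close>.\<close>
  have "e / K\<^sup>2 * (norm g)\<^sup>2 \<le> inner (D g) g" for g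
  proof -
    have "(norm g)\<^sup>2 \<le> (norm (g - R g) * K)\<^sup>2"
      using K(2)[of "g - R g"] by (intro power_mono) (simp_all add: neumann_left[OF psR])
    then have "e / K\<^sup>2 * (norm g)\<^sup>2 \<le> e / K\<^sup>2 * (norm (g - R g) * K)\<^sup>2"
      using \<open>0 < e\<close> by (intro mult_left_mono) auto
    also have "\<dots> = e * (norm (g - R g))\<^sup>2" using K(1) by (simp add: power_mult_distrib)
    also have "\<dots> \<le> inner (D g) g" unfolding form R_def by (rule lower)
    finally show ?thesis .
  qed
  moreover have "0 < e / K\<^sup>2" using \<open>0 < e\<close> K(1) by simp
  ultimately obtain d where S: "bounded_clinear (op_sqrt D)"
    "\<And>x y. cinner (op_sqrt D x) y = cinner x (op_sqrt D y)" "\<And>x. op_sqrt D (op_sqrt D x) = D x"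
    "0 < d" "\<And>x. d * (norm x)\<^sup>2 \<le> inner (op_sqrt D x) x"
    using op_sqrt_lower_bound[OF D self, of "e / K\<^sup>2"] by blast
  have C: "C_op \<rho> X = (\<lambda>f. op_sqrt D (neumann R f))"
    by (simp add: C_op_def Delta_op_def Let_def o_def bij_neumann(2)[OF ps] R_def D_def[abs_def])
  show "bounded_clinear (C_op \<rho> X)"
    unfolding C by (rule bounded_clinear_compose[OF S(1) N])
  have "bij (op_sqrt D)"
    using clinear_simps(1)[OF S(1)] S(4,5) by (rule bij_lower_bound)
  then show "bij (C_op \<rho> X)"
    using bij_comp[OF bij_neumann(1)[OF psR]] unfolding C o_def by blast
  have "(norm (C_op \<rho> X f))\<^sup>2 = inner (D (neumann R f)) (neumann R f)"
    unfolding C power2_norm_eq_inner by (simp only: S(2,3) flip: Re_cinner)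
      (simp only: self)
  also have "\<dots> = poisson_form \<rho> (reconstruction X) f"
    unfolding form neumann_right[OF psR] by (simp add: R_def)
  finally show "(norm (C_op \<rho> X f))\<^sup>2 = poisson_form \<rho> (reconstruction X) f" .
qed

text \<open>Since \<open>C_op \<rho> Y\<close> is onto, the norm bound may be tested at its values,
  where squaring turns it into the comparison of Poisson forms. The second claim later forces the
  product of the two norms to be at least 1.\<close>

lemma C_op_quotient:
  fixes X Y :: "'n::finite \<Rightarrow> 'h::chilbert_space \<Rightarrow> 'h"
  assumes "0 < \<rho>" "X \<in> rho_ball \<rho>" "Y \<in> rho_ball \<rho>"
  shows "bounded_linear (C_op \<rho> X \<circ> inv (C_op \<rho> Y))"
    and "(C_op \<rho> X \<circ> inv (C_op \<rho> Y)) ((C_op \<rho> Y \<circ> inv (C_op \<rho> X)) f) = f"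
    and "0 \<le> c \<Longrightarrow> onorm (C_op \<rho> X \<circ> inv (C_op \<rho> Y)) \<le> c \<longleftrightarrow>
      (\<forall>f. poisson_form \<rho> (reconstruction X) f \<le> c\<^sup>2 * poisson_form \<rho> (reconstruction Y) f)"
proof -
  note psX = rho_ball_bounds(1)[OF assms(1,2)] and psY = rho_ball_bounds(1)[OF assms(1,3)]
  obtain d where d: "0 < d" "\<And>f. d * (norm f)\<^sup>2 \<le> poisson_form \<rho> (reconstruction X) f"
    using rho_ball_bounds(2)[OF assms(1,2)] by blast
  obtain e where e: "0 < e" "\<And>f. e * (norm f)\<^sup>2 \<le> poisson_form \<rho> (reconstruction Y) f"
    using rho_ball_bounds(2)[OF assms(1,3)] by blast
  note CX = C_op_properties[OF psX d] and CY = C_op_properties[OF psY e]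
  have "sqrt e * norm f \<le> norm (C_op \<rho> Y f)" for f
  proof (rule power2_le_imp_le)
    show "(sqrt e * norm f)\<^sup>2 \<le> (norm (C_op \<rho> Y f))\<^sup>2"
      using e by (simp add: CY(3) power_mult_distrib)
  qed simp
  then have I: "bounded_clinear (inv (C_op \<rho> Y))"
    using CY(1,2) e(1) by (intro inv_lower_bound(1)[of _ "sqrt e"]) auto
  show bl: "bounded_linear (C_op \<rho> X \<circ> inv (C_op \<rho> Y))"
    unfolding o_def by (rule bounded_linear_compose[OF clinear_simps(1)[OF CX(1)] clinear_simps(1)[OF I]])
  have IY: "inv (C_op \<rho> Y) (C_op \<rho> Y f) = f" for f
    using CY(2) by (simp add: bij_is_inj)
  have YI: "C_op \<rho> Y (inv (C_op \<rho> Y) f) = f" for f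
    using CY(2) by (simp add: bij_is_surj surj_f_inv_f)
  have XI: "C_op \<rho> X (inv (C_op \<rho> X) f) = f" for f
    using CX(2) by (simp add: bij_is_surj surj_f_inv_f)
  show "(C_op \<rho> X \<circ> inv (C_op \<rho> Y)) ((C_op \<rho> Y \<circ> inv (C_op \<rho> X)) f) = f"
    by (simp add: IY XI)
  assume c: "0 \<le> c"
  have "onorm (C_op \<rho> X \<circ> inv (C_op \<rho> Y)) \<le> c \<longleftrightarrow>
      (\<forall>g. norm (C_op \<rho> X (inv (C_op \<rho> Y) g)) \<le> c * norm g)"
  proof
    assume "onorm (C_op \<rho> X \<circ> inv (C_op \<rho> Y)) \<le> c"
    then show "\<forall>g. norm (C_op \<rho> X (inv (C_op \<rho> Y) g)) \<le> c * norm g"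
      using onorm[OF bl] by (metis (no_types, opaque_lifting) comp_apply mult_right_mono norm_ge_zero order_trans)
  next
    assume "\<forall>g. norm (C_op \<rho> X (inv (C_op \<rho> Y) g)) \<le> c * norm g"
    then show "onorm (C_op \<rho> X \<circ> inv (C_op \<rho> Y)) \<le> c"
      using c by (intro onorm_bound) auto
  qed
  also have "\<dots> \<longleftrightarrow> (\<forall>f. norm (C_op \<rho> X f) \<le> c * norm (C_op \<rho> Y f))"
    using IY YI by metis
  also have "\<dots> \<longleftrightarrow> (\<forall>f. (norm (C_op \<rho> X f))\<^sup>2 \<le> (c * norm (C_op \<rho> Y f))\<^sup>2)"
    using c by (simp add: power2_le_iff_abs_le)
  finally show "onorm (C_op \<rho> X \<circ> inv (C_op \<rho> Y)) \<le> c \<longleftrightarrow>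
      (\<forall>f. poisson_form \<rho> (reconstruction X) f \<le> c\<^sup>2 * poisson_form \<rho> (reconstruction Y) f)"
    by (simp add: CX(3) CY(3) power_mult_distrib)
qed

section \<open>Finite-dimensional compressions\<close>

definition orthonormal :: "nat \<Rightarrow> (nat \<Rightarrow> 'a::chilbert_space) \<Rightarrow> bool"
  where "orthonormal d e \<longleftrightarrow> (\<forall>i<d. \<forall>j<d. cinner (e i) (e j) = (if i = j then 1 else 0))"

lemma cinner_orthonormal_sum:
  assumes "orthonormal d e" "j < d"
  shows "cinner (\<Sum>k<d. a k *\<^sub>C e k) (e j) = a j"
proof -
  have "cinner (\<Sum>k<d. a k *\<^sub>C e k) (e j) = (\<Sum>k<d. if k = j then a k else 0)"
    unfolding cinner_sum_left
    by (rule sum.cong) (use assms in \<open>auto simp: orthonormal_def cinner_scaleC_left\<close>)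
  then show ?thesis using assms by simp
qed

lemma cinner_orthonormal_residual:
  assumes "orthonormal d e"
  shows "cinner (v - (\<Sum>k<d. cinner v (e k) *\<^sub>C e k)) (\<Sum>k<d. a k *\<^sub>C e k) = 0"
  unfolding cinner_sum_right cinner_scaleC_right
  by (rule sum.neutral) (simp add: cinner_diff_left cinner_orthonormal_sum[OF assms])

lemma norm_orthonormal_sum:
  assumes "orthonormal d e"
  shows "(norm (\<Sum>k<d. a k *\<^sub>C e k))\<^sup>2 = (\<Sum>k<d. (cmod (a k))\<^sup>2)"
proof -
  let ?s = "\<Sum>k<d. a k *\<^sub>C e k"
  have "cinner ?s ?s = (\<Sum>k<d. cnj (a k) * a k)"
    unfolding cinner_sum_right[of ?s] cinner_scaleC_right
    by (rule sum.cong) (simp_all add: cinner_orthonormal_sum[OF assms])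
  also have "\<dots> = complex_of_real (\<Sum>k<d. (cmod (a k))\<^sup>2)"
    by (simp add: complex_norm_square[symmetric] mult.commute[of "cnj _"] del: of_real_power)
  finally show ?thesis
    unfolding cinner_self of_real_eq_iff .
qed

text \<open>The left-hand side is the squared norm of the projection of \<open>v\<close> onto the
  span of the system.\<close>

lemma bessel:
  assumes "orthonormal d e"
  shows "(\<Sum>k<d. (cmod (cinner v (e k)))\<^sup>2) \<le> (norm v)\<^sup>2"
proof -
  define q where "q = (\<Sum>k<d. cinner v (e k) *\<^sub>C e k)"
  have "cinner (v - q) q = 0"
    unfolding q_def by (rule cinner_orthonormal_residual[OF assms])
  then have "inner v q = (norm q)\<^sup>2"
    by (metis Re_cinner cinner_diff_left eq_iff_diff_eq_0 power2_norm_eq_inner)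
  then have "norm q * norm q \<le> norm q * norm v"
    using norm_cauchy_schwarz[of v q] by (simp add: power2_eq_square mult.commute)
  then have "norm q \<le> norm v" by (cases "q = 0") (auto simp: mult_le_cancel_left)
  then have "(norm q)\<^sup>2 \<le> (norm v)\<^sup>2" by (intro power_mono) auto
  then show ?thesis unfolding q_def norm_orthonormal_sum[OF assms] .
qed

text \<open>One Gram-Schmidt step. The last claim says that vectors already expanded stay expanded,
  which the induction over a finite set needs.\<close>

lemma orthonormal_extend:
  assumes e: "orthonormal d e" and w: "w = v - (\<Sum>k<d. cinner v (e k) *\<^sub>C e k)" "w \<noteq> 0"
  shows "orthonormal (Suc d) (e(d := sgn w))"
    and "v = (\<Sum>k<Suc d. cinner v ((e(d := sgn w)) k) *\<^sub>C (e(d := sgn w)) k)"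
    and "u = (\<Sum>k<d. cinner u (e k) *\<^sub>C e k) \<Longrightarrow>
      u = (\<Sum>k<Suc d. cinner u ((e(d := sgn w)) k) *\<^sub>C (e(d := sgn w)) k)"
proof -
  have sgn: "sgn w = complex_of_real (inverse (norm w)) *\<^sub>C w"
    by (simp only: sgn_div_norm scaleC_of_real)
  have orth: "cinner w (\<Sum>k<d. a k *\<^sub>C e k) = 0" for a
    unfolding w(1) by (rule cinner_orthonormal_residual[OF e])
  have orth': "cinner (\<Sum>k<d. a k *\<^sub>C e k) w = 0" for a
    by (subst cinner_commute) (simp add: orth)
  have we: "cinner w (e k) = 0" if "k < d" for k
    unfolding w(1) using cinner_orthonormal_sum[OF e that] by (simp add: cinner_diff_left)
  then have ew: "cinner (e k) w = 0" if "k < d" for k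
    using that by (subst cinner_commute) simp
  have "cinner (sgn w) (sgn w) = 1" using w(2) by (simp add: cinner_self norm_sgn)
  then show "orthonormal (Suc d) (e(d := sgn w))"
    using e we ew unfolding orthonormal_def less_Suc_eq
    by (auto simp: sgn cinner_scaleC_left cinner_scaleC_right)
  have vw: "cinner v w = complex_of_real ((norm w)\<^sup>2)"
    using arg_cong[OF w(1), of "\<lambda>x. cinner x w"] by (simp add: cinner_diff_left orth' cinner_self)
  have "cinner v (sgn w) *\<^sub>C sgn w = w"
    using w(2) by (simp add: sgn cinner_scaleC_right vw scaleC_scaleC power2_eq_square field_simps)
  then show "v = (\<Sum>k<Suc d. cinner v ((e(d := sgn w)) k) *\<^sub>C (e(d := sgn w)) k)"
    by (simp add: w(1) del: cinner_zero_right)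
  assume u: "u = (\<Sum>k<d. cinner u (e k) *\<^sub>C e k)"
  have "cinner u (sgn w) = 0"
    unfolding sgn cinner_scaleC_right by (subst u) (simp add: orth')
  then show "u = (\<Sum>k<Suc d. cinner u ((e(d := sgn w)) k) *\<^sub>C (e(d := sgn w)) k)"
    using u by simp
qed

lemma orthonormal_basis_exists:
  fixes F :: "'a::chilbert_space set"
  assumes "finite F"
  shows "\<exists>d e. orthonormal d e \<and> (\<forall>v\<in>F. v = (\<Sum>k<d. cinner v (e k) *\<^sub>C e k))"
  using assms
proof (induction F)
  case empty
  show ?case by (intro exI[of _ 0]) (simp add: orthonormal_def)
next
  case (insert v F)
  then obtain d e where e: "orthonormal d e" "\<forall>v\<in>F. v = (\<Sum>k<d. cinner v (e k) *\<^sub>C e k)"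
    by blast
  show ?case
  proof (cases "v - (\<Sum>k<d. cinner v (e k) *\<^sub>C e k) = 0")
    case True
    then show ?thesis using e by (metis eq_iff_diff_eq_0 insertE)
  next
    case False
    note ext = orthonormal_extend[OF e(1) refl False]
    show ?thesis
      using ext(1,2) ext(3)[OF e(2)[rule_format]] by blast
  qed
qed

text \<open>A finite system never spans the space, so a vector outside its span has a nonzero
  residual to normalise.\<close>

lemma infinite_dimensional_orthonormal:
  assumes "infinite_dimensional TYPE('k::chilbert_space)"
  shows "\<exists>u :: nat \<Rightarrow> 'k. orthonormal d u"
proof (induction d)
  case 0
  show ?case by (simp add: orthonormal_def)
next
  case (Suc d)
  then obtain u :: "nat \<Rightarrow> 'k" where u: "orthonormal d u" by blast
  have "complex_vector.span (u ` {..<d}) \<noteq> UNIV"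
    using assms unfolding infinite_dimensional_def by blast
  then obtain v where v: "v \<notin> complex_vector.span (u ` {..<d})" by blast
  have "(\<Sum>k<d. cinner v (u k) *\<^sub>C u k) \<in> complex_vector.span (u ` {..<d})"
    by (intro complex_vector.span_sum complex_vector.span_scale complex_vector.span_base) auto
  then have "v - (\<Sum>k<d. cinner v (u k) *\<^sub>C u k) \<noteq> 0" using v by auto
  from orthonormal_extend(1)[OF u refl this] show ?case by blast
qed

text \<open>\<open>Q\<close> is the partial isometry carrying \<open>u k\<close> to
  \<open>e k\<close>; its adjoint exchanges the two systems.\<close>

lemma bounded_clinear_orthonormal_map:
  assumes e: "orthonormal d e" and u: "orthonormal d u"
  defines "Q \<equiv> \<lambda>z. \<Sum>k<d. cinner z (u k) *\<^sub>C e k"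
  shows "bounded_clinear Q" and "norm (Q z) \<le> norm z"
    and "cadj Q = (\<lambda>y. \<Sum>k<d. cinner y (e k) *\<^sub>C u k)"
proof -
  have norm: "norm (Q z) \<le> norm z" for z
  proof (rule power2_le_imp_le)
    show "(norm (Q z))\<^sup>2 \<le> (norm z)\<^sup>2"
      unfolding Q_def norm_orthonormal_sum[OF e] by (rule bessel[OF u])
  qed simp
  then show "norm (Q z) \<le> norm z" .
  show "bounded_clinear Q"
    by (rule bounded_clinearI[where K = 1])
      (use norm in \<open>simp_all add: Q_def cinner_add_left cinner_scaleC_left scaleC_add_left
        sum.distrib complex_vector.scale_sum_right scaleC_scaleC\<close>)
  show "cadj Q = (\<lambda>y. \<Sum>k<d. cinner y (e k) *\<^sub>C u k)"
  proof (rule cadj_unique)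
    fix x y
    have "cinner (Q x) y = (\<Sum>k<d. cinner x (u k) * cinner (e k) y)"
      by (simp add: Q_def cinner_sum_left cinner_scaleC_left)
    also have "\<dots> = (\<Sum>k<d. cnj (cinner y (e k)) * cinner x (u k))"
      by (simp add: mult.commute flip: cinner_commute)
    also have "\<dots> = cinner x (\<Sum>k<d. cinner y (e k) *\<^sub>C u k)"
      by (simp add: cinner_sum_right cinner_scaleC_right)
    finally show "cinner (Q x) y = cinner x (\<Sum>k<d. cinner y (e k) *\<^sub>C u k)" .
  qed
qed

text \<open>Lets vectors of an arbitrary Hilbert space be moved to the test space \<open>'k\<close>
  and back without loss, finitely many at a time.\<close>

lemma finite_set_coisometry:
  fixes F :: "'a::chilbert_space set"
  assumes "infinite_dimensional TYPE('k::chilbert_space)" and "finite F"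
  obtains Q :: "'k::chilbert_space \<Rightarrow> 'a" where "bounded_clinear Q" "\<And>z. norm (Q z) \<le> norm z"
    "\<And>y. norm (cadj Q y) \<le> norm y" "\<And>y. y \<in> F \<Longrightarrow> Q (cadj Q y) = y"
proof -
  obtain d and e :: "nat \<Rightarrow> 'a" where e: "orthonormal d e"
    and F: "\<And>v. v \<in> F \<Longrightarrow> v = (\<Sum>k<d. cinner v (e k) *\<^sub>C e k)"
    using orthonormal_basis_exists[OF assms(2)] by blast
  obtain u :: "nat \<Rightarrow> 'k" where u: "orthonormal d u"
    using infinite_dimensional_orthonormal[OF assms(1)] by blast
  define Q where "Q z = (\<Sum>k<d. cinner z (u k) *\<^sub>C e k)" for z
  note Q = bounded_clinear_orthonormal_map[OF e u, folded Q_def]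
  have "norm (cadj Q y) \<le> norm y" for y
    unfolding Q(3) by (rule bounded_clinear_orthonormal_map(2)[OF u e])
  moreover have "Q (cadj Q y) = y" if "y \<in> F" for y
  proof -
    have "Q (cadj Q y) = (\<Sum>k<d. cinner y (e k) *\<^sub>C e k)"
      by (simp add: Q(3) Q_def cinner_orthonormal_sum[OF u])
    then show ?thesis using F[OF that] by simp
  qed
  ultimately show ?thesis using that[of Q] Q(1,2) by blast
qed

section \<open>From domination to the order of Poisson kernels\<close>

text \<open>This is also the form of \<open>Re_poly\<close>, by \<open>cinner_Re_poly\<close>, but
  written without adjoints.\<close>

definition poly_form :: "nat \<Rightarrow> 'n ncpoly \<Rightarrow> ('n \<Rightarrow> 'a::chilbert_space \<Rightarrow> 'a) \<Rightarrow> (nat \<Rightarrow> 'a) \<Rightarrow> real"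
  where "poly_form m p A x = Re (\<Sum>i<m. \<Sum>j<m. cinner (poly_eval p A i j (x j)) (x i))"

lemma poly_form_eq:
  "poly_form m p A x =
    Re (\<Sum>i<m. \<Sum>j<m. \<Sum>\<alpha> | p \<alpha> i j \<noteq> 0. p \<alpha> i j * cinner (word_op A \<alpha> (x j)) (x i))"
  by (simp add: poly_form_def poly_eval_def cinner_sum_left cinner_scaleC_left)

lemma bounded_clinear_scaleC:
  assumes "bounded_clinear f"
  shows "bounded_clinear (\<lambda>x. c *\<^sub>C f x)"
  using assms bounded_linear_compose[OF bounded_linear_scaleC[of c], of f]
  by (auto simp: bounded_clinear_def scaleC_scaleC mult.commute)

lemma bounded_clinear_poly_eval:
  assumes "\<And>i. bounded_clinear (A i)"
  shows "bounded_clinear (poly_eval p A i j)"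
  unfolding poly_eval_def
  by (intro bounded_clinear_sum bounded_clinear_scaleC bounded_clinear_word_op assms)

text \<open>Exchanging the two block indices turns the sum over the adjoint entries into the complex
  conjugate of the sum \<open>T\<close> over the entries; the mean of both is
  \<open>Re T\<close>.\<close>

lemma cinner_Re_poly:
  assumes A: "\<And>i. bounded_clinear (A i)"
  shows "(\<Sum>i<m. \<Sum>j<m. cinner (Re_poly p A i j (x j)) (x i)) = complex_of_real (poly_form m p A x)"
proof -
  define P where "P = poly_eval p A"
  have P: "bounded_clinear (P i j)" for i j
    unfolding P_def by (rule bounded_clinear_poly_eval[OF A])
  define T where "T = (\<Sum>i<m. \<Sum>j<m. cinner (P i j (x j)) (x i))"
  have "(\<Sum>i<m. \<Sum>j<m. cinner (cadj (P j i) (x j)) (x i))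
      = (\<Sum>i<m. \<Sum>j<m. cnj (cinner (P j i (x i)) (x j)))"
    by (simp add: cadj_eq'[OF P] flip: cinner_commute)
  also have "\<dots> = cnj T"
    unfolding T_def by (subst sum.swap) simp
  finally have adj: "(\<Sum>i<m. \<Sum>j<m. cinner (cadj (P j i) (x j)) (x i)) = cnj T" .
  have "cinner (Re_poly p A i j (x j)) (x i) =
      (1 / 2) * (cinner (cadj (P j i) (x j)) (x i) + cinner (P i j (x j)) (x i))" for i j
    by (simp add: Re_poly_def block_adj_def cinner_scaleR_left cinner_add_left P_def)
  then have "(\<Sum>i<m. \<Sum>j<m. cinner (Re_poly p A i j (x j)) (x i)) = (1 / 2) * (cnj T + T)"
    by (simp only: sum_distrib_left[symmetric] sum.distrib adj T_def[symmetric])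
  also have "\<dots> = complex_of_real (Re T)"
    by (rule complex_eqI) simp_all
  finally show ?thesis by (simp add: poly_form_def T_def P_def)
qed

lemma block_nonneg_Re_poly:
  assumes A: "\<And>i. bounded_clinear (A i)"
  shows "block_nonneg m (Re_poly p A) \<longleftrightarrow> (\<forall>x. 0 \<le> poly_form m p A x)"
  unfolding block_nonneg_def Let_def cinner_Re_poly[OF A] by simp

definition rho_form ::
    "real \<Rightarrow> nat \<Rightarrow> 'n ncpoly \<Rightarrow> ('n \<Rightarrow> 'a::chilbert_space \<Rightarrow> 'a) \<Rightarrow> (nat \<Rightarrow> 'a) \<Rightarrow> real"
  where "rho_form \<rho> m p A x = poly_form m p A x + (\<rho> - 1) * poly_form m p (\<lambda>_ _. 0) x"

lemma block_le_Re_poly_rho: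
  fixes A B :: "'n \<Rightarrow> 'a::chilbert_space \<Rightarrow> 'a"
  assumes A: "\<And>i. bounded_clinear (A i)" and B: "\<And>i. bounded_clinear (B i)"
  shows "block_le m (Re_poly_rho \<rho> p A) (\<lambda>i j x. c\<^sup>2 *\<^sub>R Re_poly_rho \<rho> p B i j x) \<longleftrightarrow>
    (\<forall>x. rho_form \<rho> m p A x \<le> c\<^sup>2 * rho_form \<rho> m p B x)"
proof -
  have Z: "\<And>i. bounded_clinear ((\<lambda>(_ :: 'n) (_ :: 'a). 0 :: 'a) i)" by (rule bounded_clinear_zero)
  have *: "(\<Sum>i<m. \<Sum>j<m. cinner (Re_poly_rho \<rho> p T i j (x j)) (x i)) = complex_of_real (rho_form \<rho> m p T x)"
    if "\<And>i. bounded_clinear (T i)" for T :: "'n \<Rightarrow> 'a \<Rightarrow> 'a" and x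
    using cinner_Re_poly[OF that, where p = p and x = x and m = m]
      cinner_Re_poly[OF Z, where p = p and x = x and m = m]
    by (simp add: Re_poly_rho_def rho_form_def cinner_add_left cinner_scaleR_left sum.distrib
        flip: sum_distrib_left)
  have "(\<Sum>i<m. \<Sum>j<m. cinner (c\<^sup>2 *\<^sub>R Re_poly_rho \<rho> p B i j (x j) - Re_poly_rho \<rho> p A i j (x j)) (x i))
      = complex_of_real (c\<^sup>2 * rho_form \<rho> m p B x - rho_form \<rho> m p A x)" for x
    by (simp add: cinner_diff_left cinner_scaleR_left sum_subtractf *[OF A] *[OF B]
        flip: sum_distrib_left)
  then show ?thesis unfolding block_le_def block_nonneg_def Let_def by simp
qed

text \<open>Replaces operator inequalities between block matrices by inequalities between real
  numbers; both directions start from this version.\<close>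

lemma harnack_dom_iff:
  fixes A B :: "'n::finite \<Rightarrow> 'h::chilbert_space \<Rightarrow> 'h"
  assumes A: "\<And>i. bounded_clinear (A i)" and B: "\<And>i. bounded_clinear (B i)"
  shows "harnack_dom TYPE('k::chilbert_space) \<rho> c A B \<longleftrightarrow>
    (\<forall>m p. is_ncpoly m p \<and>
      (\<forall>X \<in> (strict_row_contractions :: ('n \<Rightarrow> 'k \<Rightarrow> 'k) set). \<forall>x. 0 \<le> poly_form m p X x) \<longrightarrow>
      (\<forall>x. rho_form \<rho> m p A x \<le> c\<^sup>2 * rho_form \<rho> m p B x))"
proof -
  have "block_nonneg m (Re_poly p X) \<longleftrightarrow> (\<forall>x. 0 \<le> poly_form m p X x)"
    if "X \<in> strict_row_contractions" for m p and X :: "'n \<Rightarrow> 'k \<Rightarrow> 'k"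
    using that by (intro block_nonneg_Re_poly) (auto simp: strict_row_contractions_def)
  then show ?thesis
    unfolding harnack_dom_def block_le_Re_poly_rho[OF A B] by simp
qed

section \<open>Entries of the Neumann series and the polynomial that realises them\<close>

lemma cinner_unit_vec: "cinner f (unit_vec w h) = cinner (Rep_ell2 f w) h"
proof -
  have "cinner f (unit_vec w h) = (\<Sum>\<^sub>\<infinity>v\<in>{w}. cinner (Rep_ell2 f v) h)"
    unfolding cinner_ell2.rep_eq by (rule infsum_cong_neutral) (auto simp: unit_vec.rep_eq)
  then show ?thesis by simp
qed

text \<open>Comparing word lengths, only the power \<open>k = length w - length v\<close> can
  contribute, and only if \<open>w\<close> extends \<open>v\<close>.\<close>

lemma neumann_unit_vec:
  assumes A: "\<And>i. bounded_clinear (A i)" and ps: "power_stable (reconstruction A)"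
  shows "cinner (neumann (reconstruction A) (unit_vec v g)) (unit_vec w h) =
    (if take (length v) w = v then cinner g (word_op A (drop (length v) w) h) else 0)"
proof -
  define f where "f k = cinner ((reconstruction A ^^ k) (unit_vec v g)) (unit_vec w h)" for k
  have f: "f k = (if k \<le> length w \<and> take (length w - k) w = v
      then cinner g (word_op A (drop (length w - k) w) h) else 0)" for k
    by (simp add: f_def cinner_unit_vec cinner_reconstruction_funpow[OF A] unit_vec.rep_eq)
  have nz: "k = length w - length v \<and> length v \<le> length w"
    if "k \<le> length w \<and> take (length w - k) w = v" for k
    using that by auto
  have sums: "f sums cinner (neumann (reconstruction A) (unit_vec v g)) (unit_vec w h)"
    unfolding f_def by (rule cinner_neumann_sums[OF ps])
  have "f k = 0" if "k \<noteq> length w - length v" for k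
    using nz[of k] that by (auto simp: f)
  then have "f sums f (length w - length v)"
    using sums_finite[of "{length w - length v}" f] by simp
  from sums_unique2[OF sums this] show ?thesis
    by (cases "length v \<le> length w") (auto simp: f)
qed

lemma norm_unit_vec_sum:
  fixes m :: nat
  assumes "inj_on b {..<m}"
  shows "(norm (\<Sum>j<m. unit_vec (b j) (x j)))\<^sup>2 = (\<Sum>j<m. (norm (x j))\<^sup>2)"
proof -
  have "cinner (unit_vec (b i) (x i)) (unit_vec (b j) (x j)) =
      (if i = j then complex_of_real ((norm (x j))\<^sup>2) else 0)" if "i < m" "j < m" for i j
    using assms that unfolding inj_on_def
    by (auto simp: cinner_unit_vec unit_vec.rep_eq cinner_self)
  then have "(\<Sum>i<m. \<Sum>j<m. cinner (unit_vec (b i) (x i)) (unit_vec (b j) (x j))) =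
      (\<Sum>i<m. \<Sum>j<m. if i = j then complex_of_real ((norm (x j))\<^sup>2) else 0)"
    by (intro sum.cong) auto
  also have "\<dots> = complex_of_real (\<Sum>j<m. (norm (x j))\<^sup>2)"
    unfolding of_real_sum by (intro sum.cong refl) (subst sum.delta', auto)
  finally have "cinner (\<Sum>j<m. unit_vec (b j) (x j)) (\<Sum>j<m. unit_vec (b j) (x j)) =
      complex_of_real (\<Sum>j<m. (norm (x j))\<^sup>2)"
    by (simp only: cinner_sum_left) (simp only: cinner_sum_right)
  then show ?thesis unfolding cinner_self of_real_eq_iff .
qed

text \<open>
  The coefficient \<open>2\<close> compensates the factor \<open>1/2\<close> in the real part: only the words \<open>b j\<close>
  extending \<open>b i\<close> are used, and the adjoint supplies the opposite entries.
\<close>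

definition kernel_poly :: "(nat \<Rightarrow> 'n list) \<Rightarrow> 'n ncpoly"
  where "kernel_poly b \<alpha> i j = (if b j = b i @ \<alpha> then if \<alpha> = [] then 1 else 2 else 0)"

text \<open>Two words determine at most one \<open>\<alpha>\<close> with
  \<open>b j = b i @ \<alpha>\<close>, so each entry of the polynomial is at most one
  monomial.\<close>

lemma kernel_poly_support:
  "{\<alpha>. kernel_poly b \<alpha> i j \<noteq> 0} =
    (if take (length (b i)) (b j) = b i then {drop (length (b i)) (b j)} else {})"
proof -
  have "b j = b i @ \<alpha> \<longleftrightarrow> take (length (b i)) (b j) = b i \<and> \<alpha> = drop (length (b i)) (b j)" for \<alpha>
    by (metis append_eq_conv_conj)
  then show ?thesis by (auto simp: kernel_poly_def)
qed

lemma is_ncpoly_kernel_poly: "is_ncpoly m (kernel_poly b)"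
proof -
  have "{\<alpha>. \<exists>i<m. \<exists>j<m. kernel_poly b \<alpha> i j \<noteq> 0}
      = (\<Union>i<m. \<Union>j<m. {\<alpha>. kernel_poly b \<alpha> i j \<noteq> 0})" by auto
  also have "finite \<dots>" by (intro finite_UN_I) (auto simp: kernel_poly_support)
  finally show ?thesis by (simp add: is_ncpoly_def)
qed

text \<open>With \<open>Q\<close> the Neumann entries and \<open>s\<close> the squared norm of the
  vector, the polynomial contributes \<open>2 * Re Q - s\<close> in total, and at the zero tuple
  \<open>s\<close>. Together this is \<open>(\<rho> - 2) * s + 2 * Re Q\<close>, the Poisson
  form.\<close>

lemma rho_form_kernel_poly:
  assumes A: "\<And>i. bounded_clinear (A i)" and ps: "power_stable (reconstruction A)"
    and b: "inj_on b {..<m}"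
  shows "rho_form \<rho> m (kernel_poly b) A x =
    poisson_form \<rho> (reconstruction A) (\<Sum>j<m. unit_vec (b j) (x j))"
proof -
  define Q where "Q A i j = (if take (length (b i)) (b j) = b i
    then cinner (word_op A (drop (length (b i)) (b j)) (x j)) (x i) else 0)"
    for A :: "'a \<Rightarrow> 'b \<Rightarrow> 'b" and i j
  define s where "s = (\<Sum>j<m. (norm (x j))\<^sup>2)"
  \<comment> \<open>The coefficient is 1 rather than 2 at the empty word, which by injectivity of
    \<open>b\<close> means on the diagonal; the subtracted term corrects this.\<close>
  have entry: "cinner (poly_eval (kernel_poly b) T i j (x j)) (x i) =
      2 * Q T i j - (if i = j then cinner (x i) (x i) else 0)" if "i < m" "j < m" for T i j
  proof (cases "i = j")
    case True
    then show ?thesis by (simp add: poly_eval_def kernel_poly_support Q_def) (simp add: kernel_poly_def)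
  next
    case False
    then have "b i \<noteq> b j" using b that by (auto simp: inj_on_def)
    then have "kernel_poly b (drop (length (b i)) (b j)) i j = 2"
      if "take (length (b i)) (b j) = b i"
      using that by (auto simp: kernel_poly_def) (metis append_take_drop_id)+
    then show ?thesis
      using False by (simp add: poly_eval_def kernel_poly_support Q_def cinner_scaleC_left)
  qed
  have form: "poly_form m (kernel_poly b) T x = 2 * Re (\<Sum>i<m. \<Sum>j<m. Q T i j) - s" for T
    unfolding poly_form_def
    by (simp add: entry sum_subtractf Re_cinner s_def power2_norm_eq_inner sum_distrib_left)
  have "Q (\<lambda>_ _. 0) i j = (if i = j then cinner (x i) (x i) else 0)" if "i < m" "j < m" for i j
  proof (cases "i = j")
    case False
    then have "b i \<noteq> b j" using b that by (auto simp: inj_on_def)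
    then have "drop (length (b i)) (b j) \<noteq> []" if "take (length (b i)) (b j) = b i"
      using that by (metis append_Nil2 append_take_drop_id)
    then show ?thesis using False by (cases "drop (length (b i)) (b j)") (auto simp: Q_def)
  qed (simp add: Q_def)
  then have "(\<Sum>i<m. \<Sum>j<m. Q (\<lambda>_ _. 0) i j) = (\<Sum>i<m. cinner (x i) (x i))" by simp
  then have "Re (\<Sum>i<m. \<Sum>j<m. Q (\<lambda>_ _. 0) i j) = s"
    by (simp add: Re_cinner s_def power2_norm_eq_inner)
  moreover have "inner (neumann (reconstruction A) (\<Sum>j<m. unit_vec (b j) (x j)))
      (\<Sum>j<m. unit_vec (b j) (x j)) = Re (\<Sum>i<m. \<Sum>j<m. Q A i j)"
  proof -
    \<comment> \<open>The Neumann entries pair the vectors in the opposite order, hence the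
      conjugate; real parts agree.\<close>
    have "cinner (neumann (reconstruction A) (\<Sum>j<m. unit_vec (b j) (x j)))
      (\<Sum>j<m. unit_vec (b j) (x j)) = (\<Sum>i<m. \<Sum>j<m. cnj (Q A i j))"
      unfolding clinear_simps(6)[OF bounded_clinear_neumann[OF ps]] cinner_sum_left
      unfolding cinner_sum_right
      by (intro sum.cong refl)
        (simp add: neumann_unit_vec[OF A ps] Q_def flip: cinner_commute)
    then show ?thesis by (simp flip: Re_cinner)
  qed
  ultimately show ?thesis
    unfolding rho_form_def form poisson_form_def norm_unit_vec_sum[OF b] s_def
    by (simp add: algebra_simps)
qed

text \<open>The squared column norm at \<open>y\<close> is \<open>inner (G y) y\<close>, so the root
  of \<open>onorm G\<close> bounds the column and thereby the reconstruction operator.\<close>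

lemma strict_row_contraction_reconstruction:
  assumes "X \<in> strict_row_contractions"
  shows "\<exists>t. 0 \<le> t \<and> t < 1 \<and> (\<forall>f. norm (reconstruction X f) \<le> t * norm f)"
proof -
  have X: "\<And>i. bounded_clinear (X i)" using assms by (simp add: strict_row_contractions_def)
  define G where "G x = (\<Sum>i\<in>UNIV. X i (cadj (X i) x))" for x
  have "bounded_clinear G"
    unfolding G_def by (intro bounded_clinear_sum bounded_clinear_compose[OF X] bounded_clinear_cadj X)
  then have G: "bounded_linear G" by (rule clinear_simps)
  have "onorm G < 1" using assms by (simp add: strict_row_contractions_def G_def[abs_def])
  define t where "t = sqrt (onorm G)"
  have t: "0 \<le> t" "t < 1" "t\<^sup>2 = onorm G"
    using \<open>onorm G < 1\<close> onorm_pos_le[OF G] by (auto simp: t_def)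
  have col: "(\<Sum>i\<in>UNIV. (norm (cadj (X i) y))\<^sup>2) \<le> t\<^sup>2 * (norm y)\<^sup>2" for y
  proof -
    have "(\<Sum>i\<in>UNIV. (norm (cadj (X i) y))\<^sup>2) = inner (G y) y"
      unfolding G_def inner_sum_left
      by (rule sum.cong) (simp_all add: power2_norm_eq_inner cadj_eq[OF X] flip: Re_cinner)
    also have "\<dots> \<le> norm (G y) * norm y" by (rule norm_cauchy_schwarz)
    also have "\<dots> \<le> (onorm G * norm y) * norm y" by (intro mult_right_mono onorm[OF G]) simp
    finally show ?thesis unfolding t(3) by (simp add: power2_eq_square mult.assoc)
  qed
  show ?thesis
    using t(1,2) norm_reconstruction_le[OF X t(1) col] by blast
qed

text \<open>Domination is applied to \<open>kernel_poly b\<close> with \<open>b\<close> enumerating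
  a finite set of words. This gives the inequality on finitely supported vectors, which are dense,
  and the forms are continuous.\<close>

lemma harnack_dom_imp_poisson:
  fixes A B :: "'n::finite \<Rightarrow> 'h::chilbert_space \<Rightarrow> 'h"
  assumes A: "\<And>i. bounded_clinear (A i)" "power_stable (reconstruction A)"
    and B: "\<And>i. bounded_clinear (B i)" "power_stable (reconstruction B)"
    and dom: "harnack_dom TYPE('k::chilbert_space) \<rho> c A B"
  shows "poisson_form \<rho> (reconstruction A) f \<le> c\<^sup>2 * poisson_form \<rho> (reconstruction B) f"
proof -
  have pos: "0 \<le> poly_form m (kernel_poly b) X x"
    if strict: "X \<in> strict_row_contractions" and inj: "inj_on b {..<m}" for m b x and X :: "'n \<Rightarrow> 'k \<Rightarrow> 'k"
  proof -
    have X: "\<And>i. bounded_clinear (X i)" using strict by (simp add: strict_row_contractions_def)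
    obtain t where t: "0 \<le> t" "t < 1" "\<And>f. norm (reconstruction X f) \<le> t * norm f"
      using strict_row_contraction_reconstruction[OF strict] by blast
    note R = bounded_clinear_reconstruction[OF X]
    have "0 \<le> (1 - t) / (1 + t) * (norm (\<Sum>j<m. unit_vec (b j) (x j)))\<^sup>2"
      using t by simp
    also have "\<dots> \<le> poisson_form 1 (reconstruction X) (\<Sum>j<m. unit_vec (b j) (x j))"
      by (rule poisson_form_contraction[OF R t])
    \<comment> \<open>At parameter 1 the correction by the zero tuple vanishes, so
      \<open>rho_form\<close> is just \<open>poly_form\<close>.\<close>
    also have "\<dots> = rho_form 1 m (kernel_poly b) X x"
      by (rule rho_form_kernel_poly[OF X power_stable_contraction[OF R t] inj, symmetric])
    finally show ?thesis by (simp add: rho_form_def)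
  qed
  define s where "s F = (\<Sum>w\<in>F. unit_vec w (Rep_ell2 f w))" for F
  have "poisson_form \<rho> (reconstruction A) (s F) \<le> c\<^sup>2 * poisson_form \<rho> (reconstruction B) (s F)"
    if F: "finite F" for F
  proof -
    have dom': "\<forall>x. rho_form \<rho> m p A x \<le> c\<^sup>2 * rho_form \<rho> m p B x"
      if "is_ncpoly m p"
        and "\<And>X x. X \<in> (strict_row_contractions :: ('n \<Rightarrow> 'k \<Rightarrow> 'k) set) \<Longrightarrow> 0 \<le> poly_form m p X x"
      for m p
    proof (rule mp[OF spec[OF spec[OF iffD1[OF harnack_dom_iff[OF A(1) B(1)] dom]]]])
      show "is_ncpoly m p \<and>
          (\<forall>X\<in>(strict_row_contractions :: ('n \<Rightarrow> 'k \<Rightarrow> 'k) set). \<forall>x. 0 \<le> poly_form m p X x)"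
        using that by simp
    qed
    obtain b where b: "bij_betw b {..<card F} F"
      using ex_bij_betw_nat_finite[OF F] by (auto simp: atLeast0LessThan)
    then have inj: "inj_on b {..<card F}" by (rule bij_betw_imp_inj_on)
    define x where "x j = Rep_ell2 f (b j)" for j
    have sF: "s F = (\<Sum>j<card F. unit_vec (b j) (x j))"
      unfolding s_def x_def by (rule sum.reindex_bij_betw[OF b, symmetric])
    have "rho_form \<rho> (card F) (kernel_poly b) A x \<le> c\<^sup>2 * rho_form \<rho> (card F) (kernel_poly b) B x"
      by (rule spec[OF dom'[OF is_ncpoly_kernel_poly pos[OF _ inj]]])
    then show ?thesis
      unfolding sF rho_form_kernel_poly[OF A inj] rho_form_kernel_poly[OF B inj] .
  qed
  then have ev: "\<forall>\<^sub>F F in finite_subsets_at_top UNIV.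
      poisson_form \<rho> (reconstruction A) (s F) \<le> c\<^sup>2 * poisson_form \<rho> (reconstruction B) (s F)"
    by (rule eventually_finite_subsets_at_top_weakI)
  have lim: "(s \<longlongrightarrow> f) (finite_subsets_at_top UNIV)"
    using ell2_sums_unit_vecs[of f] by (simp add: has_sum_def s_def[abs_def])
  have "((\<lambda>F. poisson_form \<rho> R (s F)) \<longlongrightarrow> poisson_form \<rho> R f) (finite_subsets_at_top UNIV)"
    if "power_stable R" for R
    unfolding poisson_form_def
    by (rule tendsto_add[OF tendsto_mult_left[OF tendsto_power[OF tendsto_norm[OF lim]]]
        tendsto_mult_left[OF tendsto_inner[OF bounded_linear.tendsto[OF
          clinear_simps(1)[OF bounded_clinear_neumann[OF that]] lim] lim]]])
  note cont = this
  show ?thesis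
  proof (rule tendsto_le)
    show "((\<lambda>F. poisson_form \<rho> (reconstruction A) (s F))
        \<longlongrightarrow> poisson_form \<rho> (reconstruction A) f) (finite_subsets_at_top UNIV)"
      by (rule cont[OF A(2)])
    show "((\<lambda>F. c\<^sup>2 * poisson_form \<rho> (reconstruction B) (s F))
        \<longlongrightarrow> c\<^sup>2 * poisson_form \<rho> (reconstruction B) f) (finite_subsets_at_top UNIV)"
      by (rule tendsto_mult_left[OF cont[OF B(2)]])
  qed (use ev in simp_all)
qed

section \<open>From the order of Poisson kernels to domination\<close>

text \<open>Prepends a letter. Unlike \<open>right_creation\<close> it is set up directly on
  vector-valued families, as the left creation operator tensored with the identity.\<close>

lift_definition left_creation :: "'n \<Rightarrow> ('n list, 'a::chilbert_space) ell2 \<Rightarrow> ('n list, 'a) ell2"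
  is "\<lambda>i f w. if w \<noteq> [] \<and> hd w = i then f (tl w) else 0"
proof -
  fix i :: 'n and f :: "'n list \<Rightarrow> 'a"
  assume f: "(\<lambda>w. (norm (f w))\<^sup>2) summable_on UNIV"
  let ?g = "\<lambda>w. (norm (if w \<noteq> [] \<and> hd w = i then f (tl w) else 0))\<^sup>2"
  have "?g summable_on range (Cons i)"
    using f by (simp add: summable_on_reindex o_def)
  then show "?g summable_on UNIV"
  proof (rule summable_on_cong_neutral[THEN iffD1, rotated -1])
    fix w assume "w \<in> UNIV - range (Cons i)"
    then show "?g w = 0" by (cases w) auto
  qed auto
qed

lemma cinner_left_creation:
  "cinner (left_creation i f) (left_creation j g) = (if i = j then cinner f g else 0)"
proof (cases "i = j")
  case True
  have "cinner (left_creation i f) (left_creation i g) =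
      (\<Sum>\<^sub>\<infinity>w\<in>range (Cons i). cinner (Rep_ell2 (left_creation i f) w) (Rep_ell2 (left_creation i g) w))"
    unfolding cinner_ell2.rep_eq
  proof (rule infsum_cong_neutral)
    fix w assume "w \<in> UNIV - range (Cons i)"
    then show "cinner (Rep_ell2 (left_creation i f) w) (Rep_ell2 (left_creation i g) w) = 0"
      by (cases w) (auto simp: left_creation.rep_eq)
  qed auto
  also have "\<dots> = cinner f g"
    by (subst infsum_reindex) (simp_all add: o_def left_creation.rep_eq cinner_ell2.rep_eq)
  finally show ?thesis using True by simp
next
  case False
  then have "cinner (Rep_ell2 (left_creation i f) w) (Rep_ell2 (left_creation j g) w) = 0" for w
    by (simp add: left_creation.rep_eq)
  then show ?thesis using False by (simp add: cinner_ell2.rep_eq)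
qed

lemma bounded_clinear_left_creation: "bounded_clinear (left_creation i)"
proof (rule bounded_clinearI[where K = 1])
  show "left_creation i (f + g) = left_creation i f + left_creation i g" for f g :: "('a list, 'b) ell2"
    by (rule ell2_eqI) (simp add: left_creation.rep_eq plus_ell2.rep_eq)
  show "left_creation i (c *\<^sub>C f) = c *\<^sub>C left_creation i f" for c and f :: "('a list, 'b) ell2"
    by (rule ell2_eqI) (simp add: left_creation.rep_eq scaleC_ell2.rep_eq complex_vector.scale_zero_right)
  show "norm (left_creation i f) \<le> norm f * 1" for f :: "('a list, 'b) ell2"
    using cinner_left_creation[of i f i f] by (simp add: norm_eq_sqrt_inner flip: Re_cinner)
qed

lemma left_creation_unit_vec: "left_creation i (unit_vec w h) = unit_vec (i # w) h"
proof (rule ell2_eqI)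
  show "Rep_ell2 (left_creation i (unit_vec w h)) v = Rep_ell2 (unit_vec (i # w) h) v" for v
    by (cases v) (auto simp: left_creation.rep_eq unit_vec.rep_eq)
qed

text \<open>One operator acts on the first letter, the other on the last, so they commute; on words
  with at most one letter both sides vanish.\<close>

lemma reconstruction_left_creation:
  assumes A: "\<And>i. bounded_clinear (A i)"
  shows "reconstruction A (left_creation i f) = left_creation i (reconstruction A f)"
proof (rule ell2_eqI)
  fix w
  show "Rep_ell2 (reconstruction A (left_creation i f)) w =
      Rep_ell2 (left_creation i (reconstruction A f)) w"
    using clinear_simps(4)[OF bounded_clinear_cadj[OF A]]
    by (cases w) (auto simp: reconstruction_rep[OF A] left_creation.rep_eq)
qed

lemma neumann_left_creation:
  assumes A: "\<And>i. bounded_clinear (A i)" and ps: "power_stable (reconstruction A)"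
  shows "neumann (reconstruction A) (left_creation i f) =
    left_creation i (neumann (reconstruction A) f)"
proof -
  have "(reconstruction A ^^ k) (left_creation i f) = left_creation i ((reconstruction A ^^ k) f)" for k
    by (induction k) (simp_all add: reconstruction_left_creation[OF A])
  then have "(\<lambda>k. left_creation i ((reconstruction A ^^ k) f)) sums
      neumann (reconstruction A) (left_creation i f)"
    using neumann_sums[OF ps, of "left_creation i f"] by simp
  then show ?thesis
    using bounded_linear.sums[OF clinear_simps(1)[OF bounded_clinear_left_creation]
        neumann_sums[OF ps]] sums_unique2 by blast
qed

text \<open>The multi-Toeplitz property. The resolvent commutes with left creation; its adjoint need
  not, and is moved to the other argument first.\<close>

lemma cinner_poisson_left_creation:
  assumes A: "\<And>i. bounded_clinear (A i)" and ps: "power_stable (reconstruction A)"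
  shows "cinner (poisson \<rho> (reconstruction A) (left_creation i f)) (left_creation j g) =
    (if i = j then cinner (poisson \<rho> (reconstruction A) f) g else 0)"
  unfolding poisson_def
  by (simp add: cinner_add_left cinner_scaleR_left cadj_eq'[OF bounded_clinear_neumann[OF ps]]
      neumann_left_creation[OF A ps] cinner_left_creation)

text \<open>Against the vacuum the kernel returns monomials. For nonempty \<open>\<alpha>\<close>
  only the adjoint resolvent contributes; for the empty word
  \<open>(\<rho> - 2) + 1 + 1 = 1 + (\<rho> - 1)\<close>.\<close>

lemma cinner_poisson_unit_vec:
  assumes A: "\<And>i. bounded_clinear (A i)" and ps: "power_stable (reconstruction A)"
  shows "cinner (poisson \<rho> (reconstruction A) (unit_vec \<alpha> h)) (unit_vec [] g) =
    cinner (word_op A \<alpha> h) g + of_real (\<rho> - 1) * cinner (word_op (\<lambda>_ _. 0) \<alpha> h) g"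
proof -
  have "cinner (unit_vec \<alpha> h) (neumann (reconstruction A) (unit_vec [] g)) =
      cnj (cinner (neumann (reconstruction A) (unit_vec [] g)) (unit_vec \<alpha> h))"
    by (rule cinner_commute)
  also have "\<dots> = cinner (word_op A \<alpha> h) g"
    by (simp add: neumann_unit_vec[OF A ps] flip: cinner_commute)
  finally have adj: "cinner (unit_vec \<alpha> h) (neumann (reconstruction A) (unit_vec [] g)) =
      cinner (word_op A \<alpha> h) g" .
  show ?thesis
    unfolding poisson_def cinner_add_left cinner_scaleR_left
      cadj_eq'[OF bounded_clinear_neumann[OF ps]] adj neumann_unit_vec[OF A ps]
    by (cases \<alpha>) (simp_all add: cinner_unit_vec unit_vec.rep_eq algebra_simps)
qed

section \<open>Evaluating polynomials at row contractions\<close>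

text \<open>The row bound followed by the column bound gives \<open>r\<^sup>2\<close> for the norm
  of the operator in the definition.\<close>

lemma strict_row_contractionI:
  fixes X :: "'n::finite \<Rightarrow> 'a::chilbert_space \<Rightarrow> 'a"
  assumes X: "\<And>i. bounded_clinear (X i)" and r: "0 \<le> r" "r < 1"
    and row: "\<And>z. (norm (\<Sum>i\<in>UNIV. X i (z i)))\<^sup>2 \<le> r\<^sup>2 * (\<Sum>i\<in>UNIV. (norm (z i))\<^sup>2)"
  shows "X \<in> strict_row_contractions"
proof -
  have "norm (\<Sum>i\<in>UNIV. X i (cadj (X i) y)) \<le> r\<^sup>2 * norm y" for y
  proof (rule power2_le_imp_le)
    have "(norm (\<Sum>i\<in>UNIV. X i (cadj (X i) y)))\<^sup>2
        \<le> r\<^sup>2 * (\<Sum>i\<in>UNIV. (norm (cadj (X i) y))\<^sup>2)" by (rule row)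
    also have "\<dots> \<le> r\<^sup>2 * (r\<^sup>2 * (norm y)\<^sup>2)"
      by (intro mult_left_mono column_bound[OF X row]) simp
    finally show "(norm (\<Sum>i\<in>UNIV. X i (cadj (X i) y)))\<^sup>2 \<le> (r\<^sup>2 * norm y)\<^sup>2"
      by (simp add: power2_eq_square mult_ac)
  qed (use r in simp)
  then have "onorm (\<lambda>x. \<Sum>i\<in>UNIV. X i (cadj (X i) x)) \<le> r\<^sup>2"
    by (intro onorm_bound) simp_all
  also have "r\<^sup>2 < 1" using r by (simp add: power_less_one_iff)
  finally show ?thesis using X by (simp add: strict_row_contractions_def)
qed

text \<open>
  A polynomial only sees the finite-dimensional span of the vectors obtained by applying its
  monomials, and the compression of the tuple to that span can be transplanted to any
  infinite-dimensional space.
\<close>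

lemma poly_form_row_contraction_nonneg:
  fixes V :: "'n::finite \<Rightarrow> 'a::chilbert_space \<Rightarrow> 'a"
  assumes inf: "infinite_dimensional TYPE('k::chilbert_space)" and p: "is_ncpoly m p"
    and pos: "\<And>X x. X \<in> (strict_row_contractions :: ('n \<Rightarrow> 'k \<Rightarrow> 'k) set) \<Longrightarrow> 0 \<le> poly_form m p X x"
    and V: "\<And>i. bounded_clinear (V i)"
    and row: "\<And>z. (norm (\<Sum>i\<in>UNIV. V i (z i)))\<^sup>2 \<le> (\<Sum>i\<in>UNIV. (norm (z i))\<^sup>2)"
  shows "0 \<le> poly_form m p V y"
proof -
  define N where "N = Max (length ` {\<alpha>. \<exists>i<m. \<exists>j<m. p \<alpha> i j \<noteq> 0})"
  have N: "length \<alpha> \<le> N" if "p \<alpha> i j \<noteq> 0" "i < m" "j < m" for \<alpha> i j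
    unfolding N_def using p that by (intro Max_ge) (auto simp: is_ncpoly_def)
  \<comment> \<open>All words up to the degree are included, not only those occurring in
    \<open>p\<close>: the induction below removes \<open>Q (cadj Q _)\<close> after every suffix of
    a word.\<close>
  define F where "F = (\<lambda>(\<alpha>, j). word_op V \<alpha> (y j)) ` ({\<alpha>. length \<alpha> \<le> N} \<times> {..<m})"
  have "finite {\<alpha> :: 'n list. length \<alpha> \<le> N}"
    using finite_lists_length_le[of "UNIV :: 'n set" N] by simp
  then have "finite F" unfolding F_def by (intro finite_imageI finite_cartesian_product) auto
  then obtain Q :: "'k \<Rightarrow> 'a" where Q: "bounded_clinear Q" "\<And>z. norm (Q z) \<le> norm z"
    "\<And>y. norm (cadj Q y) \<le> norm y" "\<And>y. y \<in> F \<Longrightarrow> Q (cadj Q y) = y"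
    using finite_set_coisometry[OF inf] by blast
  have QF: "Q (cadj Q (word_op V \<alpha> (y j))) = word_op V \<alpha> (y j)" if "length \<alpha> \<le> N" "j < m" for \<alpha> j
    using that by (intro Q(4)) (auto simp: F_def)
  note Q' = bounded_clinear_cadj[OF Q(1)]
  \<comment> \<open>\<open>G r\<close> is the value at the tuple scaled by \<open>r\<close>.
    Positivity is known for \<open>r < 1\<close>, where the tuple is strict, and passes to
    \<open>r = 1\<close> by continuity.\<close>
  define G where "G r = (\<Sum>i<m. \<Sum>j<m. \<Sum>\<alpha> | p \<alpha> i j \<noteq> 0.
    p \<alpha> i j * (of_real (r ^ length \<alpha>) * cinner (word_op V \<alpha> (y j)) (y i)))" for r :: real
  have G: "0 \<le> Re (G r)" if r: "0 \<le> r" "r < 1" for r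
  proof -
    define X where "X i z = r *\<^sub>R cadj Q (V i (Q z))" for i z
    have X: "bounded_clinear (X i)" for i
      unfolding X_def
      by (intro bounded_clinear_scaleR bounded_clinear_compose[OF Q'] bounded_clinear_compose[OF V] Q)
    have "X \<in> strict_row_contractions"
    proof (rule strict_row_contractionI[OF X r])
      fix z
      have "(\<Sum>i\<in>UNIV. X i (z i)) = r *\<^sub>R cadj Q (\<Sum>i\<in>UNIV. V i (Q (z i)))"
        by (simp add: X_def clinear_simps(6)[OF Q'] scaleR_sum_right)
      then have "(norm (\<Sum>i\<in>UNIV. X i (z i)))\<^sup>2 = r\<^sup>2 * (norm (cadj Q (\<Sum>i\<in>UNIV. V i (Q (z i)))))\<^sup>2"
        by (simp add: power_mult_distrib)
      also have "\<dots> \<le> r\<^sup>2 * (norm (\<Sum>i\<in>UNIV. V i (Q (z i))))\<^sup>2"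
        by (intro mult_left_mono power_mono Q) auto
      also have "\<dots> \<le> r\<^sup>2 * (\<Sum>i\<in>UNIV. (norm (Q (z i)))\<^sup>2)"
        by (intro mult_left_mono row) simp
      also have "\<dots> \<le> r\<^sup>2 * (\<Sum>i\<in>UNIV. (norm (z i))\<^sup>2)"
        by (intro mult_left_mono sum_mono power_mono Q) auto
      finally show "(norm (\<Sum>i\<in>UNIV. X i (z i)))\<^sup>2 \<le> r\<^sup>2 * (\<Sum>i\<in>UNIV. (norm (z i))\<^sup>2)" .
    qed
    then have nonneg: "0 \<le> poly_form m p X (\<lambda>j. cadj Q (y j))" by (rule pos)
    have "word_op X \<alpha> (cadj Q (y j)) = r ^ length \<alpha> *\<^sub>R cadj Q (word_op V \<alpha> (y j))"
      if "length \<alpha> \<le> N" "j < m" for \<alpha> j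
      using that
    proof (induction \<alpha>)
      case (Cons i \<alpha>)
      then show ?case
        using QF[of \<alpha> j]
        by (simp add: X_def linear_simps[OF clinear_simps(1)[OF Q(1)]]
            linear_simps[OF clinear_simps(1)[OF V]] linear_simps[OF clinear_simps(1)[OF Q']])
    qed simp
    moreover have "cinner (cadj Q (word_op V \<alpha> (y j))) (cadj Q (y i)) = cinner (word_op V \<alpha> (y j)) (y i)"
      if "length \<alpha> \<le> N" "j < m" for \<alpha> i j
      using cadj_eq[OF Q(1), of "cadj Q (word_op V \<alpha> (y j))" "y i"] QF[OF that] by simp
    ultimately have "cinner (word_op X \<alpha> (cadj Q (y j))) (cadj Q (y i)) =
        of_real (r ^ length \<alpha>) * cinner (word_op V \<alpha> (y j)) (y i)"
      if "length \<alpha> \<le> N" "j < m" for \<alpha> i j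
      using that by (simp add: cinner_scaleR_left del: of_real_power)
    then have "poly_form m p X (\<lambda>j. cadj Q (y j)) = Re (G r)"
      unfolding poly_form_eq G_def by (intro arg_cong[of _ _ Re] sum.cong refl) (use N in auto)
    then show ?thesis using nonneg by simp
  qed
  have "((\<lambda>r. Re (G r)) \<longlongrightarrow> Re (G 1)) (at_left 1)"
    unfolding G_def by (intro tendsto_intros)
  moreover have "\<forall>\<^sub>F r in at_left 1. 0 \<le> Re (G r)"
    using eventually_at_left_real[of 0 1] by (rule eventually_mono) (use G in auto)
  ultimately have "0 \<le> Re (G 1)"
    by (intro tendsto_lowerbound) auto
  then show ?thesis by (simp add: poly_form_eq G_def)
qed

text \<open>The kernel difference \<open>D\<close> is used as a new inner product in which left
  creation is isometric. Evaluating \<open>p\<close> at this row of isometries, on vacuum vectors,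
  reproduces \<open>s\<^sup>2 * rho_form \<rho> m p B x - rho_form \<rho> m p A x\<close>.\<close>

lemma poisson_imp_harnack_dom:
  fixes A B :: "'n::finite \<Rightarrow> 'h::chilbert_space \<Rightarrow> 'h"
  assumes inf: "infinite_dimensional TYPE('k::chilbert_space)"
    and A: "\<And>i. bounded_clinear (A i)" "power_stable (reconstruction A)"
    and B: "\<And>i. bounded_clinear (B i)" "power_stable (reconstruction B)"
    and e: "0 < e" "\<And>f. e * (norm f)\<^sup>2 \<le> poisson_form \<rho> (reconstruction B) f"
    and "0 \<le> c"
    and le: "\<And>f. poisson_form \<rho> (reconstruction A) f \<le> c\<^sup>2 * poisson_form \<rho> (reconstruction B) f"
  shows "harnack_dom TYPE('k) \<rho> c A B"
  unfolding harnack_dom_iff[OF A(1) B(1)]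
proof (intro allI impI, elim conjE)
  fix m p and x :: "nat \<Rightarrow> 'h"
  assume p: "is_ncpoly m p"
    and pos: "\<forall>X\<in>(strict_row_contractions :: ('n \<Rightarrow> 'k \<Rightarrow> 'k) set). \<forall>x. 0 \<le> poly_form m p X x"
  txt \<open>Enlarging \<open>c\<close> makes the difference of the Poisson kernels invertible.\<close>
  have strict: "rho_form \<rho> m p A x \<le> s\<^sup>2 * rho_form \<rho> m p B x" if "c < s" for s
  proof -
    define KA where "KA = poisson \<rho> (reconstruction A)"
    define KB where "KB = poisson \<rho> (reconstruction B)"
    define D where "D f = s\<^sup>2 *\<^sub>R KB f - KA f" for f
    have D: "bounded_clinear D"
      unfolding D_def KA_def KB_def
      by (intro bounded_clinear_diff bounded_clinear_scaleR bounded_clinear_poisson A B)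
    have self: "cinner (D f) g = cinner f (D g)" for f g
      by (simp add: D_def KA_def KB_def cinner_diff_left cinner_diff_right cinner_scaleR_left
          cinner_scaleR_right poisson_self_adjoint[OF A(2)] poisson_self_adjoint[OF B(2)])
    have "c\<^sup>2 < s\<^sup>2" using that \<open>0 \<le> c\<close> by (intro power_strict_mono) auto
    have lower: "(s\<^sup>2 - c\<^sup>2) * e * (norm f)\<^sup>2 \<le> inner (D f) f" for f
    proof -
      have "(s\<^sup>2 - c\<^sup>2) * (e * (norm f)\<^sup>2) \<le> (s\<^sup>2 - c\<^sup>2) * poisson_form \<rho> (reconstruction B) f"
        using \<open>c\<^sup>2 < s\<^sup>2\<close> by (intro mult_left_mono e) simp
      also have "\<dots> \<le> s\<^sup>2 * poisson_form \<rho> (reconstruction B) f - poisson_form \<rho> (reconstruction A) f"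
        using le[of f] by (simp add: algebra_simps)
      also have "\<dots> = inner (D f) f"
        by (simp add: D_def KA_def KB_def inner_diff_left inner_poisson[OF A(2)] inner_poisson[OF B(2)])
      finally show ?thesis by (simp add: mult.assoc)
    qed
    have "0 < (s\<^sup>2 - c\<^sup>2) * e" using \<open>c\<^sup>2 < s\<^sup>2\<close> e(1) by simp
    then obtain d where d: "bounded_clinear (op_sqrt D)"
      "\<And>x y. cinner (op_sqrt D x) y = cinner x (op_sqrt D y)" "\<And>x. op_sqrt D (op_sqrt D x) = D x"
      "0 < d" "\<And>x. d * (norm x)\<^sup>2 \<le> inner (op_sqrt D x) x"
      using op_sqrt_lower_bound[OF D self _ lower] by blast
    define S where "S = op_sqrt D"
    note S = d[folded S_def]
    have "bij S" by (rule bij_lower_bound[OF clinear_simps(1)[OF S(1)] S(4,5)])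
    then have IS: "inv S (S f) = f" and SI: "S (inv S f) = f" for f
      by (simp_all add: bij_is_inj bij_is_surj surj_f_inv_f)
    have "d * norm f \<le> norm (S f)" for f
    proof -
      have "norm f * (d * norm f) \<le> norm f * norm (S f)"
        using order_trans[OF S(5) norm_cauchy_schwarz, of f] by (simp add: power2_eq_square mult_ac)
      then show ?thesis by (cases "f = 0") (auto simp: mult_le_cancel_left)
    qed
    then have I: "bounded_clinear (inv S)"
      by (rule inv_lower_bound(1)[OF S(1) \<open>bij S\<close> S(4)])
    have SS: "cinner (S f) (S g) = cinner (D f) g" for f g by (simp only: S(2,3)) (simp only: self)
    \<comment> \<open>Conjugation by the root \<open>S\<close> of \<open>D\<close> turns isometries
      for the form of \<open>D\<close> into isometries for the given inner product.\<close>
    define V where "V i f = S (left_creation i (inv S f))" for i f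
    have V: "bounded_clinear (V i)" for i
      unfolding V_def
      by (intro bounded_clinear_compose[OF S(1)] bounded_clinear_compose[OF bounded_clinear_left_creation] I)
    have VV: "cinner (V i f) (V j g) = (if i = j then cinner f g else 0)" for i j f g
    proof -
      have "cinner (V i f) (V j g) = (if i = j then cinner (D (inv S f)) (inv S g) else 0)"
        by (simp add: V_def SS) (simp add: D_def KA_def KB_def cinner_diff_left cinner_scaleR_left
            cinner_poisson_left_creation[OF A] cinner_poisson_left_creation[OF B])
      also have "cinner (D (inv S f)) (inv S g) = cinner f g" by (simp add: SI flip: SS)
      finally show ?thesis .
    qed
    have row: "(norm (\<Sum>i\<in>UNIV. V i (z i)))\<^sup>2 \<le> (\<Sum>i\<in>UNIV. (norm (z i))\<^sup>2)" for z
    proof -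
      have "norm (V i f) = norm f" for i f
        using VV[of i f i f] by (simp add: norm_eq_sqrt_inner flip: Re_cinner)
      then show ?thesis
        using norm_sum_orthogonal[of "\<lambda>i. V i (z i)"] by (simp add: VV)
    qed
    \<comment> \<open>The vacuum vectors are chosen because words of \<open>V\<close> map them to
      \<open>S (unit_vec \<alpha> (x j))\<close>, whose pairings with the vacuum are
      monomials.\<close>
    define y where "y j = S (unit_vec [] (x j))" for j
    have word: "word_op V \<alpha> (y j) = S (unit_vec \<alpha> (x j))" for \<alpha> j
      by (induction \<alpha>) (simp_all add: y_def V_def IS left_creation_unit_vec)
    have gram: "cinner (word_op V \<alpha> (y j)) (y i) =
        of_real (s\<^sup>2) * (cinner (word_op B \<alpha> (x j)) (x i)
          + of_real (\<rho> - 1) * cinner (word_op (\<lambda>_ _. 0) \<alpha> (x j)) (x i))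
        - (cinner (word_op A \<alpha> (x j)) (x i)
          + of_real (\<rho> - 1) * cinner (word_op (\<lambda>_ _. 0) \<alpha> (x j)) (x i))" for \<alpha> i j
      unfolding word unfolding y_def SS D_def KA_def KB_def cinner_diff_left cinner_scaleR_left
        cinner_poisson_unit_vec[OF A] cinner_poisson_unit_vec[OF B] ..
    have "poly_form m p V y = s\<^sup>2 * rho_form \<rho> m p B x - rho_form \<rho> m p A x"
      unfolding rho_form_def poly_form_eq gram
      by (simp add: algebra_simps sum.distrib sum_subtractf sum_distrib_left)
    moreover have "0 \<le> poly_form m p V y"
      using pos by (intro poly_form_row_contraction_nonneg[OF inf p _ V row]) blast
    ultimately show ?thesis by simp
  qed
  have "((\<lambda>s. s\<^sup>2 * rho_form \<rho> m p B x) \<longlongrightarrow> c\<^sup>2 * rho_form \<rho> m p B x) (at_right c)"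
    by (intro tendsto_intros)
  moreover have "\<forall>\<^sub>F s in at_right c. rho_form \<rho> m p A x \<le> s\<^sup>2 * rho_form \<rho> m p B x"
    using eventually_at_right_less[of c] by (rule eventually_mono) (rule strict)
  ultimately show "rho_form \<rho> m p A x \<le> c\<^sup>2 * rho_form \<rho> m p B x"
    by (intro tendsto_lowerbound) auto
qed

section \<open>Domination as a norm bound, and the distance formula\<close>

lemma harnack_dom_iff_onorm:
  fixes X Y :: "'n::finite \<Rightarrow> 'h::chilbert_space \<Rightarrow> 'h"
  assumes "infinite_dimensional TYPE('k::chilbert_space)" and rho: "0 < \<rho>"
    and X: "X \<in> rho_ball \<rho>" and Y: "Y \<in> rho_ball \<rho>" and c: "0 \<le> c"
  shows "harnack_dom TYPE('k) \<rho> c X Y \<longleftrightarrow> onorm (C_op \<rho> X \<circ> inv (C_op \<rho> Y)) \<le> c"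
proof -
  have lin: "\<And>i. bounded_clinear (X i)" "\<And>i. bounded_clinear (Y i)"
    using X Y by (auto simp: rho_ball_def)
  note ps = rho_ball_bounds(1)[OF rho X] rho_ball_bounds(1)[OF rho Y]
  obtain e where e: "0 < e" "\<And>f. e * (norm f)\<^sup>2 \<le> poisson_form \<rho> (reconstruction Y) f"
    using rho_ball_bounds(2)[OF rho Y] by blast
  show ?thesis
    unfolding C_op_quotient(3)[OF rho X Y c]
    using harnack_dom_imp_poisson[OF lin(1) ps(1) lin(2) ps(2)]
      poisson_imp_harnack_dom[OF assms(1) lin(1) ps(1) lin(2) ps(2) e c] by blast
qed

theorem theorem3p5:
  fixes X Y :: "'n::finite \<Rightarrow> 'h::chilbert_space \<Rightarrow> 'h" and \<rho> :: real
  assumes "infinite_dimensional TYPE('k::chilbert_space)"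
    and "\<rho> > 0"
    and "X \<in> rho_ball \<rho>" and "Y \<in> rho_ball \<rho>"
  shows "hyperbolic_dist TYPE('k) \<rho> X Y =
    ln (max (onorm (C_op \<rho> X \<circ> inv (C_op \<rho> Y))) (onorm (C_op \<rho> Y \<circ> inv (C_op \<rho> X))))"
proof -
  define S where "S = C_op \<rho> X \<circ> inv (C_op \<rho> Y)"
  define T where "T = C_op \<rho> Y \<circ> inv (C_op \<rho> X)"
  define M where "M = max (onorm S) (onorm T)"
  have S: "bounded_linear S"
    unfolding S_def by (rule C_op_quotient(1)[OF assms(2-4)])
  have T: "bounded_linear T"
    unfolding T_def by (rule C_op_quotient(1)[OF assms(2,4,3)])
  have ST: "S (T f) = f" for f
    unfolding S_def T_def by (rule C_op_quotient(2)[OF assms(2-4)])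
  have "harnack_equiv TYPE('k) \<rho> c X Y \<longleftrightarrow> M \<le> c" if "1 < c" for c
    unfolding harnack_equiv_def M_def S_def T_def
    using harnack_dom_iff_onorm[OF assms, of c] harnack_dom_iff_onorm[OF assms(1,2,4,3), of c] that
    by auto
  then have set: "{c. 1 < c \<and> harnack_equiv TYPE('k) \<rho> c X Y} = {c. 1 < c \<and> M \<le> c}" by auto
  show ?thesis
  proof (cases "\<exists>f :: ('n list, 'h) ell2. f \<noteq> 0")
    case True
    then obtain f :: "('n list, 'h) ell2" where "f \<noteq> 0" by blast
    \<comment> \<open>\<open>S\<close> and \<open>T\<close> invert each other, so on a nonzero space
      the product of their norms is at least 1, whence \<open>M\<close> is at least 1.\<close>
    have "norm f \<le> onorm S * norm (T f)" using onorm[OF S, of "T f"] by (simp add: ST)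
    also have "\<dots> \<le> onorm S * (onorm T * norm f)"
      by (intro mult_left_mono onorm[OF T] onorm_pos_le[OF S])
    finally have "1 * norm f \<le> (onorm S * onorm T) * norm f" by (simp add: mult.assoc)
    then have "1 \<le> onorm S * onorm T" using \<open>f \<noteq> 0\<close> by (simp only: mult_le_cancel_right) auto
    also have "\<dots> \<le> M * M"
      using onorm_pos_le[OF S] onorm_pos_le[OF T] by (intro mult_mono) (auto simp: M_def)
    finally have "1 \<le> M"
      using onorm_pos_le[OF S] by (metis M_def abs_le_square_iff abs_of_nonneg max.coboundedI1
          mult.left_neutral one_power2 power2_eq_square zero_le_one)
    \<comment> \<open>For \<open>M = 1\<close> the strict bound \<open>1 < c\<close> excludes
      \<open>M\<close> itself, but the infimum is the same.\<close>
    have "Inf {c. 1 < c \<and> M \<le> c} = M"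
    proof (cases "M = 1")
      case True
      then have "{c. 1 < c \<and> M \<le> c} = {1<..}" by auto
      then show ?thesis using True by simp
    next
      case False
      then have "{c. 1 < c \<and> M \<le> c} = {M..}" using \<open>1 \<le> M\<close> by auto
      then show ?thesis by simp
    qed
    then show ?thesis
      unfolding hyperbolic_dist_def set M_def S_def T_def by simp
  next
    case False
    txt \<open>On the zero space both norms are \<open>0\<close>, and \<open>ln 0 = 0 = ln 1\<close>.\<close>
    then have "S f = 0" "T f = 0" for f by blast+
    then have "onorm S \<le> 0" "onorm T \<le> 0" by (auto intro!: onorm_bound)
    then have M: "M = 0"
      using onorm_pos_le[OF S] onorm_pos_le[OF T] by (simp add: M_def)
    then have "{c. 1 < c \<and> M \<le> c} = {1<..}" by auto
    then have "hyperbolic_dist TYPE('k) \<rho> X Y = ln M"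
      unfolding hyperbolic_dist_def set by (simp add: M)
    then show ?thesis unfolding M_def S_def T_def .
  qed
qed

end
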